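(* There exists a constant $K_1\ge1$ depending only on the dimension $d$ such that for all $M>0$, all $\delta\in(0,M/2)$, all $(M,\delta)$-equidistributed sequences $Z$, all measurable and bounded $V\colon\mathbb{R}^d\to\mathbb{R}$, and all real-valued $\psi\in W^{2,2}(\mathbb{R}^d)$ we have \[ \left(\frac{\delta}{M}\right)^{K_1\left(1+M^{4/3}\lVert V\rVert_\infty^{2/3}\right)}\lVert\psi\rVert^2\le\lVert W_{\delta,Z}\psi\rVert^2+\delta^2M^2\lVert-\Delta\psi+V\psi\rVert^2 . \]
   Context: For $M>0$ and $k\in\mathbb{R}^d$ let $\Lambda_M(k):=k+(-M/2,M/2)^d$, and let $B(z,\delta)=\{x\in\mathbb{R}^d:\lvert x-z\rvert_2<\delta\}$. Given $M,\delta>0$, a sequence $Z=(z_k)_{k\in(M\mathbb{Z})^d}\subset\mathbb{R}^d$ is called $(M,\delta)$-equidistributed if $B(z_k,\delta)\subset\Lambda_M(k)$ for all $k\in(M\mathbb{Z})^d$. For such $Z$ set $S_{\delta,Z}=\bigcup_{k\in(M\mathbb{Z})^d}B(z_k,\delta)$ and $W_{\delta,Z}=\chi_{S_{\delta,Z}}$ (indicator function, acting as a multiplication operator). $\lVert\cdot\rVert$ denotes the $L^2(\mathbb{R}^d)$-norm. *)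

theory Defs
  imports "HOL-Analysis.Analysis" "HOL-Probability.Essential_Supremum"
begin

text \<open>Smooth (C-infinity) real functions on a Euclidean space: membership in a class of
  everywhere differentiable functions closed under taking partial derivatives.\<close>
definition smooth_fun :: "('a::euclidean_space \<Rightarrow> real) \<Rightarrow> bool" where
  "smooth_fun f \<longleftrightarrow> (\<exists>F. f \<in> F \<and>
     (\<forall>g\<in>F. \<exists>g'. (\<forall>x. (g has_derivative g' x) (at x)) \<and> (\<forall>b\<in>Basis. (\<lambda>x. g' x b) \<in> F)))"

definition test_fun :: "('a::euclidean_space \<Rightarrow> real) \<Rightarrow> bool" where
  "test_fun \<phi> \<longleftrightarrow> smooth_fun \<phi> \<and> compact (closure {x. \<phi> x \<noteq> 0})"

definition partial :: "'a::euclidean_space \<Rightarrow> ('a \<Rightarrow> real) \<Rightarrow> 'a \<Rightarrow> real" where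
  "partial b \<phi> x = frechet_derivative \<phi> (at x) b"

definition weak_deriv :: "('a::euclidean_space \<Rightarrow> real) \<Rightarrow> 'a \<Rightarrow> ('a \<Rightarrow> real) \<Rightarrow> bool" where
  "weak_deriv f b g \<longleftrightarrow> (\<forall>\<phi>. test_fun \<phi> \<longrightarrow>
      integrable lebesgue (\<lambda>x. f x * partial b \<phi> x) \<and> integrable lebesgue (\<lambda>x. g x * \<phi> x) \<and>
      (LINT x|lebesgue. f x * partial b \<phi> x) = - (LINT x|lebesgue. g x * \<phi> x))"

definition L2 :: "('a::euclidean_space \<Rightarrow> real) \<Rightarrow> bool" where
  "L2 f \<longleftrightarrow> f \<in> borel_measurable lebesgue \<and> integrable lebesgue (\<lambda>x. (f x)\<^sup>2)"

definition L2norm_sq :: "('a::euclidean_space \<Rightarrow> real) \<Rightarrow> real" where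
  "L2norm_sq f = (LINT x|lebesgue. (f x)\<^sup>2)"

definition W22 :: "('a::euclidean_space \<Rightarrow> real) \<Rightarrow> bool" where
  "W22 f \<longleftrightarrow> L2 f \<and> (\<forall>b\<in>Basis. \<exists>g. L2 g \<and> weak_deriv f b g \<and>
      (\<forall>c\<in>Basis. \<exists>h. L2 h \<and> weak_deriv g c h))"

definition is_laplacian :: "('a::euclidean_space \<Rightarrow> real) \<Rightarrow> ('a \<Rightarrow> real) \<Rightarrow> bool" where
  "is_laplacian f L \<longleftrightarrow> (\<exists>D1 D2. (\<forall>b\<in>Basis. weak_deriv f b (D1 b) \<and> weak_deriv (D1 b) b (D2 b))
      \<and> (\<forall>x. L x = (\<Sum>b\<in>Basis. D2 b x)))"

definition Linf_norm :: "('a::euclidean_space \<Rightarrow> real) \<Rightarrow> real" where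
  "Linf_norm V = real_of_ereal (esssup lebesgue (\<lambda>x. ereal \<bar>V x\<bar>))"

definition lattice :: "real \<Rightarrow> 'a::euclidean_space set" where
  "lattice M = {k. \<forall>b\<in>Basis. \<exists>z::int. k \<bullet> b = M * of_int z}"

definition cube :: "real \<Rightarrow> 'a::euclidean_space \<Rightarrow> 'a set" where
  "cube M k = {x. \<forall>b\<in>Basis. \<bar>(x - k) \<bullet> b\<bar> < M / 2}"

definition equidistributed :: "real \<Rightarrow> real \<Rightarrow> ('a::euclidean_space \<Rightarrow> 'a) \<Rightarrow> bool" where
  "equidistributed M \<delta> Z \<longleftrightarrow> (\<forall>k\<in>lattice M. ball (Z k) \<delta> \<subseteq> cube M k)"

definition S_set :: "real \<Rightarrow> real \<Rightarrow> ('a::euclidean_space \<Rightarrow> 'a) \<Rightarrow> 'a set" where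
  "S_set M \<delta> Z = (\<Union>k\<in>lattice M. ball (Z k) \<delta>)"

end

theory Submission
  imports Defs
begin

text \<open>By mollification and cutoff it suffices to treat twice differentiable \<open>\<psi>\<close> with compact support.
For such \<open>\<psi>\<close> one uses a Carleman estimate with weight \<open>w(r) = (e^{s r} / r)^\<alpha>\<close>, \<open>r = |x - z|\<close>, centred at a site
\<open>z = z_k\<close>, for functions supported in \<open>0 < r \<le> 1 / (2 s)\<close>:
\<open>\<alpha>^3 s / 2 * \<integral> w^2 f^2 / r \<le> \<integral> (r w \<Delta>f)^2\<close>. It is applied to \<open>f = \<theta> \<psi>\<close>, where \<open>\<theta>\<close> cuts off at the scale \<open>\<delta>\<close> near \<open>z\<close>
and at a fixed multiple of \<open>M\<close> away from \<open>z\<close>. The term with \<open>V\<close> is absorbed if \<open>\<alpha>^3\<close> is a large multiple of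
\<open>M^4 |V|^2\<close>, which gives the exponent \<open>M^{4/3} |V|^{2/3}\<close>. The inner cutoff error is controlled by \<open>\<psi>\<close> on the ball
\<open>B(z, \<delta>)\<close> through Caccioppoli's inequality, at the price of \<open>w(\<delta>/4)^2\<close>, a power of \<open>1/\<delta>\<close>.
One then sums over all sites: the outer cutoff errors add up to at most a multiple of \<open>|\<psi>|^2\<close> by bounded overlap,
and carry the factor \<open>(w(4R) / w(R))^2 \<le> 4^{-\<alpha>}\<close>, so they are absorbed by the left-hand side; no selection of
dominating sites is necessary.\<close>

subsection \<open>Convolution and the divergence theorem\<close>

text \<open>The factor \<open>e^{s r}\<close> is the source of positivity: for the pure power
  \<open>r^{-\<alpha>}\<close>, that is \<open>s = 0\<close>, all terms left over by the divergence
  vanish and nothing remains to absorb V. Its price is the restriction \<open>s r \<le> 1/2\<close>,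
  which ties \<open>s\<close> to the outer radius \<open>8 R\<close>; with \<open>R = d M\<close>
  and \<open>s = 1 / (16 R)\<close> all constants are dimensional. The potential enters the
  estimates only through \<open>|\<Delta>u| \<le> N |u| + |\<zeta>|\<close> with
  \<open>\<zeta> = - \<Delta>u + V u\<close>. The outer cutoff also produces
  \<open>|\<nabla>u|\<close> at distance comparable to \<open>M\<close> from the site. A local
  estimate there would enlarge the domain again, so this gradient is kept until after summation,
  when one global energy identity bounds it by \<open>u\<close> and \<open>\<zeta>\<close>. Since
  \<open>\<delta> / M < 1/2\<close>, every dimensional constant is at most a power of
  \<open>M / \<delta>\<close>, so all losses can be put into the exponent. The final inequality
  contains only \<open>\<psi>\<close> and \<open>\<Delta>\<psi>\<close>, so the approximation has to
  converge in these two alone.\<close>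

lemma integrable_compact_support:
  fixes F :: "'a::euclidean_space \<Rightarrow> 'b::euclidean_space"
  assumes "compact K" "continuous_on K F" "\<And>x. x \<notin> K \<Longrightarrow> F x = 0"
  shows "integrable lebesgue F"
proof -
  have "integrable lborel (\<lambda>x. indicator K x *\<^sub>R F x)"
    by (rule borel_integrable_compact[OF assms(1,2)])
  moreover have "(\<lambda>x. indicator K x *\<^sub>R F x) = F"
    using assms(3) by (auto simp: indicator_def fun_eq_iff)
  ultimately have "integrable lborel F" by simp
  then show ?thesis by (simp add: integrable_completion borel_measurable_integrable)
qed

text \<open>The common ground of constants, integrable functions and square integrable functions,
  all of which are convolved below with kernels of bounded support.\<close>

definition loc_integrable :: "('a::euclidean_space \<Rightarrow> real) \<Rightarrow> bool" where
  "loc_integrable g \<longleftrightarrow> g \<in> borel_measurable lebesgue \<and>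
     (\<forall>K. compact K \<longrightarrow> integrable lebesgue (\<lambda>x. indicator K x * g x))"

lemma continuous_imp_lebesgue_measurable:
  fixes F :: "'a::euclidean_space \<Rightarrow> 'b::euclidean_space"
  assumes "continuous_on UNIV F"
  shows "F \<in> borel_measurable lebesgue"
  using borel_measurable_continuous_onI[OF assms] by (simp add: measurable_completion)

lemma loc_integrable_scaleR_continuous:
  fixes k :: "'a::euclidean_space \<Rightarrow> 'b::euclidean_space"
  assumes g: "loc_integrable g" and k: "continuous_on UNIV k" and K: "compact K" "\<And>x. x \<notin> K \<Longrightarrow> k x = 0"
  shows "integrable lebesgue (\<lambda>x. g x *\<^sub>R k x)"
proof -
  have "bounded (k ` K)"
    by (intro compact_imp_bounded compact_continuous_image K(1) continuous_on_subset[OF k]) auto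
  then obtain B where B: "\<And>x. x \<in> K \<Longrightarrow> norm (k x) \<le> B" unfolding bounded_iff by auto
  have gK: "integrable lebesgue (\<lambda>x. B * (indicator K x * g x))"
    using g K(1) unfolding loc_integrable_def by auto
  show ?thesis
  proof (rule Bochner_Integration.integrable_bound[OF gK])
    show "(\<lambda>x. g x *\<^sub>R k x) \<in> borel_measurable lebesgue"
      using g continuous_imp_lebesgue_measurable[OF k] unfolding loc_integrable_def by auto
    have "norm (g x *\<^sub>R k x) \<le> norm (B * (indicator K x * g x))" for x
    proof (cases "x \<in> K")
      case True
      then have "norm (k x) \<le> B" by (rule B)
      then have "\<bar>g x\<bar> * norm (k x) \<le> \<bar>g x\<bar> * \<bar>B\<bar>"
        by (intro mult_left_mono) auto
      then show ?thesis using True by (simp add: abs_mult mult.commute)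
    qed (simp add: K(2))
    then show "AE x in lebesgue. norm (g x *\<^sub>R k x) \<le> norm (B * (indicator K x * g x))" by simp
  qed
qed

text \<open>In finite dimension, continuity of \<open>k'\<close> in each fixed direction is
  continuity in operator norm, hence uniform continuity on a ball. The mean value inequality along
  the segment from \<open>p\<close> to \<open>p + h\<close> then gives one \<open>d\<close> for all
  \<open>p\<close>; far out both \<open>k\<close> and \<open>k'\<close> vanish.\<close>

lemma uniform_linearization:
  fixes k :: "'a::euclidean_space \<Rightarrow> 'b::euclidean_space"
  assumes der: "\<And>x. (k has_derivative k' x) (at x)"
    and cont: "\<And>h. continuous_on UNIV (\<lambda>x. k' x h)"
    and supp: "\<And>x. norm x > R \<Longrightarrow> k x = 0" and e: "e > 0"
  shows "\<exists>d>0. d \<le> 1 \<and> (\<forall>p h. norm h < d \<longrightarrow> norm (k (p + h) - k p - k' p h) \<le> e * norm h)"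
proof -
  define F where "F x = Blinfun (k' x)" for x
  have bl: "bounded_linear (k' x)" for x using der has_derivative_bounded_linear by blast
  have F: "blinfun_apply (F x) = k' x" for x unfolding F_def using bl by (rule bounded_linear_Blinfun_apply)
  have "continuous_on UNIV F"
    by (rule continuous_on_blinfun_componentwise) (simp add: F cont)
  then have "continuous_on (cball 0 (\<bar>R\<bar>+2)) F" using continuous_on_subset by blast
  then have "uniformly_continuous_on (cball 0 (\<bar>R\<bar>+2)) F"
    by (intro compact_uniformly_continuous) auto
  then obtain d0 where d0: "d0 > 0"
    "\<And>x y. x \<in> cball 0 (\<bar>R\<bar>+2) \<Longrightarrow> y \<in> cball 0 (\<bar>R\<bar>+2) \<Longrightarrow> dist y x < d0 \<Longrightarrow> dist (F y) (F x) < e"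
    using e unfolding uniformly_continuous_on_def by metis
  define d where "d = min 1 d0"
  have "norm (k (p + h) - k p - k' p h) \<le> e * norm h" if h: "norm h < d" for p h
  \<comment> \<open>As \<open>d \<le> 1\<close>, the segment stays in the ball of radius
    \<open>|R| + 2\<close> in the first case and off the support in the second. The absolute value
    admits a negative \<open>R\<close>.\<close>
  proof (cases "norm p \<le> \<bar>R\<bar> + 1")
    case True
    have in1: "p + t *\<^sub>R h \<in> cball 0 (\<bar>R\<bar>+2) \<inter> ball p d" if "t \<in> {0..1}" for t
    proof -
      have "norm (t *\<^sub>R h) \<le> norm h" using that by (simp add: mult_left_le_one_le)
      then have "norm (t *\<^sub>R h) < d" using h by simp
      moreover have "norm (p + t *\<^sub>R h) \<le> norm p + norm (t *\<^sub>R h)" by (rule norm_triangle_ineq)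
      moreover have "norm (p - (p + t *\<^sub>R h)) = norm (t *\<^sub>R h)" by simp
      ultimately show ?thesis using True h unfolding d_def mem_cball_0 Int_iff mem_ball dist_norm by linarith
    qed
    let ?S = "cball 0 (\<bar>R\<bar>+2) \<inter> ball p d"
    have "norm (k (p+h) - k p - k' p ((p+h) - p)) \<le> norm ((p+h) - p) * e"
    proof (rule differentiable_bound_linearization[where S = ?S and f' = k'])
      show "p + t *\<^sub>R (p + h - p) \<in> ?S" if "t \<in> {0..1}" for t using in1[OF that] by simp
      show "(k has_derivative k' x) (at x within ?S)" for x using der has_derivative_at_withinI by blast
      show "p \<in> ?S" using in1[of 0] by simp
      fix x assume x: "x \<in> ?S"
      then have "dist x p < d0" unfolding d_def by (simp add: dist_commute)
      then have "dist (F x) (F p) < e" using d0(2)[of p x] x in1[of 0] by auto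
      moreover have "blinfun_apply (F x - F p) = (\<lambda>h. k' x h - k' p h)"
        by (simp add: blinfun.diff_left F fun_eq_iff)
      then have "dist (F x) (F p) = onorm (\<lambda>h. k' x h - k' p h)"
        by (simp add: dist_norm norm_blinfun.rep_eq)
      ultimately show "onorm (k' x - k' p) \<le> e" by (simp add: fun_diff_def)
    qed
    then show ?thesis by (simp add: mult.commute)
  next
    case False
    have "norm (p + h) \<ge> norm p - norm h" by norm
    then have "k (p+h) = 0" "k p = 0" using False h supp unfolding d_def by auto
    moreover have "k' p = (\<lambda>h. 0)"
    proof (rule has_derivative_unique[OF der])
      have o: "open {x::'a. \<bar>R\<bar> < norm x}"
        by (intro open_Collect_less continuous_intros)
      show "(k has_derivative (\<lambda>h. 0)) (at p)"
        by (rule has_derivative_transform_within_open[OF _ o, where f = "\<lambda>x. 0"])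
          (use False supp in auto)
    qed
    ultimately show ?thesis using e by simp
  qed
  moreover have "d > 0" "d \<le> 1" unfolding d_def using d0 by auto
  ultimately show ?thesis by blast
qed

lemma continuous_reflect: "continuous_on UNIV k \<Longrightarrow> continuous_on UNIV (\<lambda>y. k (x - y :: 'a::euclidean_space))"
  by (rule continuous_on_compose2[where s = UNIV]) (auto intro: continuous_intros)

lemma integrable_conv:
  fixes k :: "'a::euclidean_space \<Rightarrow> 'b::euclidean_space"
  assumes g: "loc_integrable g" and k: "continuous_on UNIV k" and supp: "\<And>x. norm x > R \<Longrightarrow> k x = 0"
  shows "integrable lebesgue (\<lambda>y. g y *\<^sub>R k (x - y))"
proof (rule loc_integrable_scaleR_continuous[OF g continuous_reflect[OF k]])
  show "compact (cball x R)" by simp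
  show "k (x - y) = 0" if "y \<notin> cball x R" for y
    using that by (intro supp) (simp add: dist_norm)
qed

lemma deriv_supp:
  fixes k :: "'a::euclidean_space \<Rightarrow> 'b::euclidean_space"
  assumes der: "\<And>x. (k has_derivative k' x) (at x)"
    and supp: "\<And>x. norm x > R \<Longrightarrow> k x = 0" and x: "norm x > R"
  shows "k' x = (\<lambda>h. 0)"
proof (rule has_derivative_unique[OF der])
  have o: "open {x::'a. R < norm x}"
    by (intro open_Collect_less continuous_intros)
  show "(k has_derivative (\<lambda>h. 0)) (at x)"
    by (rule has_derivative_transform_within_open[OF _ o, where f = "\<lambda>x. 0"])
      (use x supp in auto)
qed

text \<open>The derivative falls on the kernel, so \<open>g\<close> may be rough. The linearization
  error of \<open>k\<close> is at most \<open>e' |h|\<close> uniformly and lives in one fixed ball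
  around \<open>x\<close>, so the integral errs by at most \<open>e' |h|\<close> times the mass of
  \<open>|g|\<close> on that ball.\<close>

lemma conv_has_derivative:
  fixes k :: "'a::euclidean_space \<Rightarrow> 'b::euclidean_space"
  assumes g: "loc_integrable g"
    and der: "\<And>x. (k has_derivative k' x) (at x)"
    and cont: "\<And>h. continuous_on UNIV (\<lambda>x. k' x h)"
    and supp: "\<And>x. norm x > R \<Longrightarrow> k x = 0"
  shows "((\<lambda>x. LINT y|lebesgue. g y *\<^sub>R k (x - y)) has_derivative
          (\<lambda>h. LINT y|lebesgue. g y *\<^sub>R k' (x - y) h)) (at x)"
proof -
  have supp': "k' x h = 0" if "norm x > R" for x h using deriv_supp[OF der supp that] by simp
  have kc: "continuous_on UNIV k"
    by (intro continuous_at_imp_continuous_on ballI has_derivative_continuous[OF der])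
  have i0: "integrable lebesgue (\<lambda>y. g y *\<^sub>R k (x - y))" for x
    by (rule integrable_conv[OF g kc supp])
  have i1: "integrable lebesgue (\<lambda>y. g y *\<^sub>R k' (x - y) h)" for x h
    by (rule integrable_conv[where k = "\<lambda>x. k' x h", OF g cont supp'])
  have bl: "bounded_linear (k' x)" for x using der has_derivative_bounded_linear by blast
  have lin: "linear (\<lambda>h. LINT y|lebesgue. g y *\<^sub>R k' (x - y) h)"
  proof (rule linearI)
    fix h1 h2
    have "(LINT y|lebesgue. g y *\<^sub>R k' (x - y) (h1 + h2)) = (LINT y|lebesgue. g y *\<^sub>R k' (x - y) h1 + g y *\<^sub>R k' (x - y) h2)"
      using bl by (simp add: linear_add bounded_linear.linear scaleR_add_right)
    then show "(LINT y|lebesgue. g y *\<^sub>R k' (x - y) (h1 + h2)) =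
       (LINT y|lebesgue. g y *\<^sub>R k' (x - y) h1) + (LINT y|lebesgue. g y *\<^sub>R k' (x - y) h2)"
      by (simp add: i1)
  next
    fix r h
    have "(LINT y|lebesgue. g y *\<^sub>R k' (x - y) (r *\<^sub>R h)) = (LINT y|lebesgue. r *\<^sub>R (g y *\<^sub>R k' (x - y) h))"
      using bl by (simp add: linear_scale bounded_linear.linear mult.commute[of r])
    then show "(LINT y|lebesgue. g y *\<^sub>R k' (x - y) (r *\<^sub>R h)) = r *\<^sub>R (LINT y|lebesgue. g y *\<^sub>R k' (x - y) h)"
      by (simp del: scaleR_scaleR)
  qed
  define I where "I = (LINT y|lebesgue. \<bar>indicator (cball x (\<bar>R\<bar>+1)) y * g y\<bar>)"
  have Iint: "integrable lebesgue (\<lambda>y. \<bar>indicator (cball x (\<bar>R\<bar>+1)) y * g y\<bar>)"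
    using g unfolding loc_integrable_def by auto
  have I0: "I \<ge> 0" unfolding I_def by simp
  show ?thesis
    unfolding has_derivative_at_alt
  proof (intro conjI allI impI)
    show "bounded_linear (\<lambda>h. LINT y|lebesgue. g y *\<^sub>R k' (x - y) h)"
      using lin linear_conv_bounded_linear by blast
    fix e :: real assume e: "e > 0"
    \<comment> \<open>Adding 1 keeps the quotient meaningful when \<open>I = 0\<close>.\<close>
    define e' where "e' = e / (I + 1)"
    have e': "e' > 0" using e I0 unfolding e'_def by simp
    have e'I: "e' * I \<le> e" unfolding e'_def using e I0 by (simp add: field_simps)
    obtain d where d: "d > 0" "d \<le> 1" "\<And>p h. norm h < d \<Longrightarrow> norm (k (p + h) - k p - k' p h) \<le> e' * norm h"
      using uniform_linearization[OF der cont supp e'] by blast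
    have "norm ((LINT y|lebesgue. g y *\<^sub>R k (w - y)) - (LINT y|lebesgue. g y *\<^sub>R k (x - y)) -
          (LINT y|lebesgue. g y *\<^sub>R k' (x - y) (w - x))) \<le> e * norm (w - x)" if w: "norm (w - x) < d" for w
    proof -
      let ?q = "\<lambda>y. g y *\<^sub>R (k (w - y) - k (x - y) - k' (x - y) (w - x))"
      have qi: "integrable lebesgue ?q" using i0 i1 by (simp add: scaleR_diff_right)
      have "norm (LINT y|lebesgue. ?q y) \<le> (LINT y|lebesgue. (e' * norm (w - x)) * \<bar>indicator (cball x (\<bar>R\<bar>+1)) y * g y\<bar>)"
      proof (rule Bochner_Integration.integral_norm_bound_integral[OF qi])
        show "integrable lebesgue (\<lambda>y. (e' * norm (w - x)) * \<bar>indicator (cball x (\<bar>R\<bar>+1)) y * g y\<bar>)"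
          using Iint by simp
        fix y
        show "norm (?q y) \<le> (e' * norm (w - x)) * \<bar>indicator (cball x (\<bar>R\<bar>+1)) y * g y\<bar>"
        proof (cases "y \<in> cball x (\<bar>R\<bar>+1)")
          case True
          have "norm (k (w - y) - k (x - y) - k' (x - y) (w - x)) \<le> e' * norm (w - x)"
            using d(3)[OF w, of "x - y"] by (simp add: algebra_simps)
          then show ?thesis using True by (simp add: mult_left_mono mult.commute)
        next
          case False
          then have n: "norm (x - y) > \<bar>R\<bar> + 1" by (simp add: dist_norm)
          have "norm (w - y) \<ge> norm (x - y) - norm (w - x)" by norm
          then have "norm (w - y) > R" using w d(2) n by linarith
          moreover have "norm (x - y) > R" using n by linarith
          ultimately show ?thesis using supp supp' False by simp
        qed
      qed
      also have "\<dots> = (e' * I) * norm (w - x)" unfolding I_def by simp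
      also have "\<dots> \<le> e * norm (w - x)" using e'I by (intro mult_right_mono) auto
      finally show ?thesis using i0 i1 by (simp add: scaleR_diff_right)
    qed
    then show "\<exists>d>0. \<forall>w. norm (w - x) < d \<longrightarrow>
            norm ((LINT y|lebesgue. g y *\<^sub>R k (w - y)) - (LINT y|lebesgue. g y *\<^sub>R k (x - y)) -
            (LINT y|lebesgue. g y *\<^sub>R k' (x - y) (w - x))) \<le> e * norm (w - x)"
      using d(1) by blast
  qed
qed

text \<open>The same localization as for the derivative, with uniform continuity of the kernel in
  place of its linearization. It serves merely continuous mollifiers and the Hessians of
  convolutions.\<close>

lemma conv_continuous:
  fixes k :: "'a::euclidean_space \<Rightarrow> 'b::euclidean_space"
  assumes g: "loc_integrable g" and k: "continuous_on UNIV k" and supp: "\<And>x. norm x > R \<Longrightarrow> k x = 0"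
  shows "continuous_on UNIV (\<lambda>x. LINT y|lebesgue. g y *\<^sub>R k (x - y))"
proof -
  have i0: "integrable lebesgue (\<lambda>y. g y *\<^sub>R k (x - y))" for x
    by (rule integrable_conv[OF g k supp])
  show ?thesis
    unfolding continuous_on_iff
  proof (intro ballI allI impI)
    fix x :: 'a and e :: real assume e: "e > 0"
    define I where "I = (LINT y|lebesgue. \<bar>indicator (cball x (\<bar>R\<bar>+1)) y * g y\<bar>)"
    have Iint: "integrable lebesgue (\<lambda>y. \<bar>indicator (cball x (\<bar>R\<bar>+1)) y * g y\<bar>)"
      using g unfolding loc_integrable_def by auto
    have I0: "I \<ge> 0" unfolding I_def by simp
    define e' where "e' = e / (I + 1)"
    have e': "e' > 0" using e I0 unfolding e'_def by simp
    have e'I: "e' * I < e" unfolding e'_def using e I0 by (simp add: field_simps)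
    have "uniformly_continuous_on (cball 0 (\<bar>R\<bar>+2)) k"
      using k by (intro compact_uniformly_continuous) (auto intro: continuous_on_subset)
    then obtain d0 where d0: "d0 > 0"
      "\<And>x y. x \<in> cball 0 (\<bar>R\<bar>+2) \<Longrightarrow> y \<in> cball 0 (\<bar>R\<bar>+2) \<Longrightarrow> dist y x < d0 \<Longrightarrow> dist (k y) (k x) < e'"
      using e' unfolding uniformly_continuous_on_def by metis
    define d where "d = min 1 d0"
    have "norm ((LINT y|lebesgue. g y *\<^sub>R k (w - y)) - (LINT y|lebesgue. g y *\<^sub>R k (x - y))) < e"
      if w: "norm (w - x) < d" for w
    proof -
      let ?q = "\<lambda>y. g y *\<^sub>R (k (w - y) - k (x - y))"
      have qi: "integrable lebesgue ?q" using i0 by (simp add: scaleR_diff_right)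
      have "norm (LINT y|lebesgue. ?q y) \<le> (LINT y|lebesgue. e' * \<bar>indicator (cball x (\<bar>R\<bar>+1)) y * g y\<bar>)"
      proof (rule Bochner_Integration.integral_norm_bound_integral[OF qi])
        show "integrable lebesgue (\<lambda>y. e' * \<bar>indicator (cball x (\<bar>R\<bar>+1)) y * g y\<bar>)"
          using Iint by simp
        fix y
        have n1: "norm (w - y) \<ge> norm (x - y) - norm (w - x)" "norm (w - y) \<le> norm (x - y) + norm (w - x)" by norm+
        show "norm (?q y) \<le> e' * \<bar>indicator (cball x (\<bar>R\<bar>+1)) y * g y\<bar>"
        proof (cases "y \<in> cball x (\<bar>R\<bar>+1)")
          case True
          have "dist (w - y) (x - y) < d0" using w unfolding d_def by (simp add: dist_norm)
          then have "dist (k (w - y)) (k (x - y)) < e'"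
            using True w n1 unfolding d_def by (intro d0(2)) (auto simp: dist_norm norm_minus_commute)
          then have "\<bar>g y\<bar> * norm (k (w - y) - k (x - y)) \<le> \<bar>g y\<bar> * e'"
            by (intro mult_left_mono) (auto simp: dist_norm)
          then show ?thesis using True by (simp add: mult.commute)
        next
          case False
          then have n: "norm (x - y) > \<bar>R\<bar> + 1" by (simp add: dist_norm)
          then have "norm (w - y) > R" using w n1 unfolding d_def by linarith
          moreover have "norm (x - y) > R" using n by linarith
          ultimately show ?thesis using supp False by simp
        qed
      qed
      also have "\<dots> = e' * I" unfolding I_def by simp
      also have "\<dots> < e" by (rule e'I)
      finally show ?thesis using i0 by (simp add: scaleR_diff_right)
    qed
    then show "\<exists>d>0. \<forall>x'\<in>UNIV. dist x' x < d \<longrightarrow>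
        dist (LINT y|lebesgue. g y *\<^sub>R k (x' - y)) (LINT y|lebesgue. g y *\<^sub>R k (x - y)) < e"
      using d0(1) by (intro exI[of _ d]) (auto simp: d_def dist_norm)
  qed
qed

lemma lebesgue_integral_translate_reflect:
  fixes f :: "'a::euclidean_space \<Rightarrow> 'b::euclidean_space"
  assumes f: "f \<in> borel_measurable lebesgue"
  shows "(LINT y|lebesgue. f (x - y)) = (LINT y|lebesgue. f y)"
    and "(LINT y|lebesgue. f (x + y)) = (LINT y|lebesgue. f y)"
    and "integrable lebesgue f \<Longrightarrow> integrable lebesgue (\<lambda>y. f (x - y))"
proof -
  \<comment> \<open>The affine change of variables has one factor per axis; with the same
    \<open>c\<close> on every axis it is \<open>x + c y\<close>, and for \<open>c = 1\<close> and
    \<open>c = -1\<close> the Jacobian is 1.\<close>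
  have T: "(\<lambda>y. x + (\<Sum>j\<in>Basis. (c * (y \<bullet> j)) *\<^sub>R j)) = (\<lambda>y. x + c *\<^sub>R y)" for c
    by (simp add: scaleR_scaleR[symmetric] scaleR_sum_right[symmetric] euclidean_representation del: scaleR_scaleR)
  have L: "lebesgue = distr lebesgue lebesgue (\<lambda>y. x + c *\<^sub>R y)" if "\<bar>c\<bar> = 1" for c :: real
  proof -
    have "lebesgue = density (distr lebesgue lebesgue (\<lambda>y. x + (\<Sum>j\<in>Basis. (c * (y \<bullet> j)) *\<^sub>R j))) (\<lambda>_. (\<Prod>j\<in>(Basis::'a set). \<bar>c\<bar>))"
      using that by (intro lebesgue_affine_euclidean) auto
    then show ?thesis using that unfolding T by (simp add: density_1)
  qed
  have M: "(\<lambda>y. x + c *\<^sub>R y) \<in> lebesgue \<rightarrow>\<^sub>M lebesgue" if "\<bar>c\<bar> = 1" for c :: real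
    using that lebesgue_affine_measurable[of "\<lambda>_. c" x] unfolding T by auto
  have I: "(LINT y|lebesgue. f (x + c *\<^sub>R y)) = (LINT y|lebesgue. f y)" if "\<bar>c\<bar> = 1" for c :: real
    by (subst (2) L[OF that], subst integral_distr[OF M[OF that] f]) simp
  show "(LINT y|lebesgue. f (x - y)) = (LINT y|lebesgue. f y)" using I[of "-1"] by simp
  show "(LINT y|lebesgue. f (x + y)) = (LINT y|lebesgue. f y)" using I[of 1] by simp
  show "integrable lebesgue (\<lambda>y. f (x - y))" if "integrable lebesgue f"
  proof -
    have "integrable (distr lebesgue lebesgue (\<lambda>y. x + (-1) *\<^sub>R y)) f" using that L[of "-1"] by simp
    then have "integrable lebesgue (\<lambda>y. f (x + (-1) *\<^sub>R y))"
      by (subst (asm) integrable_distr_eq[OF M f]) auto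
    then show ?thesis by simp
  qed
qed

text \<open>Convolving \<open>k\<close> with the constant 1 gives the constant
  \<open>\<integral> k\<close>, by translation invariance. Differentiating this constant under the
  integral yields \<open>\<integral> k' h\<close>, which is therefore 0. No iterated integrals are
  involved.\<close>

lemma integral_directional_derivative_zero:
  fixes k :: "'a::euclidean_space \<Rightarrow> real"
  assumes der: "\<And>x. (k has_derivative k' x) (at x)"
    and cont: "\<And>h. continuous_on UNIV (\<lambda>x. k' x h)"
    and supp: "\<And>x. norm x > R \<Longrightarrow> k x = 0"
  shows "(LINT x|lebesgue. k' x h) = 0"
proof -
  have g: "loc_integrable (\<lambda>x::'a. 1)"
    unfolding loc_integrable_def
    by (auto intro!: integrable_compact_support continuous_intros cong: continuous_on_cong)
  have kc: "continuous_on UNIV k"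
    by (intro continuous_at_imp_continuous_on ballI has_derivative_continuous[OF der])
  have "((\<lambda>x. LINT y|lebesgue. 1 *\<^sub>R k (x - y)) has_derivative
          (\<lambda>h. LINT y|lebesgue. 1 *\<^sub>R k' (x - y) h)) (at x)" for x
    by (rule conv_has_derivative[OF g der cont supp])
  moreover have "(\<lambda>x. LINT y|lebesgue. 1 *\<^sub>R k (x - y)) = (\<lambda>x. LINT y|lebesgue. k y)"
    using lebesgue_integral_translate_reflect(1)[OF continuous_imp_lebesgue_measurable[OF kc]] by auto
  ultimately have "((\<lambda>x. LINT y|lebesgue. k y) has_derivative
          (\<lambda>h. LINT y|lebesgue. 1 *\<^sub>R k' (0 - y) h)) (at 0)" by metis
  then have "(\<lambda>h. LINT y|lebesgue. 1 *\<^sub>R k' (0 - y) h) = (\<lambda>h. 0)"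
    by (rule has_derivative_unique) (rule has_derivative_const)
  moreover have "(LINT y|lebesgue. k' (0 - y) h) = (LINT y|lebesgue. k' y h)"
    by (rule lebesgue_integral_translate_reflect(1)[OF continuous_imp_lebesgue_measurable[OF cont]])
  ultimately show ?thesis by (simp add: fun_eq_iff)
qed

text \<open>Applied to the derivative of a vector field this is its divergence.\<close>

definition trace_map :: "('a::euclidean_space \<Rightarrow> 'a) \<Rightarrow> real" where
  "trace_map A = (\<Sum>b\<in>Basis. A b \<bullet> b)"

text \<open>The open set \<open>U\<close> is there because the weight is singular at the site:
  fields are differentiated off \<open>z\<close> only, and \<open>K\<close> avoids \<open>z\<close>.
  Extended by zero, the derivative is continuous on the two open sets \<open>U\<close> and
  \<open>- K\<close>, which cover the space, so each coordinate integrates to 0.\<close>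

lemma divergence_theorem_compact_support:
  fixes X :: "'a::euclidean_space \<Rightarrow> 'a"
  assumes K: "compact K" "K \<subseteq> U" "open U"
    and der: "\<And>x. x \<in> U \<Longrightarrow> (X has_derivative X' x) (at x)"
    and cont: "\<And>h. continuous_on U (\<lambda>x. X' x h)"
    and supp: "\<And>x. x \<notin> K \<Longrightarrow> X x = 0"
  shows "(LINT x|lebesgue. (if x \<in> K then trace_map (X' x) else 0)) = 0"
proof -
  define D where "D x = (if x \<in> K then X' x else (\<lambda>h. 0))" for x
  have oK: "open (- K)" using compact_imp_closed[OF K(1)] by (simp add: open_Compl)
  have der0: "(X has_derivative (\<lambda>h. 0)) (at x)" if "x \<notin> K" for x
    by (rule has_derivative_transform_within_open[OF _ oK, where f = "\<lambda>x. 0"])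
      (use that supp in auto)
  have X'0: "X' x = (\<lambda>h. 0)" if "x \<in> U" "x \<notin> K" for x
    using has_derivative_unique der der0 that by blast
  have derD: "(X has_derivative D x) (at x)" for x
    unfolding D_def using der der0 K(2) by auto
  have contD: "continuous_on UNIV (\<lambda>x. D x h)" for h
  proof -
    have 1: "continuous_on U (\<lambda>x. D x h)"
      by (rule continuous_on_eq[OF cont[of h]]) (auto simp: D_def X'0)
    have 2: "continuous_on (- K) (\<lambda>x. D x h)"
      by (rule continuous_on_eq[where f = "\<lambda>x. 0"]) (auto simp: D_def)
    have "continuous_on (U \<union> - K) (\<lambda>x. D x h)"
      by (rule continuous_on_open_Un[OF K(3) oK 1 2])
    moreover have "U \<union> - K = UNIV" using K(2) by auto
    ultimately show ?thesis by simp
  qed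
  obtain R where R: "\<And>x. x \<in> K \<Longrightarrow> norm x \<le> R" using compact_imp_bounded[OF K(1)] unfolding bounded_iff by auto
  have supp': "X x = 0" if "norm x > R" for x using R that supp by force
  have int: "integrable lebesgue (\<lambda>x. D x b \<bullet> b)" for b
    by (rule integrable_compact_support[OF K(1) continuous_on_inner[OF continuous_on_subset[OF contD] continuous_on_const]])
      (auto simp: D_def)
  have z: "(LINT x|lebesgue. D x b \<bullet> b) = 0" for b
    by (rule integral_directional_derivative_zero[where k = "\<lambda>x. X x \<bullet> b" and k' = "\<lambda>x h. D x h \<bullet> b" and R = R])
      (auto intro!: derivative_eq_intros continuous_intros derD contD simp: supp')
  have "(if x \<in> K then trace_map (X' x) else 0) = (\<Sum>b\<in>Basis. D x b \<bullet> b)" for x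
    by (simp add: D_def trace_map_def)
  then have "(LINT x|lebesgue. (if x \<in> K then trace_map (X' x) else 0)) = (\<Sum>b\<in>Basis. LINT x|lebesgue. D x b \<bullet> b)"
    by (simp add: int)
  then show ?thesis by (simp add: z)
qed

subsection \<open>Twice differentiable functions with explicit gradient and Hessian\<close>

text \<open>Gradient and Hessian are carried as data, so that products, compositions and
  convolutions come with explicit formulas for them. Symmetry of the Hessian belongs to the package
  and is propagated through these operations.\<close>

definition C2_on :: "'a::euclidean_space set \<Rightarrow> ('a \<Rightarrow> real) \<Rightarrow> ('a \<Rightarrow> 'a) \<Rightarrow> ('a \<Rightarrow> 'a \<Rightarrow> 'a) \<Rightarrow> bool" where
  "C2_on S u G H \<longleftrightarrow>
     (\<forall>x\<in>S. (u has_derivative (\<lambda>h. G x \<bullet> h)) (at x) \<and> (G has_derivative H x) (at x) \<and>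
        (\<forall>h k. H x h \<bullet> k = H x k \<bullet> h)) \<and>
     (\<forall>h. continuous_on S (\<lambda>x. H x h))"

text \<open>For \<open>C2_on S u G H\<close>, the Laplacian of \<open>u\<close> at \<open>x \<in> S\<close> is \<open>trace_map (H x)\<close>.\<close>

lemma C2_onD:
  assumes "C2_on S u G H"
  shows "x \<in> S \<Longrightarrow> (u has_derivative (\<lambda>h. G x \<bullet> h)) (at x)"
    and "x \<in> S \<Longrightarrow> (G has_derivative H x) (at x)"
    and "x \<in> S \<Longrightarrow> H x h \<bullet> k = H x k \<bullet> h"
    and "continuous_on S (\<lambda>x. H x h)"
    and "continuous_on S u" "continuous_on S G"
    and "x \<in> S \<Longrightarrow> linear (H x)"
proof -
  show "x \<in> S \<Longrightarrow> (u has_derivative (\<lambda>h. G x \<bullet> h)) (at x)"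
    and "x \<in> S \<Longrightarrow> (G has_derivative H x) (at x)"
    and "x \<in> S \<Longrightarrow> H x h \<bullet> k = H x k \<bullet> h"
    and "continuous_on S (\<lambda>x. H x h)"
    using assms unfolding C2_on_def by auto
  show "continuous_on S u" "continuous_on S G"
    using assms unfolding C2_on_def
    by (auto intro!: continuous_at_imp_continuous_on intro: has_derivative_continuous)
  show "x \<in> S \<Longrightarrow> linear (H x)"
    using assms unfolding C2_on_def by (auto dest: has_derivative_linear)
qed

text \<open>Continuity is assumed for fixed directions; a moving direction is expanded in the basis
  with continuous coefficients.\<close>

lemma C2_on_continuous_Hessian:
  assumes C: "C2_on S u G H" and g: "continuous_on S g"
  shows "continuous_on S (\<lambda>x. H x (g x))"
proof -
  have "H x (g x) = (\<Sum>b\<in>Basis. (g x \<bullet> b) *\<^sub>R H x b)" if "x \<in> S" for x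
    using C2_onD(7)[OF C that] by (subst euclidean_representation[of "g x", symmetric]) (simp add: linear_sum linear_scale del: euclidean_representation)
  moreover have "continuous_on S (\<lambda>x. \<Sum>b\<in>Basis. (g x \<bullet> b) *\<^sub>R H x b)"
    by (intro continuous_intros g C2_onD(4)[OF C])
  ultimately show ?thesis by (simp cong: continuous_on_cong)
qed

lemma C2_on_subset: "C2_on S u G H \<Longrightarrow> T \<subseteq> S \<Longrightarrow> C2_on T u G H"
  unfolding C2_on_def by (auto intro: continuous_on_subset)

lemma C2_on_support:
  assumes C: "C2_on S u G H" and K: "closed K" "\<And>x. x \<notin> K \<Longrightarrow> u x = 0"
    and x: "x \<in> S" "x \<notin> K" and S: "open S"
  shows "G x = 0" "H x h = 0"
proof -
  have oK: "open (- K \<inter> S)" using K(1) S by (simp add: open_Compl open_Int)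
  have G0: "G y = 0" if y: "y \<in> - K \<inter> S" for y
  proof -
    have "(u has_derivative (\<lambda>h. 0)) (at y)"
      by (rule has_derivative_transform_within_open[OF _ oK, where f = "\<lambda>x. 0"])
        (use y K(2) in auto)
    then have "(\<lambda>h. G y \<bullet> h) = (\<lambda>h. 0)"
      using has_derivative_unique C2_onD(1)[OF C] y by blast
    then show ?thesis by (metis inner_eq_zero_iff)
  qed
  then show "G x = 0" using x by simp
  have "(G has_derivative (\<lambda>h. 0)) (at x)"
    by (rule has_derivative_transform_within_open[OF _ oK, where f = "\<lambda>x. 0"])
      (use x G0 in auto)
  then show "H x h = 0"
    using has_derivative_unique C2_onD(2)[OF C x(1)] by metis
qed

lemma C2_on_diff_const: "C2_on S u G H \<Longrightarrow> C2_on S (\<lambda>x. c - u x) (\<lambda>x. - G x) (\<lambda>x h. - H x h)"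
  unfolding C2_on_def by (auto intro!: derivative_eq_intros continuous_intros)

lemma C2_on_mult:
  assumes u: "C2_on S u G H" and w: "C2_on S w G' H'"
  shows "C2_on S (\<lambda>x. u x * w x) (\<lambda>x. u x *\<^sub>R G' x + w x *\<^sub>R G x)
    (\<lambda>x h. u x *\<^sub>R H' x h + w x *\<^sub>R H x h + (G x \<bullet> h) *\<^sub>R G' x + (G' x \<bullet> h) *\<^sub>R G x)"
  unfolding C2_on_def
proof (intro conjI ballI allI)
  fix x assume x: "x \<in> S"
  note d = C2_onD[OF u] C2_onD[OF w]
  show "((\<lambda>x. u x * w x) has_derivative (\<lambda>h. (u x *\<^sub>R G' x + w x *\<^sub>R G x) \<bullet> h)) (at x)"
    by (rule has_derivative_eq_rhs, rule has_derivative_mult[OF d(1)[OF x] d(8)[OF x]])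
      (auto simp: algebra_simps inner_simps)
  show "((\<lambda>x. u x *\<^sub>R G' x + w x *\<^sub>R G x) has_derivative
          (\<lambda>h. u x *\<^sub>R H' x h + w x *\<^sub>R H x h + (G x \<bullet> h) *\<^sub>R G' x + (G' x \<bullet> h) *\<^sub>R G x)) (at x)"
    by (rule has_derivative_eq_rhs, rule has_derivative_add[OF has_derivative_scaleR[OF d(1)[OF x] d(9)[OF x]] has_derivative_scaleR[OF d(8)[OF x] d(2)[OF x]]])
      (auto simp: algebra_simps)
  show "(u x *\<^sub>R H' x h + w x *\<^sub>R H x h + (G x \<bullet> h) *\<^sub>R G' x + (G' x \<bullet> h) *\<^sub>R G x) \<bullet> k =
        (u x *\<^sub>R H' x k + w x *\<^sub>R H x k + (G x \<bullet> k) *\<^sub>R G' x + (G' x \<bullet> k) *\<^sub>R G x) \<bullet> h" for h k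
    using d(3)[OF x, of h k] d(10)[OF x, of h k] by (simp add: inner_simps inner_commute)
next
  fix h
  show "continuous_on S (\<lambda>x. u x *\<^sub>R H' x h + w x *\<^sub>R H x h + (G x \<bullet> h) *\<^sub>R G' x + (G' x \<bullet> h) *\<^sub>R G x)"
    by (intro continuous_intros C2_onD[OF u] C2_onD[OF w])
qed

lemma C2_on_compose:
  assumes u: "C2_on S u G H"
    and D1: "\<And>x. x \<in> S \<Longrightarrow> (f has_field_derivative fd (u x)) (at (u x))"
    and D2: "\<And>x. x \<in> S \<Longrightarrow> (fd has_field_derivative fdd (u x)) (at (u x))"
    and c: "continuous_on (u ` S) fdd"
  shows "C2_on S (\<lambda>x. f (u x)) (\<lambda>x. fd (u x) *\<^sub>R G x)
    (\<lambda>x h. fd (u x) *\<^sub>R H x h + (fdd (u x) * (G x \<bullet> h)) *\<^sub>R G x)"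
  unfolding C2_on_def
proof (intro conjI ballI allI)
  fix x assume x: "x \<in> S"
  note d = C2_onD[OF u]
  have 1: "((\<lambda>x. f (u x)) has_derivative (\<lambda>h. (G x \<bullet> h) * fd (u x))) (at x)"
    using DERIV_compose_FDERIV[OF D1[OF x] d(1)[OF x]] by simp
  have 2: "((\<lambda>x. fd (u x)) has_derivative (\<lambda>h. (G x \<bullet> h) * fdd (u x))) (at x)"
    using DERIV_compose_FDERIV[OF D2[OF x] d(1)[OF x]] by simp
  show "((\<lambda>x. f (u x)) has_derivative (\<lambda>h. (fd (u x) *\<^sub>R G x) \<bullet> h)) (at x)"
    using 1 by (simp add: mult.commute)
  show "((\<lambda>x. fd (u x) *\<^sub>R G x) has_derivative
          (\<lambda>h. fd (u x) *\<^sub>R H x h + (fdd (u x) * (G x \<bullet> h)) *\<^sub>R G x)) (at x)"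
    by (rule has_derivative_eq_rhs, rule has_derivative_scaleR[OF 2 d(2)[OF x]])
      (auto simp: algebra_simps)
  show "(fd (u x) *\<^sub>R H x h + (fdd (u x) * (G x \<bullet> h)) *\<^sub>R G x) \<bullet> k =
       (fd (u x) *\<^sub>R H x k + (fdd (u x) * (G x \<bullet> k)) *\<^sub>R G x) \<bullet> h" for h k
    using d(3)[OF x, of h k] by (simp add: inner_simps inner_commute)
next
  fix h
  have "continuous_on (u ` S) fd"
    using D2 by (auto intro!: continuous_at_imp_continuous_on DERIV_isCont)
  then have "continuous_on S (\<lambda>x. fd (u x))" "continuous_on S (\<lambda>x. fdd (u x))"
    using continuous_on_compose2[OF _ C2_onD(5)[OF u]] c by auto
  then show "continuous_on S (\<lambda>x. fd (u x) *\<^sub>R H x h + (fdd (u x) * (G x \<bullet> h)) *\<^sub>R G x)"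
    by (intro continuous_intros C2_onD[OF u])
qed

text \<open>Radial functions are written as functions of the squared distance, which is smooth also
  at the centre. The weight, the cutoffs and the mollifier all arise from
  \<open>C2_on_compose\<close> applied to it.\<close>

lemma C2_on_norm_square: "C2_on S (\<lambda>x. (norm (x - z))\<^sup>2) (\<lambda>x. 2 *\<^sub>R (x - z)) (\<lambda>x h. 2 *\<^sub>R h)"
  unfolding C2_on_def power2_norm_eq_inner
  by (auto intro!: derivative_eq_intros continuous_intros simp: inner_commute)

lemma trace_map_simps [simp]:
  fixes A B :: "'a::euclidean_space \<Rightarrow> 'a" and g U :: 'a
  shows
  "trace_map (\<lambda>h. A h + B h) = trace_map A + trace_map B"
  "trace_map (\<lambda>h. - A h) = - trace_map A"
  "trace_map (\<lambda>h. c *\<^sub>R A h) = c * trace_map A"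
  "trace_map (\<lambda>h. (g \<bullet> h) *\<^sub>R U) = g \<bullet> U"
  "trace_map (\<lambda>h. (c * (g \<bullet> h)) *\<^sub>R U) = c * (g \<bullet> U)"
  "trace_map (\<lambda>h::'a. h) = DIM('a)"
proof -
  have 1: "trace_map (\<lambda>h. (g \<bullet> h) *\<^sub>R U) = g \<bullet> U" for g U :: 'a
    unfolding trace_map_def by (subst euclidean_inner[of g U], simp add: inner_commute)
  show "trace_map (\<lambda>h. (g \<bullet> h) *\<^sub>R U) = g \<bullet> U" by (rule 1)
  show "trace_map (\<lambda>h. (c * (g \<bullet> h)) *\<^sub>R U) = c * (g \<bullet> U)"
    using 1[of "c *\<^sub>R g" U] by simp
qed (simp_all add: trace_map_def inner_simps sum.distrib sum_negf sum_distrib_left)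

lemma C2_on_continuous_trace: "C2_on S u G H \<Longrightarrow> continuous_on S (\<lambda>x. trace_map (H x))"
  unfolding trace_map_def by (intro continuous_intros C2_onD(4))

subsection \<open>The Carleman estimate\<close>

text \<open>The exponent has derivative \<open>\<alpha> (s - 1/t)\<close>, which lies between
  \<open>-\<alpha>/t\<close> and \<open>-\<alpha>/(2t)\<close> as long as \<open>0 < t\<close> and
  \<open>0 \<le> s t \<le> 1/2\<close>. There the weight decays like a power of
  \<open>t\<close>.\<close>

definition carleman_weight :: "real \<Rightarrow> real \<Rightarrow> real \<Rightarrow> real" where
  "carleman_weight \<alpha> s t = exp (\<alpha> * (s * t - ln t))"

text \<open>Here \<open>a\<close> and \<open>b\<close> are read off from
  \<open>\<phi> = ln w\<close>: one has \<open>r \<phi>' = - a / 2\<close> and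
  \<open>r^2 \<Delta>\<phi> = - b\<close>, and
  \<open>\<Delta>w = w (|\<nabla>\<phi>|^2 + \<Delta>\<phi>)\<close>.\<close>

lemma C2_on_carleman_weight:
  fixes z :: "'a::euclidean_space" and \<alpha> s :: real
  defines "r \<equiv> \<lambda>x. norm (x - z)" and "w \<equiv> \<lambda>x. carleman_weight \<alpha> s (norm (x - z))"
  defines "a \<equiv> \<lambda>x. 2 * \<alpha> * (1 - s * r x)"
    and "b \<equiv> \<lambda>x. \<alpha> * ((real DIM('a) - 2) - (real DIM('a) - 1) * s * r x)"
  obtains H where "C2_on (- {z}) w (\<lambda>x. (- (w x * a x / (2 * (r x)\<^sup>2))) *\<^sub>R (x - z)) H"
    "\<And>x. x \<noteq> z \<Longrightarrow> trace_map (H x) = w x * ((a x)\<^sup>2 / 4 - b x) / (r x)\<^sup>2"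
proof -
  define f where "f t = exp (\<alpha> * (s * sqrt t - ln t / 2))" for t :: real
  define k where "k t = \<alpha> * (s / (2 * sqrt t) - 1 / (2 * t))" for t :: real
  define k' where "k' t = \<alpha> * (1 / (2 * t ^ 2) - s / (4 * t * sqrt t))" for t :: real
  have f1: "(f has_field_derivative k t * f t) (at t)" if "t > 0" for t
    unfolding f_def k_def using that
    by (auto intro!: derivative_eq_intros simp: field_simps)
  have kd: "(k has_field_derivative k' t) (at t)" if "t > 0" for t
    unfolding k_def k'_def using that
    by (auto intro!: derivative_eq_intros simp: field_simps power2_eq_square)
  have f2: "((\<lambda>t. k t * f t) has_field_derivative (k' t + k t ^ 2) * f t) (at t)" if "t > 0" for t
    using DERIV_mult[OF kd[OF that] f1[OF that]] by (simp add: algebra_simps power2_eq_square)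
  let ?H = "\<lambda>x h::'a. (k ((r x)\<^sup>2) * f ((r x)\<^sup>2)) *\<^sub>R (2 *\<^sub>R h) +
     ((k' ((r x)\<^sup>2) + k ((r x)\<^sup>2) ^ 2) * f ((r x)\<^sup>2) * ((2 *\<^sub>R (x - z)) \<bullet> h)) *\<^sub>R (2 *\<^sub>R (x - z))"
  have pos: "r x > 0" if "x \<noteq> z" for x using that unfolding r_def by simp
  have C: "C2_on (- {z}) (\<lambda>x. f ((r x)\<^sup>2)) (\<lambda>x. (k ((r x)\<^sup>2) * f ((r x)\<^sup>2)) *\<^sub>R (2 *\<^sub>R (x - z))) ?H"
    unfolding r_def
  proof (rule C2_on_compose[OF C2_on_norm_square, where fdd = "\<lambda>t. (k' t + k t ^ 2) * f t"])
    have "continuous_on {0<..} (\<lambda>t. (k' t + k t ^ 2) * f t)"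
      unfolding k'_def k_def f_def by (intro continuous_intros) auto
    then show "continuous_on ((\<lambda>x. (norm (x - z))\<^sup>2) ` (- {z})) (\<lambda>t. (k' t + (k t)\<^sup>2) * f t)"
      by (rule continuous_on_subset) auto
  qed (auto intro!: f1 f2)
  have fw: "f ((r x)\<^sup>2) = w x" if "x \<noteq> z" for x
    using pos[OF that] unfolding f_def w_def carleman_weight_def r_def by (simp add: ln_realpow)
  have ka: "k ((r x)\<^sup>2) = - (a x / (4 * (r x)\<^sup>2))" if "x \<noteq> z" for x
    using pos[OF that] unfolding k_def a_def by (simp add: field_simps power2_eq_square)
  have kb: "k' ((r x)\<^sup>2) = \<alpha> * (2 - s * r x) / (4 * (r x)^4)" if "x \<noteq> z" for x
    using pos[OF that] unfolding k'_def by (simp add: field_simps power2_eq_square eval_nat_numeral)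
  have T: "trace_map (?H x) = w x * ((a x)\<^sup>2 / 4 - b x) / (r x)\<^sup>2" if "x \<noteq> z" for x
  proof -
    let ?d = "real DIM('a)"
    have yy: "(x - z) \<bullet> (x - z) = (r x)\<^sup>2" unfolding r_def by (simp add: power2_norm_eq_inner)
    have "trace_map (?H x) = w x * (2 * ?d * (k ((r x)\<^sup>2)) + 4 * (r x)\<^sup>2 * (k' ((r x)\<^sup>2) + k ((r x)\<^sup>2) ^ 2))"
      unfolding trace_map_simps fw[OF that] by (simp add: yy algebra_simps flip: inner_diff_left inner_diff_right scaleR_diff_right)
    also have "\<dots> = w x * ((a x)\<^sup>2 / 4 - b x) / (r x)\<^sup>2"
      using pos[OF that] unfolding ka[OF that] kb[OF that]
      by (simp add: divide_simps) (simp add: a_def b_def algebra_simps power2_eq_square eval_nat_numeral)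
    finally show ?thesis .
  qed
  \<comment> \<open>The two expressions for the weight are identified only off \<open>z\<close>, so
    the derivatives are transported within the open set \<open>- {z}\<close>.\<close>
  have W: "C2_on (- {z}) w (\<lambda>x. (- (w x * a x / (2 * (r x)\<^sup>2))) *\<^sub>R (x - z)) ?H"
    unfolding C2_on_def
  proof (intro conjI ballI allI)
    fix x assume x: "x \<in> - {z}"
    have o: "open (- {z})" by (simp add: open_Compl)
    note D = C2_onD[OF C]
    have e: "(k ((r x)\<^sup>2) * f ((r x)\<^sup>2)) *\<^sub>R (2 *\<^sub>R (x - z)) = (- (w x * a x / (2 * (r x)\<^sup>2))) *\<^sub>R (x - z)"
      if "x \<in> - {z}" for x using that pos[of x] by (simp add: fw ka)
    show "(w has_derivative (\<lambda>h. ((- (w x * a x / (2 * (r x)\<^sup>2))) *\<^sub>R (x - z)) \<bullet> h)) (at x)"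
      using has_derivative_transform_within_open[OF D(1)[OF x] o x, of w] fw unfolding e[OF x] by simp
    show "((\<lambda>x. (- (w x * a x / (2 * (r x)\<^sup>2))) *\<^sub>R (x - z)) has_derivative ?H x) (at x)"
      by (rule has_derivative_transform_within_open[OF D(2)[OF x] o x]) (rule e)
    show "?H x h \<bullet> k = ?H x k \<bullet> h" for h k using D(3)[OF x] .
  next
    show "continuous_on (- {z}) (\<lambda>x. ?H x h)" for h by (rule C2_onD(4)[OF C])
  qed
  show ?thesis by (rule that[OF W T])
qed

text \<open>For \<open>v = w f\<close> one has \<open>r\<^sup>2 w \<Delta>f = (r\<^sup>2 \<Delta>v + a\<^sup>2 v / 4) + (a E v + b v)\<close>, where \<open>E\<close> is the Euler operator;
with respect to the measure \<open>dx / r\<^sup>2\<close> the cross term of the two summands, which are conjugates of a symmetric and of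
an antisymmetric operator, is a divergence up to terms of one sign. The coefficient of \<open>|\<nabla>v|\<^sup>2\<close>, a Rellich-Pohozaev term,
vanishes for this choice of \<open>a\<close> and \<open>b\<close>.\<close>

lemma carleman_divergence:
  fixes z :: "'a::euclidean_space" and \<alpha> s :: real
  assumes C: "C2_on (- {z}) v G H"
  defines "r \<equiv> \<lambda>x. norm (x - z)" and "d \<equiv> real DIM('a)"
  defines "a \<equiv> \<lambda>x. 2 * \<alpha> * (1 - s * r x)"
    and "b \<equiv> \<lambda>x. \<alpha> * ((d - 2) - (d - 1) * s * r x)"
    and "E \<equiv> \<lambda>x. (x - z) \<bullet> G x"
  obtains X X' where "\<And>x. x \<noteq> z \<Longrightarrow> (X has_derivative X' x) (at x)"
    "\<And>h. continuous_on (- {z}) (\<lambda>x. X' x h)"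
    "\<And>x. x \<noteq> z \<Longrightarrow> trace_map (X' x) = 2 * (trace_map (H x) + (a x)\<^sup>2 / (4 * (r x)\<^sup>2) * v x) * (a x * E x + b x * v x)
       - 4 * \<alpha> * s * (E x)\<^sup>2 / r x + \<alpha> * s * (d - 1)\<^sup>2 * (v x)\<^sup>2 / r x
       - 4 * \<alpha>^3 * s * (1 - s * r x)\<^sup>2 * (v x)\<^sup>2 / r x"
    "\<And>x. v x = 0 \<Longrightarrow> x = z \<or> G x = 0 \<Longrightarrow> X x = 0"
proof -
  note D = C2_onD[OF C]
  \<comment> \<open>The field is \<open>p \<nabla>v + q (x - z)\<close>. The choice of
    \<open>p\<close> produces the product of \<open>\<Delta>v\<close> with twice the antisymmetric
    part \<open>a E + b v\<close>.\<close>
  define p where "p = (\<lambda>x. 2 * (a x * E x + b x * v x))"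
  \<comment> \<open>The first term of \<open>q\<close> accounts for the product of
    \<open>a^2 v / (4 r^2)\<close> with \<open>2 (a E + b v)\<close>. The second cancels the mixed
    term \<open>v E / r\<close> that comes from the gradient of \<open>b\<close>. The third is the
    Rellich-Pohozaev flux, which cancels the Hessian term
    \<open>2 a H (x - z) \<bullet> \<nabla>v\<close>.\<close>
  define q where "q = (\<lambda>x. (a x)^3 * (v x)\<^sup>2 / (4 * (r x)\<^sup>2) + \<alpha> * (d - 1) * s * (v x)\<^sup>2 / r x - a x * (G x \<bullet> G x))"
  define ga where "ga = (\<lambda>x. (- (2 * \<alpha> * s / r x)) *\<^sub>R (x - z))"
  define gb where "gb = (\<lambda>x. (- (\<alpha> * (d - 1) * s / r x)) *\<^sub>R (x - z))"
  define gp where "gp = (\<lambda>x. 2 *\<^sub>R (E x *\<^sub>R ga x + a x *\<^sub>R (G x + H x (x - z)) + b x *\<^sub>R G x + v x *\<^sub>R gb x))"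
  define gq where "gq = (\<lambda>x. (3 * (a x)\<^sup>2 * (v x)\<^sup>2 / (4 * (r x)\<^sup>2)) *\<^sub>R ga x
       + ((a x)^3 * v x / (2 * (r x)\<^sup>2)) *\<^sub>R G x - ((a x)^3 * (v x)\<^sup>2 / (2 * (r x)^4)) *\<^sub>R (x - z)
       + (\<alpha> * (d - 1) * s * 2 * v x / r x) *\<^sub>R G x - (\<alpha> * (d - 1) * s * (v x)\<^sup>2 / (r x)^3) *\<^sub>R (x - z)
       - (G x \<bullet> G x) *\<^sub>R ga x - (2 * a x) *\<^sub>R H x (G x))"
  define X' where "X' = (\<lambda>x h. (p x *\<^sub>R H x h + (gp x \<bullet> h) *\<^sub>R G x) + (q x *\<^sub>R h + (gq x \<bullet> h) *\<^sub>R (x - z)))"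
  have X: "((\<lambda>x. p x *\<^sub>R G x + q x *\<^sub>R (x - z)) has_derivative X' x) (at x) \<and> trace_map (X' x) = 2 * (trace_map (H x) + (a x)\<^sup>2 / (4 * (r x)\<^sup>2) * v x) * (a x * E x + b x * v x)
       - 4 * \<alpha> * s * (E x)\<^sup>2 / r x + \<alpha> * s * (d - 1)\<^sup>2 * (v x)\<^sup>2 / r x
       - 4 * \<alpha>^3 * s * (1 - s * r x)\<^sup>2 * (v x)\<^sup>2 / r x" if x: "x \<noteq> z" for x
  proof
  have x': "x \<in> - {z}" using x by simp
  have rpos: "r x > 0" using x unfolding r_def by simp
  have gr: "(r has_derivative (\<lambda>h. ((1 / r x) *\<^sub>R (x - z)) \<bullet> h)) (at x)"
  proof -
    have "((\<lambda>x. x - z) has_derivative (\<lambda>h. h)) (at x)" by (auto intro!: derivative_eq_intros)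
    from has_derivative_compose[OF this has_derivative_norm] show ?thesis
      unfolding r_def using x by (simp add: sgn_div_norm inner_commute divide_inverse)
  qed
  have da: "(a has_derivative (\<lambda>h. ga x \<bullet> h)) (at x)"
    unfolding a_def ga_def by (rule derivative_eq_intros gr refl)+ (simp add: inner_simps fun_eq_iff field_simps)
  have db: "(b has_derivative (\<lambda>h. gb x \<bullet> h)) (at x)"
    unfolding b_def gb_def by (rule derivative_eq_intros gr refl)+ (simp add: inner_simps fun_eq_iff field_simps)
  have dE: "(E has_derivative (\<lambda>h. (G x + H x (x - z)) \<bullet> h)) (at x)"
  proof -
    have "(x - z) \<bullet> H x h = H x (x - z) \<bullet> h" for h
      using D(3)[OF x', of h "x - z"] by (simp add: inner_commute)
    then show ?thesis
      unfolding E_def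
      by - (rule derivative_eq_intros D(2)[OF x'] refl | simp add: inner_add_left inner_commute[of _ "G x"] add.commute)+
  qed
  have dG: "((\<lambda>x. G x \<bullet> G x) has_derivative (\<lambda>h. (2 *\<^sub>R H x (G x)) \<bullet> h)) (at x)"
  proof -
    have "G x \<bullet> H x h = H x (G x) \<bullet> h" for h
      using D(3)[OF x', of h "G x"] by (simp add: inner_commute)
    then show ?thesis
      by - (rule derivative_eq_intros D(2)[OF x'] refl | simp add: inner_commute[of _ "G x"])+
  qed
  have dp: "(p has_derivative (\<lambda>h. gp x \<bullet> h)) (at x)"
    unfolding p_def gp_def
    by (rule derivative_eq_intros da dE db D(1)[OF x'] refl)+ (simp add: inner_simps algebra_simps)
  have dq: "(q has_derivative (\<lambda>h. gq x \<bullet> h)) (at x)"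
  proof -
    define N where "N = (\<lambda>x. G x \<bullet> G x)"
    have dN: "(N has_derivative (\<lambda>h. (2 *\<^sub>R H x (G x)) \<bullet> h)) (at x)" unfolding N_def by (rule dG)
    show ?thesis
      unfolding q_def gq_def N_def[symmetric, THEN fun_cong] using rpos
      apply -
      apply (rule derivative_eq_intros da gr dN D(1)[OF x'] refl | simp)+
      apply (rule ext)
      apply (simp add: inner_add_left inner_diff_left[of _ _ h for h] divide_simps)
      apply (simp add: algebra_simps power2_eq_square eval_nat_numeral)
      done
  qed
  show "((\<lambda>x. p x *\<^sub>R G x + q x *\<^sub>R (x - z)) has_derivative X' x) (at x)"
    unfolding X'_def
    by (rule derivative_eq_intros dp dq D(2)[OF x'] refl)+ simp
  have yy: "(x - z) \<bullet> (x - z) = (r x)\<^sup>2" unfolding r_def by (simp add: power2_norm_eq_inner)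
  have yG: "(x - z) \<bullet> G x = E x" "G x \<bullet> (x - z) = E x" unfolding E_def by (simp_all add: inner_commute)
  have HH: "H x (x - z) \<bullet> G x = H x (G x) \<bullet> (x - z)" by (rule D(3)[OF x'])
  define g2 where "g2 = G x \<bullet> G x"
  define hg where "hg = H x (G x) \<bullet> (x - z)"
  have T: "trace_map (X' x) = p x * trace_map (H x) + gp x \<bullet> G x + q x * d + gq x \<bullet> (x - z)"
    unfolding X'_def d_def by simp
  have tp: "gp x \<bullet> G x = 2 * (E x * (- (2 * \<alpha> * s / r x)) * E x + a x * (g2 + hg) + b x * g2 - v x * (\<alpha> * (d - 1) * s / r x) * E x)"
    unfolding gp_def ga_def gb_def inner_add_left inner_scaleR_left HH yG g2_def hg_def by (simp add: algebra_simps)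
  have tq: "gq x \<bullet> (x - z) = (3 * (a x)\<^sup>2 * (v x)\<^sup>2 / (4 * (r x)\<^sup>2)) * (- (2 * \<alpha> * s / r x)) * (r x)\<^sup>2
       + ((a x)^3 * v x / (2 * (r x)\<^sup>2)) * E x - ((a x)^3 * (v x)\<^sup>2 / (2 * (r x)^4)) * (r x)\<^sup>2
       + (\<alpha> * (d - 1) * s * 2 * v x / r x) * E x - (\<alpha> * (d - 1) * s * (v x)\<^sup>2 / (r x)^3) * (r x)\<^sup>2
       - g2 * (- (2 * \<alpha> * s / r x)) * (r x)\<^sup>2 - (2 * a x) * hg"
  proof -
    define y where "y = x - z"
    show ?thesis
      using yy yG unfolding gq_def ga_def g2_def hg_def y_def[symmetric] inner_add_left inner_diff_left inner_scaleR_left by simp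
  qed
  \<comment> \<open>Everything rests on \<open>(d - 2) a - 2 b = 2 \<alpha> s r\<close>. It makes
    the coefficient \<open>2 a + 2 b + 2 \<alpha> s r - d a\<close> of \<open>|\<nabla>v|^2\<close>
    vanish, and it turns the terms in \<open>a^2 v^2\<close> into
    \<open>- \<alpha> s a^2 v^2 / r\<close>, the source of the cube of \<alpha>.\<close>
  show "trace_map (X' x) = 2 * (trace_map (H x) + (a x)\<^sup>2 / (4 * (r x)\<^sup>2) * v x) * (a x * E x + b x * v x)
       - 4 * \<alpha> * s * (E x)\<^sup>2 / r x + \<alpha> * s * (d - 1)\<^sup>2 * (v x)\<^sup>2 / r x
       - 4 * \<alpha>^3 * s * (1 - s * r x)\<^sup>2 * (v x)\<^sup>2 / r x"
    unfolding T tp tq q_def p_def g2_def[symmetric] using rpos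
    apply (simp add: divide_simps)
    apply (simp add: a_def b_def algebra_simps power2_eq_square eval_nat_numeral)
    done
  qed
  have cr: "continuous_on (- {z}) r" "\<And>x. x \<in> - {z} \<Longrightarrow> r x \<noteq> 0"
    unfolding r_def by (auto intro!: continuous_intros)
  have cX: "continuous_on (- {z}) (\<lambda>x. X' x h)" for h
    unfolding X'_def p_def q_def gp_def gq_def ga_def gb_def a_def b_def E_def
    by (intro continuous_intros cr(1) D(4-6) C2_on_continuous_Hessian[OF C]) (use cr(2) in auto)
  show thesis
  proof (rule that)
    show "x \<noteq> z \<Longrightarrow> ((\<lambda>x. p x *\<^sub>R G x + q x *\<^sub>R (x - z)) has_derivative X' x) (at x)" for x using X by blast
    show "x \<noteq> z \<Longrightarrow> trace_map (X' x) = 2 * (trace_map (H x) + (a x)\<^sup>2 / (4 * (r x)\<^sup>2) * v x) * (a x * E x + b x * v x)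
       - 4 * \<alpha> * s * (E x)\<^sup>2 / r x + \<alpha> * s * (d - 1)\<^sup>2 * (v x)\<^sup>2 / r x
       - 4 * \<alpha>^3 * s * (1 - s * r x)\<^sup>2 * (v x)\<^sup>2 / r x" for x using X by blast
    show "p x *\<^sub>R G x + q x *\<^sub>R (x - z) = 0" if "v x = 0" "x = z \<or> G x = 0" for x
      using that by (auto simp: p_def q_def E_def)
  qed (rule cX)
qed

text \<open>With \<open>A\<close> and \<open>B\<close> the symmetric and antisymmetric parts,
  \<open>(r w \<Delta>f)^2 = r^2 (A + B / r^2)^2 \<ge> 2 A B\<close>. As the support is compact and
  avoids \<open>z\<close>, the divergence integrates to 0, and \<open>2 A B\<close> may be replaced
  by the remaining terms of \<open>T\<close> with opposite sign. The term in \<open>E^2\<close> then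
  has a good sign and is dropped; the lower bound on \<alpha> makes the term in
  \<open>(d - 1)^2\<close> harmless.\<close>

lemma carleman_estimate:
  fixes z :: "'a::euclidean_space" and \<alpha> s :: real
  assumes C: "C2_on UNIV f G H" and K: "compact K" "z \<notin> K" "\<And>x. x \<notin> K \<Longrightarrow> f x = 0"
    and s: "s > 0" "\<And>x. x \<in> K \<Longrightarrow> s * norm (x - z) \<le> 1 / 2"
    and \<alpha>: "\<alpha> > 0" "\<alpha>\<^sup>2 \<ge> 2 * (real DIM('a) - 1)\<^sup>2"
  shows "\<alpha>^3 * s / 2 * (LINT x|lebesgue. (carleman_weight \<alpha> s (norm (x - z)))\<^sup>2 * (f x)\<^sup>2 / norm (x - z))
      \<le> (LINT x|lebesgue. (norm (x - z) * carleman_weight \<alpha> s (norm (x - z)) * trace_map (H x))\<^sup>2)"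
proof -
  define r where "r = (\<lambda>x. norm (x - z))"
  define d where "d = real DIM('a)"
  define a where "a = (\<lambda>x. 2 * \<alpha> * (1 - s * r x))"
  define b where "b = (\<lambda>x. \<alpha> * ((d - 2) - (d - 1) * s * r x))"
  define w where "w = (\<lambda>x. carleman_weight \<alpha> s (r x))"
  obtain Hw where W: "C2_on (- {z}) w (\<lambda>x. (- (w x * a x / (2 * (r x)\<^sup>2))) *\<^sub>R (x - z)) Hw"
    and tW: "\<And>x. x \<noteq> z \<Longrightarrow> trace_map (Hw x) = w x * ((a x)\<^sup>2 / 4 - b x) / (r x)\<^sup>2"
    unfolding a_def b_def w_def r_def d_def by (rule C2_on_carleman_weight[of z \<alpha> s]) auto
  define v where "v = (\<lambda>x. w x * f x)"
  define Gw where "Gw = (\<lambda>x. (- (w x * a x / (2 * (r x)\<^sup>2))) *\<^sub>R (x - z))"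
  define Gv where "Gv = (\<lambda>x. w x *\<^sub>R G x + f x *\<^sub>R Gw x)"
  define Hv where "Hv = (\<lambda>x h. w x *\<^sub>R H x h + f x *\<^sub>R Hw x h + (Gw x \<bullet> h) *\<^sub>R G x + (G x \<bullet> h) *\<^sub>R Gw x)"
  have V: "C2_on (- {z}) v Gv Hv"
    unfolding v_def Gv_def Hv_def
    by (rule C2_on_mult[OF W[folded Gw_def] C2_on_subset[OF C]]) simp
  define E where "E = (\<lambda>x. (x - z) \<bullet> Gv x)"
  have rpos: "r x > 0" if "x \<noteq> z" for x using that unfolding r_def by simp
  have xz: "x \<noteq> z" if "x \<in> K" for x using that K(2) by auto
  \<comment> \<open>This is \<open>\<Delta>v = w \<Delta>f + 2 \<nabla>w \<bullet> \<nabla>f + f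
    \<Delta>w\<close> solved for \<open>w \<Delta>f\<close>. As \<nabla>w is radial, the mixed term
    can be expressed by \<open>E\<close> and \<open>v\<close>.\<close>
  have conj: "w x * trace_map (H x) = trace_map (Hv x) + (a x * E x + b x * v x) / (r x)\<^sup>2 + (a x)\<^sup>2 / (4 * (r x)\<^sup>2) * v x"
    if "x \<noteq> z" for x
  proof -
    have yy: "(x - z) \<bullet> (x - z) = (r x)\<^sup>2" unfolding r_def by (simp add: power2_norm_eq_inner)
    define m where "m = (x - z) \<bullet> G x"
    have e1: "E x = w x * m - f x * (w x * a x / 2)"
      unfolding E_def Gv_def Gw_def inner_add_right inner_scaleR_right yy m_def
      using rpos[OF that] by (simp add: field_simps)
    have e2: "trace_map (Hv x) = w x * trace_map (H x) + f x * (w x * ((a x)\<^sup>2 / 4 - b x) / (r x)\<^sup>2) - w x * a x / (r x)\<^sup>2 * m"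
      unfolding Hv_def trace_map_simps tW[OF that] unfolding Gw_def inner_scaleR_left inner_scaleR_right m_def
      by (simp add: inner_commute[of "G x"] field_simps)
    show ?thesis unfolding e1 e2 v_def using rpos[OF that]
      by (simp add: field_simps power2_eq_square)
  qed
  define T where "T = (\<lambda>x. 2 * (trace_map (Hv x) + (a x)\<^sup>2 / (4 * (r x)\<^sup>2) * v x) * (a x * E x + b x * v x)
       - 4 * \<alpha> * s * (E x)\<^sup>2 / r x + \<alpha> * s * (d - 1)\<^sup>2 * (v x)\<^sup>2 / r x
       - 4 * \<alpha>^3 * s * (1 - s * r x)\<^sup>2 * (v x)\<^sup>2 / r x)"
  obtain X X' where X: "\<And>x. x \<noteq> z \<Longrightarrow> (X has_derivative X' x) (at x)"
    "\<And>h. continuous_on (- {z}) (\<lambda>x. X' x h)"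
    "\<And>x. x \<noteq> z \<Longrightarrow> trace_map (X' x) = T x"
    "\<And>x. v x = 0 \<Longrightarrow> x = z \<or> Gv x = 0 \<Longrightarrow> X x = 0"
    unfolding T_def a_def b_def E_def r_def d_def by (rule carleman_divergence[OF V, of \<alpha> s]) blast
  have v0: "v x = 0" if "x \<notin> K" for x using K(3)[OF that] unfolding v_def by simp
  have Gv0: "Gv x = 0" if "x \<notin> K" "x \<noteq> z" for x
    by (rule C2_on_support(1)[OF V compact_imp_closed[OF K(1)] v0]) (use that in \<open>auto simp: open_Compl\<close>)
  have intT: "(LINT x|lebesgue. (if x \<in> K then T x else 0)) = 0"
  proof -
    have "(LINT x|lebesgue. (if x \<in> K then trace_map (X' x) else 0)) = 0"
      by (rule divergence_theorem_compact_support[where U = "- {z}" and X = X, OF K(1)])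
        (use K(2) X(1,2) X(4)[OF v0] Gv0 in \<open>auto simp: open_Compl\<close>)
    moreover have "(if x \<in> K then trace_map (X' x) else 0) = (if x \<in> K then T x else 0)" for x
      using X(3) xz by auto
    ultimately show ?thesis by simp
  qed
  have cont: "continuous_on K r" "continuous_on K w" "continuous_on K f" "continuous_on K (\<lambda>x. trace_map (H x))"
     "continuous_on K v" "continuous_on K Gv" "continuous_on K (\<lambda>x. trace_map (Hv x))"
    unfolding r_def
    using C2_onD(5)[OF W] C2_onD(5)[OF C] C2_on_continuous_trace[OF C] C2_onD(5,6)[OF V] C2_on_continuous_trace[OF V] xz
    by (auto intro!: continuous_intros intro: continuous_on_subset)
  have rne: "\<forall>x\<in>K. r x \<noteq> 0" using xz rpos by force
  have contT: "continuous_on K T" unfolding T_def a_def b_def E_def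
    by (intro continuous_intros cont) (use rne in auto)
  let ?L = "\<lambda>x. \<alpha>^3 * s / 2 * ((w x)\<^sup>2 * (f x)\<^sup>2 / r x)"
  let ?R = "\<lambda>x. (r x * w x * trace_map (H x))\<^sup>2"
  have iL: "integrable lebesgue ?L"
    by (rule integrable_compact_support[OF K(1)]) (auto intro!: continuous_intros cont simp: rne K(3))
  have H0: "trace_map (H x) = 0" if "x \<notin> K" for x
    using C2_on_support[OF C compact_imp_closed[OF K(1)] K(3)] that by (simp add: trace_map_def)
  have iR: "integrable lebesgue ?R"
    by (rule integrable_compact_support[OF K(1)]) (auto intro!: continuous_intros cont simp: H0)
  have iT: "integrable lebesgue (\<lambda>x. if x \<in> K then T x else 0)"
    by (rule integrable_compact_support[OF K(1)]) (auto simp: contT cong: continuous_on_cong)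
  have "?L x + (if x \<in> K then T x else 0) \<le> ?R x" for x
  proof (cases "x \<in> K")
    case True
    then have ne: "x \<noteq> z" by (rule xz)
    let ?A = "trace_map (Hv x) + (a x)\<^sup>2 / (4 * (r x)\<^sup>2) * v x" and ?B = "a x * E x + b x * v x"
    have rp: "r x > 0" by (rule rpos[OF ne])
    have "?R x = (r x)\<^sup>2 * (?A + ?B / (r x)\<^sup>2)\<^sup>2"
      unfolding mult.assoc[of "r x"] conj[OF ne] power_mult_distrib by (simp add: add.commute add.left_commute)
    also have "\<dots> = (r x)\<^sup>2 * ?A\<^sup>2 + 2 * ?A * ?B + ?B\<^sup>2 / (r x)\<^sup>2"
      using rp by (simp add: field_simps power2_eq_square)
    \<comment> \<open>The squares of both parts are discarded; only the cross term is
      exploited.\<close>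
    also have "\<dots> \<ge> 2 * ?A * ?B" by simp
    finally have 1: "?R x \<ge> 2 * ?A * ?B" .
    have "s * r x \<le> 1/2" using s(2)[OF True] unfolding r_def .
    \<comment> \<open>The restriction on the radius keeps \<open>1 - s r\<close> at least 1/2. So
      \<open>4 \<alpha>^2 (1 - s r)^2 \<ge> \<alpha>^2\<close>, of which one half pays for
      \<open>(d - 1)^2\<close> and the other half is the gain.\<close>
    then have "(1/2)\<^sup>2 \<le> (1 - s * r x)\<^sup>2" by (intro power_mono) auto
    then have h: "4 * \<alpha>^2 * (1 - s * r x)\<^sup>2 \<ge> \<alpha>^2"
      using mult_left_mono[of "(1/2)\<^sup>2" "(1 - s * r x)\<^sup>2" "4 * \<alpha>\<^sup>2"] by (simp add: power2_eq_square)
    have "\<alpha>^2 / 2 + (d - 1)\<^sup>2 \<le> 4 * \<alpha>^2 * (1 - s * r x)\<^sup>2"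
      using h \<alpha>(2) unfolding d_def by simp
    then have key: "(\<alpha> * s * (v x)\<^sup>2 / r x) * (\<alpha>^2 / 2 + (d - 1)\<^sup>2) \<le> (\<alpha> * s * (v x)\<^sup>2 / r x) * (4 * \<alpha>^2 * (1 - s * r x)\<^sup>2)"
      using \<alpha>(1) s(1) rp by (intro mult_left_mono) auto
    have 2: "?L x + \<alpha> * s * (d - 1)\<^sup>2 * (v x)\<^sup>2 / r x \<le> 4 * \<alpha>^3 * s * (1 - s * r x)\<^sup>2 * (v x)\<^sup>2 / r x"
    proof -
      have "?L x = (\<alpha> * s * (v x)\<^sup>2 / r x) * (\<alpha>^2 / 2)"
        by (simp add: v_def power_mult_distrib power2_eq_square power3_eq_cube mult_ac)
      moreover have "4 * \<alpha>^3 * s * (1 - s * r x)\<^sup>2 * (v x)\<^sup>2 / r x = (\<alpha> * s * (v x)\<^sup>2 / r x) * (4 * \<alpha>^2 * (1 - s * r x)\<^sup>2)"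
        by (simp add: power2_eq_square power3_eq_cube)
      moreover have "\<alpha> * s * (d - 1)\<^sup>2 * (v x)\<^sup>2 / r x = (\<alpha> * s * (v x)\<^sup>2 / r x) * (d - 1)\<^sup>2"
        by simp
      ultimately show ?thesis using key unfolding distrib_left by linarith
    qed
    have 3: "4 * \<alpha> * s * (E x)\<^sup>2 / r x \<ge> 0" using \<alpha>(1) s(1) rp by simp
    show ?thesis using True 1 2 3 by (simp add: T_def)
  next
    case False
    then show ?thesis by (simp add: K(3))
  qed
  then have "(LINT x|lebesgue. ?L x + (if x \<in> K then T x else 0)) \<le> (LINT x|lebesgue. ?R x)"
    by (intro integral_mono iL iR iT Bochner_Integration.integrable_add)
  moreover have "(LINT x|lebesgue. ?L x + (if x \<in> K then T x else 0)) =
     (LINT x|lebesgue. ?L x) + (LINT x|lebesgue. (if x \<in> K then T x else 0))"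
    by (rule Bochner_Integration.integral_add[OF iL iT])
  moreover have "(LINT x|lebesgue. ?L x) = \<alpha>^3 * s / 2 * (LINT x|lebesgue. (w x)\<^sup>2 * (f x)\<^sup>2 / r x)"
    by (rule integral_mult_right_zero)
  ultimately show ?thesis unfolding intT r_def w_def by linarith
qed

subsection \<open>Cutoff functions\<close>

text \<open>Only \<open>t = 0\<close> is delicate: the difference quotient is bounded by
  \<open>|h|^(n - 1)\<close>, which tends to 0 because \<open>n \<ge> 2\<close>.\<close>

lemma DERIV_pos_part_power:
  assumes "n \<ge> 2"
  shows "((\<lambda>t::real. (max 0 t) ^ n) has_field_derivative real n * (max 0 t) ^ (n - 1)) (at t)"
proof -
  consider "t > 0" | "t < 0" | "t = 0" by linarith
  then show ?thesis
  proof cases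
    case 1
    have "((\<lambda>t::real. t ^ n) has_field_derivative real n * (max 0 t) ^ (n - 1)) (at t)"
      using 1 by (auto intro!: derivative_eq_intros)
    then show ?thesis
      by (rule DERIV_cong_ev[OF refl _ refl, THEN iffD1, rotated])
        (use 1 in \<open>auto intro!: eventually_mono[OF eventually_nhds_in_open[of "{0<..}"]]\<close>)
  next
    case 2
    have "((\<lambda>t::real. 0) has_field_derivative real n * (max 0 t) ^ (n - 1)) (at t)"
      using 2 assms by (simp add: power_0_left)
    then show ?thesis
      by (rule DERIV_cong_ev[OF refl _ refl, THEN iffD1, rotated])
        (use 2 assms in \<open>auto intro!: eventually_mono[OF eventually_nhds_in_open[of "{..<0}"]]\<close>)
  next
    case 3
    have b: "\<bar>(max 0 h) ^ n / h\<bar> \<le> \<bar>h\<bar> ^ (n - 1)" for h :: real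
    proof (cases "h > 0")
      case True
      have "h ^ n = h * h ^ (n - 1)" using assms by (cases n) auto
      then show ?thesis using True by simp
    next
      case False then show ?thesis using assms by (simp add: power_0_left)
    qed
    have "((\<lambda>h::real. \<bar>h\<bar> ^ (n - 1)) \<longlongrightarrow> \<bar>0\<bar> ^ (n - 1)) (at 0)"
      by (intro tendsto_intros)
    then have "((\<lambda>h::real. \<bar>h\<bar> ^ (n - 1)) \<longlongrightarrow> 0) (at 0)"
      using assms by (simp only: abs_zero power_0_left) (simp split: if_splits)
    then have "((\<lambda>h::real. (max 0 h) ^ n / h) \<longlongrightarrow> 0) (at 0)"
      by (rule Lim_null_comparison[rotated]) (use b in auto)
    then show ?thesis using 3 assms by (simp add: DERIV_def power_0_left)
  qed
qed

text \<open>Twice differentiable cutoffs suffice here; smoothness is only needed for the test functions below.\<close>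

definition smoothstep :: "real \<Rightarrow> real" where
  "smoothstep t = 1 - (max 0 (1 - (max 0 t)^3))^3"

definition smoothstep' :: "real \<Rightarrow> real" where
  "smoothstep' t = 9 * (max 0 (1 - (max 0 t)^3))\<^sup>2 * (max 0 t)\<^sup>2"

definition smoothstep'' :: "real \<Rightarrow> real" where
  "smoothstep'' t = 18 * (max 0 (1 - (max 0 t)^3))\<^sup>2 * max 0 t
     - 54 * max 0 (1 - (max 0 t)^3) * (max 0 t)^4"

text \<open>A cube of a positive part is twice continuously differentiable; the inner cube smooths
  the junction at 0, the outer one the junction at 1.\<close>

lemma smoothstep_derivs:
  "(smoothstep has_field_derivative smoothstep' t) (at t)"
  "(smoothstep' has_field_derivative smoothstep'' t) (at t)"
  "continuous_on A smoothstep''"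
proof -
  have 3: "((\<lambda>t::real. (max 0 t) ^ 3) has_field_derivative 3 * (max 0 t)\<^sup>2) (at t)" for t
    using DERIV_pos_part_power[of 3 t] by simp
  have 2: "((\<lambda>t::real. (max 0 t)\<^sup>2) has_field_derivative 2 * max 0 t) (at t)" for t
    using DERIV_pos_part_power[of 2 t] by simp
  have i: "((\<lambda>t::real. 1 - (max 0 t) ^ 3) has_field_derivative - (3 * (max 0 t)\<^sup>2)) (at t)" for t
    by (rule derivative_eq_intros 3 refl | simp)+
  show "(smoothstep has_field_derivative smoothstep' t) (at t)"
    unfolding smoothstep_def[abs_def] smoothstep'_def
    by (rule derivative_eq_intros DERIV_chain2[OF 3 i] refl | simp)+
  show "(smoothstep' has_field_derivative smoothstep'' t) (at t)"
    unfolding smoothstep'_def[abs_def] smoothstep''_def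
    by (rule derivative_eq_intros DERIV_chain2[OF 2 i] 2 refl | simp add: power2_eq_square eval_nat_numeral algebra_simps)+
  show "continuous_on A smoothstep''"
    unfolding smoothstep''_def[abs_def] by (intro continuous_intros)
qed

text \<open>All factors lie between 0 and 1 on the transition interval, so the bounds are sums of
  coefficients: 9, and 72 = 18 + 54.\<close>

lemma smoothstep_values:
  "t \<le> 0 \<Longrightarrow> smoothstep t = 0" "t \<ge> 1 \<Longrightarrow> smoothstep t = 1"
  "0 \<le> smoothstep t" "smoothstep t \<le> 1"
  "t \<le> 0 \<or> t \<ge> 1 \<Longrightarrow> smoothstep' t = 0" "t \<le> 0 \<or> t \<ge> 1 \<Longrightarrow> smoothstep'' t = 0"
  "\<bar>smoothstep' t\<bar> \<le> 9" "\<bar>smoothstep'' t\<bar> \<le> 72"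
proof -
  have p: "(max 0 t)^3 \<ge> 1" if "t \<ge> 1" using that by simp
  show "t \<le> 0 \<Longrightarrow> smoothstep t = 0" "t \<ge> 1 \<Longrightarrow> smoothstep t = 1"
    using p unfolding smoothstep_def by auto
  have b: "0 \<le> max 0 (1 - (max 0 t)^3)" "max 0 (1 - (max 0 t)^3) \<le> 1" by auto
  show "0 \<le> smoothstep t" "smoothstep t \<le> 1"
    unfolding smoothstep_def using b power_le_one[OF b, of 3] by auto
  show z: "t \<le> 0 \<or> t \<ge> 1 \<Longrightarrow> smoothstep' t = 0" "t \<le> 0 \<or> t \<ge> 1 \<Longrightarrow> smoothstep'' t = 0"
    using p unfolding smoothstep'_def smoothstep''_def by auto
  show "\<bar>smoothstep' t\<bar> \<le> 9"
  proof (cases "t \<le> 0 \<or> t \<ge> 1")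
    case False
    then have t: "0 \<le> t" "t \<le> 1" by auto
    have "(max 0 (1 - (max 0 t)^3))\<^sup>2 * (max 0 t)\<^sup>2 \<le> 1 * 1"
      using t by (intro mult_mono power_le_one b) auto
    then show ?thesis unfolding smoothstep'_def by simp
  qed (simp add: z)
  show "\<bar>smoothstep'' t\<bar> \<le> 72"
  proof (cases "t \<le> 0 \<or> t \<ge> 1")
    case False
    then have t: "0 \<le> t" "t \<le> 1" by auto
    have 1: "(max 0 (1 - (max 0 t)^3))\<^sup>2 * max 0 t \<le> 1 * 1"
      using t by (intro mult_mono power_le_one b) auto
    have 2: "max 0 (1 - (max 0 t)^3) * (max 0 t)^4 \<le> 1 * 1"
      using t by (intro mult_mono power_le_one b) auto
    have 3: "0 \<le> (max 0 (1 - (max 0 t)^3))\<^sup>2 * max 0 t" "0 \<le> max 0 (1 - (max 0 t)^3) * (max 0 t)^4"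
      using t by auto
    show ?thesis unfolding smoothstep''_def mult.assoc abs_le_iff using 1 2 3 by linarith
  qed (simp add: z)
qed

text \<open>The function vanishes near \<open>z\<close> and is 1 far away; its complement is the
  usual plateau. As the transition is in the squared distance, from \<open>\<rho>^2\<close> to
  \<open>4 \<rho>^2\<close>, the map \<open>\<tau>\<close> divides by 3. The first derivative of the
  profile is at most \<open>3 / \<rho>^2\<close> and the second at most \<open>8 / \<rho>^4\<close>,
  so the gradient is at most \<open>12 / \<rho>\<close> and the Laplacian at most
  \<open>(6 d + 128) / \<rho>^2\<close>; one constant serves both.\<close>

lemma cutoff_exists:
  fixes z :: "'a::euclidean_space"
  assumes \<rho>: "\<rho> > 0"
  obtains \<eta> G H where "C2_on UNIV \<eta> G H" "\<And>x. 0 \<le> \<eta> x" "\<And>x. \<eta> x \<le> 1"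
    "\<And>x. norm (x - z) \<le> \<rho> \<Longrightarrow> \<eta> x = 0" "\<And>x. 2 * \<rho> \<le> norm (x - z) \<Longrightarrow> \<eta> x = 1"
    "\<And>x. norm (x - z) \<le> \<rho> \<or> 2 * \<rho> \<le> norm (x - z) \<Longrightarrow> G x = 0"
    "\<And>x. norm (x - z) \<le> \<rho> \<or> 2 * \<rho> \<le> norm (x - z) \<Longrightarrow> trace_map (H x) = 0"
    "\<And>x. norm (G x) \<le> (6 * real DIM('a) + 128) / \<rho>"
    "\<And>x. \<bar>trace_map (H x)\<bar> \<le> (6 * real DIM('a) + 128) / \<rho>\<^sup>2"
proof -
  define \<tau> where "\<tau> t = (t / \<rho>\<^sup>2 - 1) / 3" for t
  define f1 where "f1 t = smoothstep' (\<tau> t) / (3 * \<rho>\<^sup>2)" for t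
  define f2 where "f2 t = smoothstep'' (\<tau> t) / (9 * \<rho>^4)" for t
  define q where "q x = (norm (x - z))\<^sup>2" for x
  let ?G = "\<lambda>x. f1 (q x) *\<^sub>R (2 *\<^sub>R (x - z))"
  let ?H = "\<lambda>x h::'a. f1 (q x) *\<^sub>R (2 *\<^sub>R h) + (f2 (q x) * ((2 *\<^sub>R (x - z)) \<bullet> h)) *\<^sub>R (2 *\<^sub>R (x - z))"
  have d\<tau>: "(\<tau> has_field_derivative 1 / (3 * \<rho>\<^sup>2)) (at t)" for t
    unfolding \<tau>_def[abs_def] using \<rho> by (auto intro!: derivative_eq_intros simp: field_simps)
  have C: "C2_on UNIV (\<lambda>x. smoothstep (\<tau> (q x))) ?G ?H"
    unfolding q_def
  proof (rule C2_on_compose[OF C2_on_norm_square, where f = "\<lambda>t. smoothstep (\<tau> t)" and fdd = f2])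
    show "((\<lambda>t. smoothstep (\<tau> t)) has_field_derivative f1 t) (at t)" for t
      using DERIV_chain2[OF smoothstep_derivs(1) d\<tau>] by (simp add: f1_def)
    show "(f1 has_field_derivative f2 t) (at t)" for t
      using DERIV_cdivide[OF DERIV_chain2[OF smoothstep_derivs(2) d\<tau>, of t], of "3 * \<rho>\<^sup>2"]
      unfolding f1_def[abs_def] f2_def by (simp add: power2_eq_square eval_nat_numeral)
    show "continuous_on A f2" for A
      unfolding f2_def[abs_def] using \<rho>
      by (intro continuous_intros continuous_on_compose2[OF smoothstep_derivs(3)[of UNIV]])
        (auto simp: \<tau>_def intro!: continuous_intros)
  qed
  have lo: "\<tau> (q x) \<le> 0" if "norm (x - z) \<le> \<rho>" for x
  proof -
    have "q x \<le> \<rho>\<^sup>2" unfolding q_def using that by (intro power_mono) auto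
    then show ?thesis unfolding \<tau>_def using \<rho> by (simp add: field_simps)
  qed
  have hi: "\<tau> (q x) \<ge> 1" if "2 * \<rho> \<le> norm (x - z)" for x
  proof -
    have "q x \<ge> (2 * \<rho>)\<^sup>2" unfolding q_def using that \<rho> by (intro power_mono) auto
    then show ?thesis unfolding \<tau>_def using \<rho> by (simp add: field_simps power2_eq_square)
  qed
  have z: "f1 (q x) = 0" "f2 (q x) = 0" if "norm (x - z) \<le> \<rho> \<or> 2 * \<rho> \<le> norm (x - z)" for x
    using lo[of x] hi[of x] that smoothstep_values(5,6)[of "\<tau> (q x)"] unfolding f1_def f2_def by auto
  have T: "trace_map (?H x) = f1 (q x) * 2 * real DIM('a) + f2 (q x) * 4 * q x" for x
    unfolding trace_map_simps by (simp add: q_def power2_norm_eq_inner)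
  have b1: "\<bar>f1 (q x)\<bar> \<le> 3 / \<rho>\<^sup>2" for x
    using smoothstep_values(7)[of "\<tau> (q x)"] \<rho> unfolding f1_def by (simp add: field_simps)
  have b2: "\<bar>f2 (q x)\<bar> \<le> 8 / \<rho>^4" for x
    using smoothstep_values(8)[of "\<tau> (q x)"] \<rho> unfolding f2_def by (simp add: field_simps)
  show thesis
  proof (rule that[OF C])
    fix x
    show "norm (x - z) \<le> \<rho> \<or> 2 * \<rho> \<le> norm (x - z) \<Longrightarrow> ?G x = 0"
      "norm (x - z) \<le> \<rho> \<or> 2 * \<rho> \<le> norm (x - z) \<Longrightarrow> trace_map (?H x) = 0"
      unfolding T using z by auto
    show "norm (?G x) \<le> (6 * real DIM('a) + 128) / \<rho>"
    proof (cases "norm (x - z) \<le> \<rho> \<or> 2 * \<rho> \<le> norm (x - z)")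
      case False
      have "\<bar>f1 (q x)\<bar> * (2 * norm (x - z)) \<le> 3 / \<rho>\<^sup>2 * (2 * (2 * \<rho>))"
        using False b1[of x] \<rho> by (intro mult_mono) auto
      also have "\<dots> \<le> (6 * real DIM('a) + 128) / \<rho>"
        using \<rho> by (simp add: field_simps power2_eq_square)
      finally show ?thesis by simp
    qed (use z \<rho> in auto)
    show "\<bar>trace_map (?H x)\<bar> \<le> (6 * real DIM('a) + 128) / \<rho>\<^sup>2"
    proof (cases "norm (x - z) \<le> \<rho> \<or> 2 * \<rho> \<le> norm (x - z)")
      case False
      have "q x \<le> (2 * \<rho>)\<^sup>2" unfolding q_def using False by (intro power_mono) auto
      then have "\<bar>f2 (q x)\<bar> * (4 * q x) \<le> 8 / \<rho>^4 * (4 * (2 * \<rho>)\<^sup>2)"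
        using b2[of x] \<rho> by (intro mult_mono) (auto simp: q_def)
      also have "\<dots> = 128 / \<rho>\<^sup>2"
        using \<rho> by (simp add: field_simps power2_eq_square eval_nat_numeral)
      finally have 2: "\<bar>f2 (q x)\<bar> * (4 * q x) \<le> 128 / \<rho>\<^sup>2" .
      have 1: "\<bar>f1 (q x)\<bar> * (2 * real DIM('a)) \<le> 3 / \<rho>\<^sup>2 * (2 * real DIM('a))"
        using b1[of x] by (intro mult_right_mono) auto
      have "\<bar>trace_map (?H x)\<bar> \<le> \<bar>f1 (q x)\<bar> * (2 * real DIM('a)) + \<bar>f2 (q x)\<bar> * (4 * q x)"
        unfolding T by (rule order.trans[OF abs_triangle_ineq]) (simp add: abs_mult q_def)
      also have "\<dots> \<le> (6 * real DIM('a) + 128) / \<rho>\<^sup>2"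
        using 1 2 by (simp add: add_divide_distrib)
      finally show ?thesis .
    next
      case True
      then have "trace_map (?H x) = 0" unfolding T using z by simp
      then show ?thesis using \<rho> by simp
    qed
  qed (use lo hi smoothstep_values in auto)
qed

subsection \<open>Energy identity\<close>

text \<open>The field \<open>\<eta> u \<nabla>u - (u^2 / 2) \<nabla>\<eta>\<close> is chosen so that
  the two mixed terms \<open>u \<nabla>u \<bullet> \<nabla>\<eta>\<close> cancel in its divergence;
  the cutoff then enters through its Laplacian alone.\<close>

lemma energy_identity:
  fixes u :: "'a::euclidean_space \<Rightarrow> real"
  assumes u: "C2_on UNIV u G H" and c: "C2_on UNIV \<eta> G\<eta> H\<eta>"
    and K: "compact K" "\<And>x. x \<notin> K \<Longrightarrow> u x = 0"
  shows "(LINT x|lebesgue. \<eta> x * (norm (G x))\<^sup>2) =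
     (LINT x|lebesgue. (u x)\<^sup>2 * trace_map (H\<eta> x)) / 2 - (LINT x|lebesgue. \<eta> x * u x * trace_map (H x))"
proof -
  note D = C2_onD[OF u] and D\<eta> = C2_onD[OF c]
  let ?X = "\<lambda>x. (\<eta> x * u x) *\<^sub>R G x - ((u x)\<^sup>2 / 2) *\<^sub>R G\<eta> x"
  let ?X' = "\<lambda>x h. ((\<eta> x * u x) *\<^sub>R H x h + ((\<eta> x *\<^sub>R G x + u x *\<^sub>R G\<eta> x) \<bullet> h) *\<^sub>R G x)
      + - (((u x)\<^sup>2 / 2) *\<^sub>R H\<eta> x h + ((u x *\<^sub>R G x) \<bullet> h) *\<^sub>R G\<eta> x)"
  have G0: "G x = 0" "trace_map (H x) = 0" if "x \<notin> K" for x
    using C2_on_support[OF u compact_imp_closed[OF K(1)] K(2), of x] that by (auto simp: trace_map_def)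
  have T: "trace_map (?X' x) = \<eta> x * (norm (G x))\<^sup>2 - ((u x)\<^sup>2 * trace_map (H\<eta> x) / 2 - \<eta> x * u x * trace_map (H x))" for x
    unfolding trace_map_simps by (simp add: power2_norm_eq_inner inner_simps inner_commute algebra_simps)
  have "(LINT x|lebesgue. (if x \<in> K then trace_map (?X' x) else 0)) = 0"
  proof (rule divergence_theorem_compact_support[OF K(1) _ open_UNIV, where X = ?X])
    fix x
    show "(?X has_derivative ?X' x) (at x)"
    proof -
      have "((\<lambda>x. (u x)\<^sup>2 / 2) has_derivative (\<lambda>h. (u x *\<^sub>R G x) \<bullet> h)) (at x)"
        by (rule derivative_eq_intros D(1)[OF UNIV_I] refl | simp add: mult.commute)+
      from has_derivative_diff[OF has_derivative_scaleR[OF has_derivative_mult[OF D\<eta>(1) D(1)] D(2)] has_derivative_scaleR[OF this D\<eta>(2)], OF UNIV_I UNIV_I UNIV_I UNIV_I]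
      show ?thesis by (rule has_derivative_eq_rhs) (auto simp: inner_simps algebra_simps)
    qed
    show "continuous_on UNIV (\<lambda>x. ?X' x h)" for h
      by (intro continuous_intros D D\<eta>) auto
  qed (use K in auto)
  moreover have "(if x \<in> K then trace_map (?X' x) else 0) =
     \<eta> x * (norm (G x))\<^sup>2 - ((u x)\<^sup>2 * trace_map (H\<eta> x) / 2 - \<eta> x * u x * trace_map (H x))" for x
    using K(2) G0 T by auto
  moreover have "integrable lebesgue (\<lambda>x. \<eta> x * (norm (G x))\<^sup>2)" "integrable lebesgue (\<lambda>x. (u x)\<^sup>2 * trace_map (H\<eta> x) / 2)"
    "integrable lebesgue (\<lambda>x. \<eta> x * u x * trace_map (H x))"
    by (rule integrable_compact_support[OF K(1)];
        use C2_on_continuous_trace[OF u] C2_on_continuous_trace[OF c] D(5,6) D\<eta>(5) K(2) G0 in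
        \<open>auto intro!: continuous_intros intro: continuous_on_subset\<close>)+
  ultimately show ?thesis by simp
qed

subsection \<open>Monotonicity of the weight\<close>

lemma carleman_weight_pos: "carleman_weight \<alpha> s t > 0"
  unfolding carleman_weight_def by simp

text \<open>From \<open>ln x \<le> x - 1\<close> the logarithm gains at least
  \<open>(t' - t) / t'\<close>, which is at least \<open>2 s (t' - t)\<close>. Giving up one
  logarithm for the factor \<open>t\<close> leaves \<open>\<alpha> - 1 \<ge> \<alpha> / 2\<close> of
  them, enough to beat the exponential. The product \<open>r w\<close> is what multiplies the
  Laplacian in the Carleman estimate.\<close>

lemma carleman_weight_antimono:
  assumes t: "0 < t" "t \<le> t'" and s: "s \<ge> 0" "s * t' \<le> 1/2" and \<alpha>: "\<alpha> \<ge> 2"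
  shows "t' * carleman_weight \<alpha> s t' \<le> t * carleman_weight \<alpha> s t"
    and "carleman_weight \<alpha> s t' \<le> carleman_weight \<alpha> s t"
proof -
  have "ln (t / t') \<le> t / t' - 1" using t by (intro ln_le_minus_one) auto
  then have 1: "ln t' - ln t \<ge> (t' - t) / t'" using t by (simp add: ln_div field_simps)
  have "2 * s * (t' - t) \<le> (t' - t) / t'"
  proof -
    have "2 * s * t' * (t' - t) \<le> 1 * (t' - t)" using s t by (intro mult_right_mono) auto
    then show ?thesis using t by (simp add: field_simps)
  qed
  then have 2: "ln t' - ln t \<ge> 2 * (s * (t' - t))" using 1 by simp
  have sp: "s * (t' - t) \<ge> 0" using s t by simp
  have "(\<alpha> - 1) * (ln t' - ln t) \<ge> (\<alpha> - 1) * (2 * (s * (t' - t)))"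
    using 2 \<alpha> by (intro mult_left_mono) auto
  moreover have "(2 * (\<alpha> - 1)) * (s * (t' - t)) \<ge> \<alpha> * (s * (t' - t))"
    using \<alpha> sp by (intro mult_right_mono) auto
  ultimately have "(\<alpha> - 1) * (ln t' - ln t) \<ge> \<alpha> * (s * (t' - t))" by (simp add: algebra_simps)
  then have "exp (ln t' + \<alpha> * (s * t' - ln t')) \<le> exp (ln t + \<alpha> * (s * t - ln t))"
    by (simp add: algebra_simps)
  then show "t' * carleman_weight \<alpha> s t' \<le> t * carleman_weight \<alpha> s t"
    using t unfolding carleman_weight_def exp_add by simp
  have "\<alpha> * (s * (t' - t)) \<le> \<alpha> * (ln t' - ln t)"
    using 2 sp \<alpha> by (intro mult_left_mono) auto
  then show "carleman_weight \<alpha> s t' \<le> carleman_weight \<alpha> s t"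
    unfolding carleman_weight_def by (simp add: algebra_simps)
qed

text \<open>One of the two factors 2 in \<open>4 t\<close> pays for the exponential, since
  \<open>s * (4 * t) \<le> 1/2 \<le> ln 2\<close>; the other one gives the decay. Squared, this is
  the factor that makes the outer cutoff error absorbable.\<close>

lemma carleman_weight_quadruple:
  assumes t: "0 < t" and s: "s * (4 * t) \<le> 1/2" and \<alpha>: "\<alpha> \<ge> 0" "s \<ge> 0"
  shows "carleman_weight \<alpha> s (4 * t) \<le> 2 powr (- \<alpha>) * carleman_weight \<alpha> s t"
proof -
  have "ln 2 \<ge> (1/2::real)" using ln_add_one_self_le_self2 ln_2_less_1 exp_le
    by (smt (verit) ln_ge_iff exp_half_le2)
  moreover have "ln (4 * t) = 2 * ln 2 + ln t"
    using t ln_realpow[of 2 2] by (simp add: ln_mult)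
  moreover have "s * t \<ge> 0" using \<alpha> t by simp
  ultimately have "s * (4 * t) - ln (4 * t) \<le> - ln 2 + (s * t - ln t)" using s by linarith
  then have "\<alpha> * (s * (4 * t) - ln (4 * t)) \<le> \<alpha> * (- ln 2 + (s * t - ln t))" using \<alpha> by (intro mult_left_mono)
  also have "\<dots> = - \<alpha> * ln 2 + \<alpha> * (s * t - ln t)" by (simp add: algebra_simps)
  finally show ?thesis unfolding carleman_weight_def powr_def by (simp add: exp_add[symmetric])
qed

text \<open>The exponential only helps here. Squared, this is the loss at the inner scale and the
  origin of the power of \<open>M / \<delta>\<close>.\<close>

lemma carleman_weight_ratio:
  assumes t: "0 < t" "t \<le> t'" and \<alpha>: "\<alpha> \<ge> 0" "s \<ge> 0"
  shows "carleman_weight \<alpha> s t \<le> (t' / t) powr \<alpha> * carleman_weight \<alpha> s t'"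
proof -
  have "s * t \<le> s * t'" using t \<alpha> by (intro mult_left_mono)
  then have "\<alpha> * (s * t - ln t) \<le> \<alpha> * (ln (t' / t) + (s * t' - ln t'))"
    using t \<alpha> by (intro mult_left_mono) (auto simp: ln_div)
  then show ?thesis using t unfolding carleman_weight_def powr_def by (simp add: exp_add[symmetric] algebra_simps)
qed

subsection \<open>The estimate around one site\<close>

lemma integrable_indicator_mult:
  fixes f :: "'a::euclidean_space \<Rightarrow> real"
  shows "integrable lebesgue f \<Longrightarrow> A \<in> sets lebesgue \<Longrightarrow> integrable lebesgue (\<lambda>x. indicator A x * f x)"
  using integrable_mult_indicator[of A lebesgue f] by simp

lemma sum_square_le: "(a + b)\<^sup>2 \<le> 2 * a\<^sup>2 + 2 * (b::real)\<^sup>2"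
proof -
  have "0 \<le> (a - b)\<^sup>2" by simp
  then show ?thesis by (simp add: power2_eq_square algebra_simps)
qed

text \<open>The commutator of the Laplacian with a cutoff at scale \<open>\<rho>\<close>. It is
  applied with \<open>A = r w(r)\<close> and \<open>B = w(\<rho>)\<close>: monotonicity of
  \<open>r w\<close> gives \<open>A \<le> \<rho> B\<close>, and this \<open>\<rho>\<close> cancels
  one power of the scale in the cutoff bounds.\<close>

lemma cutoff_error_le:
  fixes g y :: "'a::real_inner" and u L C \<rho> A B :: real
  assumes "\<rho> > 0" "\<bar>L\<bar> \<le> C / \<rho>\<^sup>2" "norm g \<le> C / \<rho>" "0 \<le> A" "A \<le> \<rho> * B"
  shows "A\<^sup>2 * (2 * (u * L + 2 * (g \<bullet> y))\<^sup>2) \<le> B\<^sup>2 * (4 * C\<^sup>2 * (u\<^sup>2 / \<rho>\<^sup>2 + 4 * (norm y)\<^sup>2))"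
proof -
  have "(g \<bullet> y)\<^sup>2 \<le> (norm g)\<^sup>2 * (norm y)\<^sup>2"
    using Cauchy_Schwarz_ineq[of g y] by (simp add: power2_norm_eq_inner)
  also have "\<dots> \<le> (C / \<rho>)\<^sup>2 * (norm y)\<^sup>2"
    using assms by (intro mult_right_mono power_mono) auto
  finally have 1: "(g \<bullet> y)\<^sup>2 \<le> (C / \<rho>)\<^sup>2 * (norm y)\<^sup>2" .
  have "\<bar>L\<bar>\<^sup>2 \<le> (C / \<rho>\<^sup>2)\<^sup>2" using assms by (intro power_mono) auto
  then have 2: "u\<^sup>2 * L\<^sup>2 \<le> u\<^sup>2 * (C / \<rho>\<^sup>2)\<^sup>2" by (intro mult_left_mono) auto
  have "2 * (u * L + 2 * (g \<bullet> y))\<^sup>2 \<le> 4 * (u\<^sup>2 * L\<^sup>2) + 16 * (g \<bullet> y)\<^sup>2"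
    using sum_square_le[of "u * L" "2 * (g \<bullet> y)"] by (simp add: power_mult_distrib)
  also have "\<dots> \<le> 4 * (u\<^sup>2 * (C / \<rho>\<^sup>2)\<^sup>2) + 16 * ((C / \<rho>)\<^sup>2 * (norm y)\<^sup>2)"
    using 1 2 by linarith
  also have "\<dots> = (4 * C\<^sup>2 * (u\<^sup>2 / \<rho>\<^sup>2 + 4 * (norm y)\<^sup>2)) / \<rho>\<^sup>2"
    using assms(1) by (simp add: field_simps power2_eq_square)
  finally have 3: "2 * (u * L + 2 * (g \<bullet> y))\<^sup>2 \<le> (4 * C\<^sup>2 * (u\<^sup>2 / \<rho>\<^sup>2 + 4 * (norm y)\<^sup>2)) / \<rho>\<^sup>2" .
  have "A\<^sup>2 \<le> (\<rho> * B)\<^sup>2" using assms by (intro power_mono) auto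
  then have "A\<^sup>2 * (2 * (u * L + 2 * (g \<bullet> y))\<^sup>2) \<le> (\<rho> * B)\<^sup>2 * ((4 * C\<^sup>2 * (u\<^sup>2 / \<rho>\<^sup>2 + 4 * (norm y)\<^sup>2)) / \<rho>\<^sup>2)"
    using 3 by (intro mult_mono) auto
  also have "\<dots> = B\<^sup>2 * (4 * C\<^sup>2 * (u\<^sup>2 / \<rho>\<^sup>2 + 4 * (norm y)\<^sup>2))"
    using assms(1) by (simp add: power_mult_distrib)
  finally show ?thesis .
qed

text \<open>The constant \<open>131072 = 4 * 64 * 8^3\<close> is what absorbs the contribution of the potential on \<open>r \<le> 8 R\<close>
when \<open>s = 1 / (16 R)\<close>.\<close>

lemma site_carleman:
  fixes u :: "'a::euclidean_space \<Rightarrow> real" and z :: 'a and \<alpha> R \<delta> N :: real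
  assumes u: "C2_on UNIV u G H" and K: "compact K" "\<And>x. x \<notin> K \<Longrightarrow> u x = 0"
    and \<zeta>: "integrable lebesgue (\<lambda>x. (\<zeta> x)\<^sup>2)"
    and ae: "AE x in lebesgue. \<bar>trace_map (H x)\<bar> \<le> N * \<bar>u x\<bar> + \<bar>\<zeta> x\<bar>"
    and N: "N \<ge> 0" and \<delta>: "0 < \<delta>" "\<delta> \<le> R"
    and \<alpha>: "\<alpha> \<ge> 2" "\<alpha>\<^sup>2 \<ge> 2 * (real DIM('a) - 1)\<^sup>2" "\<alpha>^3 \<ge> 131072 * N\<^sup>2 * R^4"
  defines "w \<equiv> carleman_weight \<alpha> (1 / (16 * R))" and "C \<equiv> 6 * real DIM('a) + 128"
  shows "\<alpha>^3 / (64 * R\<^sup>2) * (w R)\<^sup>2 * (LINT x|lebesgue. indicator (cball z R - ball z (\<delta>/2)) x * (u x)\<^sup>2)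
    \<le> (w (\<delta>/4))\<^sup>2 * (\<delta>\<^sup>2 / 4 * (LINT x|lebesgue. indicator (cball z (8*R)) x * (\<zeta> x)\<^sup>2)
        + 4 * C\<^sup>2 * (LINT x|lebesgue. indicator (cball z (\<delta>/2)) x * (16 * (u x)\<^sup>2 / \<delta>\<^sup>2 + 4 * (norm (G x))\<^sup>2)))
      + (w (4*R))\<^sup>2 * (4 * C\<^sup>2 * (LINT x|lebesgue. indicator (cball z (8*R)) x * ((u x)\<^sup>2 / (16 * R\<^sup>2) + 4 * (norm (G x))\<^sup>2)))"
proof -
  \<comment> \<open>The largest \<open>s\<close> for which \<open>s r \<le> 1/2\<close> holds on the
    whole ball of radius \<open>8 R\<close>.\<close>
  define s where "s = 1 / (16 * R)"
  have R: "R > 0" using \<delta> by linarith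
  have s: "s > 0" unfolding s_def using R by simp
  define r where "r = (\<lambda>x. norm (x - z))"
  have sr: "s * t \<le> 1/2" if "t \<le> 8 * R" for t
    using that R unfolding s_def by (simp add: field_simps)
  have w_pos: "w t > 0" for t unfolding w_def by (rule carleman_weight_pos)
  have wmono: "t' * w t' \<le> t * w t" "w t' \<le> w t" if "0 < t" "t \<le> t'" "t' \<le> 8 * R" for t t'
    using carleman_weight_antimono[of t t' s \<alpha>] that s sr[of t'] \<alpha> unfolding w_def s_def by auto
  obtain \<eta>i Gi Hi where i: "C2_on UNIV \<eta>i Gi Hi" "\<And>x. 0 \<le> \<eta>i x" "\<And>x. \<eta>i x \<le> 1"
    "\<And>x. r x \<le> \<delta>/4 \<Longrightarrow> \<eta>i x = 0" "\<And>x. 2 * (\<delta>/4) \<le> r x \<Longrightarrow> \<eta>i x = 1"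
    "\<And>x. r x \<le> \<delta>/4 \<or> 2 * (\<delta>/4) \<le> r x \<Longrightarrow> Gi x = 0"
    "\<And>x. r x \<le> \<delta>/4 \<or> 2 * (\<delta>/4) \<le> r x \<Longrightarrow> trace_map (Hi x) = 0"
    "\<And>x. norm (Gi x) \<le> C / (\<delta>/4)" "\<And>x. \<bar>trace_map (Hi x)\<bar> \<le> C / (\<delta>/4)\<^sup>2"
    unfolding r_def C_def by (rule cutoff_exists[of "\<delta>/4" z]) (use \<delta> in auto)
  obtain \<eta>o Go Ho where o: "C2_on UNIV \<eta>o Go Ho" "\<And>x. 0 \<le> \<eta>o x" "\<And>x. \<eta>o x \<le> 1"
    "\<And>x. r x \<le> 4*R \<Longrightarrow> \<eta>o x = 0" "\<And>x. 2 * (4*R) \<le> r x \<Longrightarrow> \<eta>o x = 1"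
    "\<And>x. r x \<le> 4*R \<or> 2 * (4*R) \<le> r x \<Longrightarrow> Go x = 0"
    "\<And>x. r x \<le> 4*R \<or> 2 * (4*R) \<le> r x \<Longrightarrow> trace_map (Ho x) = 0"
    "\<And>x. norm (Go x) \<le> C / (4*R)" "\<And>x. \<bar>trace_map (Ho x)\<bar> \<le> C / (4*R)\<^sup>2"
    unfolding r_def C_def by (rule cutoff_exists[of "4*R" z]) (use R in auto)
  \<comment> \<open>This rises from 0 to 1 between \<open>\<delta>/4\<close> and
    \<open>\<delta>/2\<close>, is 1 up to \<open>4 R\<close>, and falls back to 0 at
    \<open>8 R\<close>.\<close>
  define \<theta> where "\<theta> = (\<lambda>x. \<eta>i x * (1 - \<eta>o x))"
  note C\<theta> = C2_on_mult[OF i(1) C2_on_diff_const[OF o(1), of 1]]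
  define G\<theta> where "G\<theta> = (\<lambda>x. \<eta>i x *\<^sub>R - Go x + (1 - \<eta>o x) *\<^sub>R Gi x)"
  define H\<theta> where "H\<theta> = (\<lambda>x h. \<eta>i x *\<^sub>R - Ho x h + (1 - \<eta>o x) *\<^sub>R Hi x h + (Gi x \<bullet> h) *\<^sub>R - Go x + (- Go x \<bullet> h) *\<^sub>R Gi x)"
  note C\<theta> = C\<theta>[folded \<theta>_def G\<theta>_def H\<theta>_def]
  define f where "f = (\<lambda>x. \<theta> x * u x)"
  note Cf = C2_on_mult[OF C\<theta> u, folded f_def]
  define Lf where "Lf x = \<theta> x * trace_map (H x) + (u x * trace_map (H\<theta> x) + 2 * (G\<theta> x \<bullet> G x))" for x
  have tf: "trace_map (\<lambda>h. \<theta> x *\<^sub>R H x h + u x *\<^sub>R H\<theta> x h + (G\<theta> x \<bullet> h) *\<^sub>R G x + (G x \<bullet> h) *\<^sub>R G\<theta> x) = Lf x" for x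
    unfolding trace_map_simps Lf_def by (simp add: inner_commute)
  define Kf where "Kf = K \<inter> (cball z (8*R) - ball z (\<delta>/4))"
  have Kf: "compact Kf" "z \<notin> Kf" "\<And>x. x \<notin> Kf \<Longrightarrow> f x = 0"
  proof -
    show "compact Kf" unfolding Kf_def using K(1) by (simp add: compact_Int_closed closed_Diff)
    show "z \<notin> Kf" unfolding Kf_def using \<delta> by simp
    show "f x = 0" if "x \<notin> Kf" for x
      using that K(2)[of x] i(4)[of x] o(5)[of x] unfolding Kf_def f_def \<theta>_def r_def
      by (auto simp: dist_norm norm_minus_commute)
  qed
  have sKf: "s * norm (x - z) \<le> 1/2" if "x \<in> Kf" for x
    using that sr[of "norm (x - z)"] unfolding Kf_def by (auto simp: dist_norm norm_minus_commute)
  define I where "I = (LINT x|lebesgue. (w (r x))\<^sup>2 * (f x)\<^sup>2 / r x)"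
  have carl: "\<alpha>^3 * s / 2 * I \<le> (LINT x|lebesgue. (r x * w (r x) * Lf x)\<^sup>2)"
    using carleman_estimate[OF Cf Kf s sKf _ \<alpha>(2)] \<alpha>(1) unfolding tf I_def r_def w_def s_def by simp
  have \<theta>01: "0 \<le> \<theta> x" "\<theta> x \<le> 1" for x
    unfolding \<theta>_def using i(2,3)[of x] o(2,3)[of x] by (auto intro: mult_le_one)
  have cw: "continuous_on Kf (\<lambda>x. w (r x))" "continuous_on Kf r" "\<forall>x\<in>Kf. r x \<noteq> 0"
    using Kf(2) R unfolding w_def carleman_weight_def r_def by (auto intro!: continuous_intros)
  have cf: "continuous_on Kf f" "continuous_on Kf Lf"
  proof -
    show "continuous_on Kf f" by (rule continuous_on_subset[OF C2_onD(5)[OF Cf]]) simp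
    show "continuous_on Kf Lf" using continuous_on_subset[OF C2_on_continuous_trace[OF Cf], of Kf] unfolding tf by simp
  qed
  have Lf0: "Lf x = 0" if "x \<notin> Kf" for x
    using C2_on_support(2)[OF Cf compact_imp_closed[OF Kf(1)] Kf(3) _ that] unfolding tf[symmetric] trace_map_def by simp
  let ?J = "\<lambda>x. (w (r x))\<^sup>2 * (f x)\<^sup>2 / r x"
  have iI: "integrable lebesgue ?J"
    by (rule integrable_compact_support[OF Kf(1)]) (auto intro!: continuous_intros cw cf simp: Kf(3) cw(3))
  have iP: "integrable lebesgue (\<lambda>x. (r x * w (r x) * Lf x)\<^sup>2)"
    by (rule integrable_compact_support[OF Kf(1)]) (auto intro!: continuous_intros cw cf simp: Lf0)
  have G0: "G x = 0" if "x \<notin> K" for x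
    using C2_on_support[OF u compact_imp_closed[OF K(1)] K(2), of x] that by auto
  have iu: "integrable lebesgue (\<lambda>x. (u x)\<^sup>2)" "integrable lebesgue (\<lambda>x. (norm (G x))\<^sup>2)"
    by (rule integrable_compact_support[OF K(1)];
        use C2_onD(5,6)[OF u] K(2) G0 in \<open>auto intro!: continuous_intros intro: continuous_on_subset\<close>)+
  let ?z = "\<lambda>x. indicator (cball z (8*R)) x * (\<zeta> x)\<^sup>2"
  let ?i = "\<lambda>x. indicator (cball z (\<delta>/2)) x * (16 * (u x)\<^sup>2 / \<delta>\<^sup>2 + 4 * (norm (G x))\<^sup>2)"
  let ?o = "\<lambda>x. indicator (cball z (8*R)) x * ((u x)\<^sup>2 / (16 * R\<^sup>2) + 4 * (norm (G x))\<^sup>2)"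
  let ?l = "\<lambda>x. indicator (cball z R - ball z (\<delta>/2)) x * (u x)\<^sup>2"
  have ints: "integrable lebesgue ?z" "integrable lebesgue ?i" "integrable lebesgue ?o" "integrable lebesgue ?l"
    by (intro integrable_indicator_mult \<zeta> Bochner_Integration.integrable_add integrable_mult_right integrable_divide iu; simp)+
  define Z where "Z = (LINT x|lebesgue. ?z x)"
  define Ii where "Ii = (LINT x|lebesgue. ?i x)"
  define Io where "Io = (LINT x|lebesgue. ?o x)"
  define Il where "Il = (LINT x|lebesgue. ?l x)"
  \<comment> \<open>The coefficient \<open>\<alpha>^3 s / 4\<close> is half of the Carleman gain,
    spent on the potential; the other half survives on the left.\<close>
  let ?rhs = "\<lambda>x. \<alpha>^3 * s / 4 * ?J x + ((w (\<delta>/4))\<^sup>2 * (\<delta>\<^sup>2 / 4 * ?z x + 4 * C\<^sup>2 * ?i x) + (w (4*R))\<^sup>2 * (4 * C\<^sup>2 * ?o x))"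
  have pointwise: "(r x * w (r x) * Lf x)\<^sup>2 \<le> ?rhs x" if ax: "\<bar>trace_map (H x)\<bar> \<le> N * \<bar>u x\<bar> + \<bar>\<zeta> x\<bar>" for x
  proof -
    have T\<theta>: "trace_map (H\<theta> x) = - (\<eta>i x * trace_map (Ho x)) + (1 - \<eta>o x) * trace_map (Hi x) - 2 * (Gi x \<bullet> Go x)"
      unfolding H\<theta>_def trace_map_simps by (simp add: inner_commute)
    have nn: "?J x \<ge> 0" "?z x \<ge> 0" "?i x \<ge> 0" "?o x \<ge> 0" by (auto simp: r_def)
    have rhs0: "?rhs x \<ge> 0" using nn \<alpha>(1) s by (intro add_nonneg_nonneg mult_nonneg_nonneg) auto
    show ?thesis
    proof (cases "r x \<le> \<delta>/4 \<or> 8 * R \<le> r x")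
      case True
      then have "Lf x = 0"
      proof
        assume a: "r x \<le> \<delta>/4"
        then have "r x \<le> 4 * R" using \<delta> by linarith
        then show ?thesis using a i(4,6,7)[of x] o(4,6,7)[of x] unfolding Lf_def T\<theta> \<theta>_def G\<theta>_def by simp
      next
        assume a: "8 * R \<le> r x"
        then have "2 * (\<delta>/4) \<le> r x" using \<delta> by linarith
        then show ?thesis using a i(5,6,7)[of x] o(5,6,7)[of x] unfolding Lf_def T\<theta> \<theta>_def G\<theta>_def by simp
      qed
      then show ?thesis using rhs0 by simp
    next
      case False
      then have rx: "\<delta>/4 < r x" "r x < 8 * R" by auto
      then have rp: "r x > 0" using \<delta> by linarith
      have in8: "x \<in> cball z (8*R)" using rx unfolding r_def by (simp add: dist_norm norm_minus_commute)
      let ?W = "r x * w (r x)"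
      have W0: "?W \<ge> 0" using rp w_pos[of "r x"] by simp
      have W1: "?W \<le> \<delta>/4 * w (\<delta>/4)" using rx \<delta> by (intro wmono) auto
      let ?E = "u x * trace_map (H\<theta> x) + 2 * (G\<theta> x \<bullet> G x)"
      have "trace_map (H x) ^ 2 \<le> (N * \<bar>u x\<bar> + \<bar>\<zeta> x\<bar>)\<^sup>2"
        using ax N by (intro power2_le_iff_abs_le[THEN iffD2]) auto
      also have "\<dots> \<le> 2 * N\<^sup>2 * (u x)\<^sup>2 + 2 * (\<zeta> x)\<^sup>2"
        using sum_square_le[of "N * \<bar>u x\<bar>" "\<bar>\<zeta> x\<bar>"] by (simp add: power_mult_distrib)
      finally have tH: "trace_map (H x) ^ 2 \<le> 2 * N\<^sup>2 * (u x)\<^sup>2 + 2 * (\<zeta> x)\<^sup>2" .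
      have "(Lf x)\<^sup>2 \<le> 2 * (\<theta> x)\<^sup>2 * (trace_map (H x))\<^sup>2 + 2 * ?E\<^sup>2"
        unfolding Lf_def using sum_square_le[of "\<theta> x * trace_map (H x)" ?E] by (simp add: power_mult_distrib)
      also have "\<dots> \<le> 2 * (\<theta> x)\<^sup>2 * (2 * N\<^sup>2 * (u x)\<^sup>2 + 2 * (\<zeta> x)\<^sup>2) + 2 * ?E\<^sup>2"
        by (intro add_right_mono mult_left_mono tH) auto
      finally have "?W\<^sup>2 * (Lf x)\<^sup>2 \<le> ?W\<^sup>2 * (2 * (\<theta> x)\<^sup>2 * (2 * N\<^sup>2 * (u x)\<^sup>2 + 2 * (\<zeta> x)\<^sup>2) + 2 * ?E\<^sup>2)"
        by (intro mult_left_mono) auto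
      then have main: "(?W * Lf x)\<^sup>2 \<le> 4 * N\<^sup>2 * (?W\<^sup>2 * (f x)\<^sup>2) + 4 * (?W\<^sup>2 * ((\<theta> x)\<^sup>2 * (\<zeta> x)\<^sup>2)) + ?W\<^sup>2 * (2 * ?E\<^sup>2)"
        unfolding f_def by (simp add: power_mult_distrib algebra_simps)
      have t1: "4 * N\<^sup>2 * (?W\<^sup>2 * (f x)\<^sup>2) \<le> \<alpha>^3 * s / 4 * ?J x"
      proof -
        have "(r x)^3 \<le> (8*R)^3" using rx rp by (intro power_mono) auto
        then have "4 * N\<^sup>2 * (r x)^3 \<le> 4 * N\<^sup>2 * (8*R)^3" by (intro mult_left_mono) auto
        also have "\<dots> \<le> \<alpha>^3 * s / 4" using \<alpha>(3) R unfolding s_def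
          by (simp add: field_simps power2_eq_square eval_nat_numeral)
        finally have "(4 * N\<^sup>2 * (r x)^3) * ?J x \<le> (\<alpha>^3 * s / 4) * ?J x" using nn by (intro mult_right_mono)
        moreover have "(4 * N\<^sup>2 * (r x)^3) * ?J x = 4 * N\<^sup>2 * (?W\<^sup>2 * (f x)\<^sup>2)"
          using rp by (simp add: field_simps power2_eq_square eval_nat_numeral)
        ultimately show ?thesis by simp
      qed
      have t2: "4 * (?W\<^sup>2 * ((\<theta> x)\<^sup>2 * (\<zeta> x)\<^sup>2)) \<le> (w (\<delta>/4))\<^sup>2 * (\<delta>\<^sup>2 / 4 * ?z x)"
      proof -
        have a: "?W\<^sup>2 \<le> (\<delta>/4 * w (\<delta>/4))\<^sup>2" using W0 W1 by (intro power_mono)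
        have b: "(\<theta> x)\<^sup>2 * (\<zeta> x)\<^sup>2 \<le> 1 * (\<zeta> x)\<^sup>2"
          using \<theta>01[of x] by (intro mult_right_mono power_le_one) auto
        have "?W\<^sup>2 * ((\<theta> x)\<^sup>2 * (\<zeta> x)\<^sup>2) \<le> (\<delta>/4 * w (\<delta>/4))\<^sup>2 * (1 * (\<zeta> x)\<^sup>2)"
          by (rule mult_mono[OF a b]) auto
        then show ?thesis using in8 by (simp add: power_mult_distrib power_divide mult_ac)
      qed
      \<comment> \<open>At each point at most one of the two cutoffs varies, because
        \<open>\<delta> / 2 \<le> 4 R\<close>; in between the commutator vanishes.\<close>
      have t3: "?W\<^sup>2 * (2 * ?E\<^sup>2) \<le> (w (\<delta>/4))\<^sup>2 * (4 * C\<^sup>2 * ?i x) + (w (4*R))\<^sup>2 * (4 * C\<^sup>2 * ?o x)"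
      proof (cases "r x \<le> \<delta>/2")
        case True
        then have "r x \<le> 4 * R" using \<delta> by linarith
        then have eq: "trace_map (H\<theta> x) = trace_map (Hi x)" "G\<theta> x = Gi x"
          using o(4,6,7)[of x] unfolding T\<theta> G\<theta>_def by auto
        have le: "?W\<^sup>2 * (2 * ?E\<^sup>2) \<le> (w (\<delta>/4))\<^sup>2 * (4 * C\<^sup>2 * ((u x)\<^sup>2 / (\<delta>/4)\<^sup>2 + 4 * (norm (G x))\<^sup>2))"
          unfolding eq using \<delta> i(8,9) W0 W1 by (intro cutoff_error_le) auto
        have x2: "x \<in> cball z (\<delta>/2)" using True unfolding r_def by (simp add: dist_norm norm_minus_commute)
        from x2 have ix: "?i x = (u x)\<^sup>2 / (\<delta>/4)\<^sup>2 + 4 * (norm (G x))\<^sup>2" by (simp add: power_divide)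
        have "(w (4*R))\<^sup>2 * (4 * C\<^sup>2 * ?o x) \<ge> 0" by simp
        then show ?thesis using le unfolding ix by linarith
      next
        case False
        then have eq: "trace_map (H\<theta> x) = - trace_map (Ho x)" "G\<theta> x = - Go x"
          using i(5,6,7)[of x] unfolding T\<theta> G\<theta>_def by auto
        have nn2: "(w (\<delta>/4))\<^sup>2 * (4 * C\<^sup>2 * ?i x) \<ge> 0" by simp
        show ?thesis
        proof (cases "r x \<le> 4 * R")
          case True
          then have "?E = 0" using eq o(6,7)[of x] by simp
          moreover have "(w (4*R))\<^sup>2 * (4 * C\<^sup>2 * ?o x) \<ge> 0" by simp
          ultimately show ?thesis using nn2 by simp
        next
          case False
          have "?W \<le> 4*R * w (4*R)" using False rx R by (intro wmono) auto
          then have le: "?W\<^sup>2 * (2 * ?E\<^sup>2) \<le> (w (4*R))\<^sup>2 * (4 * C\<^sup>2 * ((u x)\<^sup>2 / (4*R)\<^sup>2 + 4 * (norm (G x))\<^sup>2))"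
            unfolding eq using R o(8,9) W0 by (intro cutoff_error_le) auto
          have ox: "?o x = (u x)\<^sup>2 / (4*R)\<^sup>2 + 4 * (norm (G x))\<^sup>2"
            using in8 by (simp add: power_mult_distrib)
          show ?thesis using le nn2 unfolding ox by linarith
        qed
      qed
      show ?thesis using main t1 t2 t3 unfolding distrib_left by linarith
    qed
  qed
  have "(LINT x|lebesgue. (r x * w (r x) * Lf x)\<^sup>2) \<le> (LINT x|lebesgue. ?rhs x)"
  proof (rule integral_mono_AE[OF iP])
    show "integrable lebesgue ?rhs"
      by (intro Bochner_Integration.integrable_add integrable_mult_right iI ints)
    show "AE x in lebesgue. (r x * w (r x) * Lf x)\<^sup>2 \<le> ?rhs x"
      using ae by eventually_elim (rule pointwise)
  qed
  also have "(LINT x|lebesgue. ?rhs x) = \<alpha>^3 * s / 4 * I + ((w (\<delta>/4))\<^sup>2 * (\<delta>\<^sup>2 / 4 * Z + 4 * C\<^sup>2 * Ii) + (w (4*R))\<^sup>2 * (4 * C\<^sup>2 * Io))"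
    unfolding I_def Z_def Ii_def Io_def
    by (intro has_bochner_integral_integral_eq has_bochner_integral_add has_bochner_integral_mult_right
        has_bochner_integral_integrable iI ints)
  finally have up: "\<alpha>^3 * s / 4 * I \<le> (w (\<delta>/4))\<^sup>2 * (\<delta>\<^sup>2 / 4 * Z + 4 * C\<^sup>2 * Ii) + (w (4*R))\<^sup>2 * (4 * C\<^sup>2 * Io)"
    using carl by linarith
  \<comment> \<open>On the annulus from \<open>\<delta>/2\<close> to \<open>R\<close> one has
    \<open>f = u\<close>, and monotonicity bounds the weight below by its value at \<open>R\<close>.
    Stopping at \<open>R\<close>, while the outer cutoff only starts at \<open>4 R\<close>, creates
    the gap in the weight used for the absorption.\<close>
  have "(LINT x|lebesgue. (w R)\<^sup>2 / R * ?l x) \<le> I" unfolding I_def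
  proof (rule integral_mono[OF _ iI])
    show "integrable lebesgue (\<lambda>x. (w R)\<^sup>2 / R * ?l x)" by (intro integrable_mult_right ints)
    fix x
    show "(w R)\<^sup>2 / R * ?l x \<le> ?J x"
    proof (cases "x \<in> cball z R - ball z (\<delta>/2)")
      case True
      then have rx: "\<delta>/2 \<le> r x" "r x \<le> R" unfolding r_def by (auto simp: dist_norm norm_minus_commute)
      then have rp: "r x > 0" using \<delta> by linarith
      have fu: "f x = u x" unfolding f_def \<theta>_def using i(5)[of x] o(4)[of x] rx R by simp
      have "w R \<le> w (r x)" using rx R rp by (intro wmono) auto
      then have "(w R)\<^sup>2 \<le> (w (r x))\<^sup>2" using w_pos[of R] by (intro power_mono) auto
      then have "(w R)\<^sup>2 / R \<le> (w (r x))\<^sup>2 / r x" using rx rp by (intro frac_le) auto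
      then have "(w R)\<^sup>2 / R * (u x)\<^sup>2 \<le> (w (r x))\<^sup>2 / r x * (u x)\<^sup>2" by (intro mult_right_mono) auto
      then show ?thesis using True fu by simp
    next
      case False then show ?thesis unfolding r_def by simp
    qed
  qed
  then have "(w R)\<^sup>2 / R * Il \<le> I" unfolding Il_def by (simp only: integral_mult_right_zero)
  then have "\<alpha>^3 * s / 4 * ((w R)\<^sup>2 / R * Il) \<le> \<alpha>^3 * s / 4 * I"
    using \<alpha>(1) s by (intro mult_left_mono) auto
  moreover have "\<alpha>^3 * s / 4 * ((w R)\<^sup>2 / R * Il) = \<alpha>^3 / (64 * R\<^sup>2) * (w R)\<^sup>2 * Il"
    unfolding s_def using R by (simp add: field_simps power2_eq_square)
  ultimately show ?thesis using up unfolding Z_def Ii_def Io_def Il_def by linarith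
qed

text \<open>The energy identity is used with a plateau that is 1 on the ball of radius
  \<open>\<delta>/2\<close> and 0 outside that of radius \<open>\<delta>\<close>. The cutoff
  contributes \<open>(1/2) C / (\<delta>/2)^2 = 2 C / \<delta>^2\<close>, and the product of
  \<open>u\<close> and \<open>\<zeta>\<close> is split by Young's inequality so that
  \<open>\<zeta>^2\<close> carries the factor \<open>\<delta>^2\<close>.\<close>

lemma caccioppoli:
  fixes u :: "'a::euclidean_space \<Rightarrow> real" and z :: 'a and \<delta> N :: real
  assumes u: "C2_on UNIV u G H" and K: "compact K" "\<And>x. x \<notin> K \<Longrightarrow> u x = 0"
    and \<zeta>: "integrable lebesgue (\<lambda>x. (\<zeta> x)\<^sup>2)"
    and ae: "AE x in lebesgue. \<bar>trace_map (H x)\<bar> \<le> N * \<bar>u x\<bar> + \<bar>\<zeta> x\<bar>"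
    and \<delta>: "0 < \<delta>" and N: "N \<ge> 0"
  defines "C \<equiv> 6 * real DIM('a) + 128"
  shows "(LINT x|lebesgue. indicator (cball z (\<delta>/2)) x * (norm (G x))\<^sup>2)
    \<le> ((2 * C + 1) / \<delta>\<^sup>2 + N) * (LINT x|lebesgue. indicator (ball z \<delta>) x * (u x)\<^sup>2)
      + \<delta>\<^sup>2 * (LINT x|lebesgue. indicator (ball z \<delta>) x * (\<zeta> x)\<^sup>2)"
proof -
  obtain \<eta> Ge He where e: "C2_on UNIV \<eta> Ge He" "\<And>x. 0 \<le> \<eta> x" "\<And>x. \<eta> x \<le> 1"
    "\<And>x. norm (x - z) \<le> \<delta>/2 \<Longrightarrow> \<eta> x = 0" "\<And>x. 2 * (\<delta>/2) \<le> norm (x - z) \<Longrightarrow> \<eta> x = 1"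
    "\<And>x. norm (x - z) \<le> \<delta>/2 \<or> 2 * (\<delta>/2) \<le> norm (x - z) \<Longrightarrow> trace_map (He x) = 0"
    "\<And>x. \<bar>trace_map (He x)\<bar> \<le> C / (\<delta>/2)\<^sup>2"
    unfolding C_def by (rule cutoff_exists[of "\<delta>/2" z]) (use \<delta> in auto)
  let ?c = "\<lambda>x. 1 - \<eta> x"
  have G0: "G x = 0" "trace_map (H x) = 0" if "x \<notin> K" for x
    using C2_on_support[OF u compact_imp_closed[OF K(1)] K(2), of x] that by (auto simp: trace_map_def)
  have iu: "integrable lebesgue (\<lambda>x. (u x)\<^sup>2)" "integrable lebesgue (\<lambda>x. (norm (G x))\<^sup>2)"
      "integrable lebesgue (\<lambda>x. ?c x * (norm (G x))\<^sup>2)"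
      "integrable lebesgue (\<lambda>x. (u x)\<^sup>2 * trace_map (\<lambda>h. - He x h) / 2)"
      "integrable lebesgue (\<lambda>x. ?c x * u x * trace_map (H x))"
    by (rule integrable_compact_support[OF K(1)];
        use C2_on_continuous_trace[OF u] C2_on_continuous_trace[OF e(1)] C2_onD(5)[OF e(1)] C2_onD(5,6)[OF u] K(2) G0 in
          \<open>auto intro!: continuous_intros intro: continuous_on_subset\<close>)+
  let ?U = "\<lambda>x. indicator (ball z \<delta>) x * (u x)\<^sup>2" and ?Z = "\<lambda>x. indicator (ball z \<delta>) x * (\<zeta> x)\<^sup>2"
  have ii: "integrable lebesgue ?U" "integrable lebesgue ?Z"
    by (intro integrable_indicator_mult iu \<zeta>; simp)+
  have "(LINT x|lebesgue. indicator (cball z (\<delta>/2)) x * (norm (G x))\<^sup>2) \<le> (LINT x|lebesgue. ?c x * (norm (G x))\<^sup>2)"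
  proof (rule integral_mono)
    show "integrable lebesgue (\<lambda>x. indicator (cball z (\<delta>/2)) x * (norm (G x))\<^sup>2)"
      by (intro integrable_indicator_mult iu) simp
    fix x
    show "indicator (cball z (\<delta>/2)) x * (norm (G x))\<^sup>2 \<le> ?c x * (norm (G x))\<^sup>2"
      using e(3,4)[of x] by (intro mult_right_mono) (auto simp: indicator_def dist_norm norm_minus_commute)
  qed (rule iu)
  also have "\<dots> = (LINT x|lebesgue. (u x)\<^sup>2 * trace_map (\<lambda>h. - He x h) / 2) - (LINT x|lebesgue. ?c x * u x * trace_map (H x))"
    using energy_identity[OF u C2_on_diff_const[OF e(1), of 1] K] by simp
  also have "\<dots> = (LINT x|lebesgue. (u x)\<^sup>2 * trace_map (\<lambda>h. - He x h) / 2 - ?c x * u x * trace_map (H x))"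
    using iu by (intro Bochner_Integration.integral_diff[symmetric])
  also have "\<dots> \<le> (LINT x|lebesgue. ((2 * C + 1) / \<delta>\<^sup>2 + N) * ?U x + \<delta>\<^sup>2 * ?Z x)"
  proof (rule integral_mono_AE)
    show "integrable lebesgue (\<lambda>x. (u x)\<^sup>2 * trace_map (\<lambda>h. - He x h) / 2 - ?c x * u x * trace_map (H x))"
      by (intro Bochner_Integration.integrable_diff iu)
    show "integrable lebesgue (\<lambda>x. ((2 * C + 1) / \<delta>\<^sup>2 + N) * ?U x + \<delta>\<^sup>2 * ?Z x)"
      by (intro Bochner_Integration.integrable_add integrable_mult_right ii)
    show "AE x in lebesgue. (u x)\<^sup>2 * trace_map (\<lambda>h. - He x h) / 2 - ?c x * u x * trace_map (H x)
        \<le> ((2 * C + 1) / \<delta>\<^sup>2 + N) * ?U x + \<delta>\<^sup>2 * ?Z x"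
      using ae
    proof eventually_elim
      fix x assume ax: "\<bar>trace_map (H x)\<bar> \<le> N * \<bar>u x\<bar> + \<bar>\<zeta> x\<bar>"
      show "(u x)\<^sup>2 * trace_map (\<lambda>h. - He x h) / 2 - ?c x * u x * trace_map (H x)
        \<le> ((2 * C + 1) / \<delta>\<^sup>2 + N) * ?U x + \<delta>\<^sup>2 * ?Z x"
      proof (cases "x \<in> ball z \<delta>")
        case True
        have "\<bar>(u x)\<^sup>2 * trace_map (\<lambda>h. - He x h) / 2\<bar> = (u x)\<^sup>2 * \<bar>trace_map (He x)\<bar> / 2"
          by (simp add: abs_mult)
        also have "\<dots> \<le> (u x)\<^sup>2 * (C / (\<delta>/2)\<^sup>2) / 2"
          by (intro divide_right_mono mult_left_mono e) auto
        also have "\<dots> = 2 * C / \<delta>\<^sup>2 * (u x)\<^sup>2" by (simp add: power_divide)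
        finally have 1: "(u x)\<^sup>2 * trace_map (\<lambda>h. - He x h) / 2 \<le> 2 * C / \<delta>\<^sup>2 * (u x)\<^sup>2" by linarith
        have "\<bar>?c x * u x * trace_map (H x)\<bar> = ?c x * (\<bar>u x\<bar> * \<bar>trace_map (H x)\<bar>)"
          using e(3)[of x] by (simp add: abs_mult)
        also have "\<dots> \<le> 1 * (\<bar>u x\<bar> * (N * \<bar>u x\<bar> + \<bar>\<zeta> x\<bar>))"
          using e(2,3)[of x] ax by (intro mult_mono mult_left_mono) auto
        also have "\<dots> = N * (u x)\<^sup>2 + \<bar>u x\<bar> * \<bar>\<zeta> x\<bar>"
          by (simp add: algebra_simps power2_eq_square flip: abs_mult)
        also have "\<bar>u x\<bar> * \<bar>\<zeta> x\<bar> \<le> (u x)\<^sup>2 / \<delta>\<^sup>2 + \<delta>\<^sup>2 * (\<zeta> x)\<^sup>2"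
        proof -
          have "2 * (\<bar>u x\<bar> / \<delta>) * (\<delta> * \<bar>\<zeta> x\<bar>) \<le> (\<bar>u x\<bar> / \<delta>)\<^sup>2 + (\<delta> * \<bar>\<zeta> x\<bar>)\<^sup>2" by (rule sum_squares_bound)
          then have "2 * (\<bar>u x\<bar> * \<bar>\<zeta> x\<bar>) \<le> (u x)\<^sup>2 / \<delta>\<^sup>2 + \<delta>\<^sup>2 * (\<zeta> x)\<^sup>2"
            using \<delta> by (simp add: power_mult_distrib power_divide)
          moreover have "0 \<le> \<bar>u x\<bar> * \<bar>\<zeta> x\<bar>" by simp
          ultimately show ?thesis by linarith
        qed
        finally have 2: "- (?c x * u x * trace_map (H x)) \<le> N * (u x)\<^sup>2 + ((u x)\<^sup>2 / \<delta>\<^sup>2 + \<delta>\<^sup>2 * (\<zeta> x)\<^sup>2)" by linarith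
        show ?thesis using 1 2 True by (simp add: algebra_simps add_divide_distrib)
      next
        case False
        then have "\<delta> \<le> norm (x - z)" by (simp add: dist_norm norm_minus_commute)
        then show ?thesis using e(5,6)[of x] False by simp
      qed
    qed
  qed
  also have "\<dots> = ((2 * C + 1) / \<delta>\<^sup>2 + N) * (LINT x|lebesgue. ?U x) + \<delta>\<^sup>2 * (LINT x|lebesgue. ?Z x)"
    using ii by (subst Bochner_Integration.integral_add) simp_all
  finally show ?thesis .
qed

text \<open>The gradient near the site is removed by Caccioppoli's inequality, whereas the one at
  the outer cutoff stays until the sites are summed. With \<open>C = 6 d + 128\<close> the inner
  terms cost at most \<open>53 C^3\<close> and the outer ones \<open>16 C^2\<close>;
  \<open>D = 100 C^3\<close> covers both.\<close>

lemma site_estimate: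
  fixes u :: "'a::euclidean_space \<Rightarrow> real" and z :: 'a and \<alpha> R \<delta> N :: real
  assumes u: "C2_on UNIV u G H" and K: "compact K" "\<And>x. x \<notin> K \<Longrightarrow> u x = 0"
    and \<zeta>: "integrable lebesgue (\<lambda>x. (\<zeta> x)\<^sup>2)"
    and ae: "AE x in lebesgue. \<bar>trace_map (H x)\<bar> \<le> N * \<bar>u x\<bar> + \<bar>\<zeta> x\<bar>"
    and N: "N \<ge> 0" and \<delta>: "0 < \<delta>" "\<delta> \<le> R"
    and \<alpha>: "\<alpha> \<ge> 2" "\<alpha>\<^sup>2 \<ge> 2 * (real DIM('a) - 1)\<^sup>2" "\<alpha>^3 \<ge> 131072 * N\<^sup>2 * R^4"
  defines "w \<equiv> carleman_weight \<alpha> (1 / (16 * R))" and "D \<equiv> 100 * (6 * real DIM('a) + 128)^3"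
  shows "\<alpha>^3 / (64 * R\<^sup>2) * (w R)\<^sup>2 * (LINT x|lebesgue. indicator (cball z R - ball z (\<delta>/2)) x * (u x)\<^sup>2)
    \<le> D * (w (\<delta>/4))\<^sup>2 * ((1 / \<delta>\<^sup>2 + N) * (LINT x|lebesgue. indicator (ball z \<delta>) x * (u x)\<^sup>2)
         + \<delta>\<^sup>2 * (LINT x|lebesgue. indicator (cball z (8*R)) x * (\<zeta> x)\<^sup>2))
      + D * (w (4*R))\<^sup>2 * (LINT x|lebesgue. indicator (cball z (8*R)) x * ((u x)\<^sup>2 / R\<^sup>2 + (norm (G x))\<^sup>2))"
proof -
  define C where "C = 6 * real DIM('a) + 128"
  have C: "C \<ge> 128" unfolding C_def by simp
  have R: "R > 0" using \<delta> by linarith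
  have G0: "G x = 0" if "x \<notin> K" for x
    using C2_on_support[OF u compact_imp_closed[OF K(1)] K(2), of x] that by auto
  have iu: "integrable lebesgue (\<lambda>x. (u x)\<^sup>2)" "integrable lebesgue (\<lambda>x. (norm (G x))\<^sup>2)"
    by (rule integrable_compact_support[OF K(1)];
        use C2_onD(5,6)[OF u] K(2) G0 in \<open>auto intro!: continuous_intros intro: continuous_on_subset\<close>)+
  let ?I = "\<lambda>A f. LINT x|lebesgue. indicator A x * f x"
  define U where "U = ?I (ball z \<delta>) (\<lambda>x. (u x)\<^sup>2)"
  define Z where "Z = ?I (cball z (8*R)) (\<lambda>x. (\<zeta> x)\<^sup>2)"
  define g where "g = ?I (cball z (\<delta>/2)) (\<lambda>x. (norm (G x))\<^sup>2)"
  define O1 where "O1 = ?I (cball z (8*R)) (\<lambda>x. (u x)\<^sup>2 / R\<^sup>2 + (norm (G x))\<^sup>2)"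
  have mono: "?I A f \<le> ?I B f'" if "\<And>x. x \<in> A \<Longrightarrow> x \<in> B \<and> f x \<le> f' x" "\<And>x. 0 \<le> f' x"
    "integrable lebesgue f" "integrable lebesgue f'" "A \<in> sets lebesgue" "B \<in> sets lebesgue" for A B and f f' :: "'a \<Rightarrow> real"
    using that by (intro integral_mono integrable_indicator_mult) (auto simp: indicator_def)
  have U0: "U \<ge> 0" "Z \<ge> 0" "O1 \<ge> 0" unfolding U_def Z_def O1_def by (auto intro!: integral_nonneg_AE)
  have "?I (ball z \<delta>) (\<lambda>x. (\<zeta> x)\<^sup>2) \<le> Z"
    unfolding Z_def using R \<delta> by (intro mono \<zeta>) auto
  then have "\<delta>\<^sup>2 * ?I (ball z \<delta>) (\<lambda>x. (\<zeta> x)\<^sup>2) \<le> \<delta>\<^sup>2 * Z" by (intro mult_left_mono) auto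
  then have "g \<le> ((2 * C + 1) / \<delta>\<^sup>2 + N) * U + \<delta>\<^sup>2 * Z"
    using caccioppoli[OF u K \<zeta> ae \<delta>(1) N, of z] unfolding C_def U_def g_def
    by linarith
  also have "\<dots> \<le> (3 * C) * ((1 / \<delta>\<^sup>2 + N) * U + \<delta>\<^sup>2 * Z)"
  proof -
    have "(2 * C + 1) / \<delta>\<^sup>2 + N \<le> 3 * C * (1 / \<delta>\<^sup>2 + N)"
    proof -
      have "(2 * C + 1) / \<delta>\<^sup>2 \<le> (3 * C) / \<delta>\<^sup>2" using C by (intro divide_right_mono) auto
      moreover have "1 * N \<le> 3 * C * N" using C N by (intro mult_right_mono) auto
      ultimately show ?thesis by (simp add: algebra_simps)
    qed
    then have "((2 * C + 1) / \<delta>\<^sup>2 + N) * U \<le> 3 * C * (1 / \<delta>\<^sup>2 + N) * U" using U0 by (intro mult_right_mono)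
    moreover have "1 * (\<delta>\<^sup>2 * Z) \<le> 3 * C * (\<delta>\<^sup>2 * Z)" using C U0 by (intro mult_right_mono) auto
    ultimately show ?thesis by (simp add: algebra_simps)
  qed
  finally have g: "g \<le> (3 * C) * ((1 / \<delta>\<^sup>2 + N) * U + \<delta>\<^sup>2 * Z)" .
  define P where "P = (1 / \<delta>\<^sup>2 + N) * U + \<delta>\<^sup>2 * Z"
  note g = g[folded P_def]
  have P0: "P \<ge> 0" unfolding P_def using U0 N by simp
  have inner: "?I (cball z (\<delta>/2)) (\<lambda>x. 16 * (u x)\<^sup>2 / \<delta>\<^sup>2 + 4 * (norm (G x))\<^sup>2) \<le> 16 / \<delta>\<^sup>2 * U + 4 * g"
  proof -
    have "?I (cball z (\<delta>/2)) (\<lambda>x. 16 * (u x)\<^sup>2 / \<delta>\<^sup>2 + 4 * (norm (G x))\<^sup>2)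
      = 16 / \<delta>\<^sup>2 * ?I (cball z (\<delta>/2)) (\<lambda>x. (u x)\<^sup>2) + 4 * g"
    proof -
      have eq: "(\<lambda>x. indicator (cball z (\<delta>/2)) x * (16 * (u x)\<^sup>2 / \<delta>\<^sup>2 + 4 * (norm (G x))\<^sup>2))
        = (\<lambda>x. 16 / \<delta>\<^sup>2 * (indicator (cball z (\<delta>/2)) x * (u x)\<^sup>2) + 4 * (indicator (cball z (\<delta>/2)) x * (norm (G x))\<^sup>2))"
        by (auto simp: fun_eq_iff indicator_def)
      show ?thesis unfolding eq g_def
        by (intro has_bochner_integral_integral_eq has_bochner_integral_add has_bochner_integral_mult_right
          has_bochner_integral_integrable integrable_indicator_mult iu) auto
    qed
    moreover have "?I (cball z (\<delta>/2)) (\<lambda>x. (u x)\<^sup>2) \<le> U"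
      unfolding U_def using \<delta> by (intro mono iu) auto
    ultimately show ?thesis by (simp add: divide_right_mono)
  qed
  have in2: "\<delta>\<^sup>2 / 4 * Z + 4 * C\<^sup>2 * ?I (cball z (\<delta>/2)) (\<lambda>x. 16 * (u x)\<^sup>2 / \<delta>\<^sup>2 + 4 * (norm (G x))\<^sup>2) \<le> D * P"
  proof -
    have "\<delta>\<^sup>2 / 4 * Z \<le> 1 * P" unfolding P_def using U0 N by (simp add: add_increasing)
    also have "\<dots> \<le> C^3 * P" using C P0 by (intro mult_right_mono) auto
    finally have 1: "\<delta>\<^sup>2 / 4 * Z \<le> C^3 * P" .
    have "16 / \<delta>\<^sup>2 * U + 4 * g \<le> 16 * P + 12 * C * P"
    proof -
      have "0 \<le> N * U" "0 \<le> \<delta>\<^sup>2 * Z" using U0 N by auto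
      then have "16 / \<delta>\<^sup>2 * U \<le> 16 * P" unfolding P_def by (simp add: algebra_simps)
      moreover have "4 * g \<le> 4 * (3 * C * P)" using g by (intro mult_left_mono) auto
      ultimately show ?thesis by linarith
    qed
    also have "\<dots> \<le> 13 * C * P"
      using mult_right_mono[OF C P0] P0 by linarith
    finally have "?I (cball z (\<delta>/2)) (\<lambda>x. 16 * (u x)\<^sup>2 / \<delta>\<^sup>2 + 4 * (norm (G x))\<^sup>2) \<le> 13 * C * P"
      using inner by linarith
    then have "4 * C\<^sup>2 * ?I (cball z (\<delta>/2)) (\<lambda>x. 16 * (u x)\<^sup>2 / \<delta>\<^sup>2 + 4 * (norm (G x))\<^sup>2) \<le> 4 * C\<^sup>2 * (13 * C * P)"
      by (intro mult_left_mono) auto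
    also have "\<dots> = 52 * (C^3 * P)" by (simp add: power2_eq_square power3_eq_cube)
    finally have 2: "4 * C\<^sup>2 * ?I (cball z (\<delta>/2)) (\<lambda>x. 16 * (u x)\<^sup>2 / \<delta>\<^sup>2 + 4 * (norm (G x))\<^sup>2) \<le> 52 * (C^3 * P)" .
    have "0 \<le> C^3 * P" using P0 C by simp
    then show ?thesis using 1 2 unfolding D_def C_def[symmetric] mult.assoc by linarith
  qed
  have out: "4 * C\<^sup>2 * ?I (cball z (8*R)) (\<lambda>x. (u x)\<^sup>2 / (16 * R\<^sup>2) + 4 * (norm (G x))\<^sup>2) \<le> D * O1"
  proof -
    have "?I (cball z (8*R)) (\<lambda>x. (u x)\<^sup>2 / (16 * R\<^sup>2) + 4 * (norm (G x))\<^sup>2) \<le>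
       ?I (cball z (8*R)) (\<lambda>x. 4 * ((u x)\<^sup>2 / R\<^sup>2 + (norm (G x))\<^sup>2))"
    proof (rule mono)
      have "(u x)\<^sup>2 / (16 * R\<^sup>2) \<le> 4 * ((u x)\<^sup>2 / R\<^sup>2)" for x
      proof -
        have "(u x)\<^sup>2 / (16 * R\<^sup>2) = 1/16 * ((u x)\<^sup>2 / R\<^sup>2)" by simp
        moreover have "(u x)\<^sup>2 / R\<^sup>2 \<ge> 0" by simp
        ultimately show ?thesis by linarith
      qed
      then show "x \<in> cball z (8*R) \<Longrightarrow> x \<in> cball z (8*R) \<and> (u x)\<^sup>2 / (16 * R\<^sup>2) + 4 * (norm (G x))\<^sup>2 \<le> 4 * ((u x)\<^sup>2 / R\<^sup>2 + (norm (G x))\<^sup>2)" for x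
        by (simp add: distrib_left)
    qed (auto intro!: Bochner_Integration.integrable_add integrable_mult_right integrable_divide iu)
    also have "\<dots> = 4 * O1" unfolding O1_def by (simp only: mult.left_commute[of _ 4] integral_mult_right_zero)
    finally have "4 * C\<^sup>2 * ?I (cball z (8*R)) (\<lambda>x. (u x)\<^sup>2 / (16 * R\<^sup>2) + 4 * (norm (G x))\<^sup>2) \<le> 4 * C\<^sup>2 * (4 * O1)"
      by (intro mult_left_mono) auto
    also have "\<dots> = 16 * (1 * C\<^sup>2 * O1)" by simp
    also have "\<dots> \<le> 100 * (C * C\<^sup>2 * O1)" using C U0 by (intro mult_mono) auto
    also have "\<dots> = D * O1" unfolding D_def C_def[symmetric] by (simp add: power2_eq_square power3_eq_cube)
    finally show ?thesis .
  qed
  have "(w (\<delta>/4))\<^sup>2 * (\<delta>\<^sup>2 / 4 * Z + 4 * C\<^sup>2 * ?I (cball z (\<delta>/2)) (\<lambda>x. 16 * (u x)\<^sup>2 / \<delta>\<^sup>2 + 4 * (norm (G x))\<^sup>2)) \<le> (w (\<delta>/4))\<^sup>2 * (D * P)"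
    by (intro mult_left_mono in2) auto
  moreover have "(w (4*R))\<^sup>2 * (4 * C\<^sup>2 * ?I (cball z (8*R)) (\<lambda>x. (u x)\<^sup>2 / (16 * R\<^sup>2) + 4 * (norm (G x))\<^sup>2)) \<le> (w (4*R))\<^sup>2 * (D * O1)"
    by (intro mult_left_mono out) auto
  moreover have "\<alpha>^3 / (64 * R\<^sup>2) * (w R)\<^sup>2 * ?I (cball z R - ball z (\<delta>/2)) (\<lambda>x. (u x)\<^sup>2)
    \<le> (w (\<delta>/4))\<^sup>2 * (\<delta>\<^sup>2 / 4 * Z + 4 * C\<^sup>2 * ?I (cball z (\<delta>/2)) (\<lambda>x. 16 * (u x)\<^sup>2 / \<delta>\<^sup>2 + 4 * (norm (G x))\<^sup>2))
      + (w (4*R))\<^sup>2 * (4 * C\<^sup>2 * ?I (cball z (8*R)) (\<lambda>x. (u x)\<^sup>2 / (16 * R\<^sup>2) + 4 * (norm (G x))\<^sup>2))"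
    unfolding w_def C_def Z_def by (rule site_carleman[OF u K(1) _ \<zeta> ae N \<delta> \<alpha>]) (rule K(2))
  ultimately show ?thesis
    unfolding U_def[symmetric] Z_def[symmetric] O1_def[symmetric] P_def[symmetric] by (simp add: mult_ac)
qed

subsection \<open>Summation over the sites\<close>

text \<open>The lattice is abstracted to three properties of the sites: their \<open>R\<close>-balls
  cover the support, their \<open>\<delta>\<close>-balls are disjoint and lie in \<open>S\<close>,
  and their \<open>8 R\<close>-balls overlap at most \<open>m\<close> times. Disjointness keeps the
  observed mass from being counted twice, while the overlap multiplies the outer error by
  \<open>m\<close>, which \<open>\<alpha>D\<close> compensates.\<close>

lemma sum_sites:
  fixes u :: "'a::euclidean_space \<Rightarrow> real" and c :: "'k \<Rightarrow> 'a" and \<alpha> R \<delta> N m :: real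
  assumes u: "C2_on UNIV u G H" and K: "compact K" "\<And>x. x \<notin> K \<Longrightarrow> u x = 0"
    and \<zeta>: "integrable lebesgue (\<lambda>x. (\<zeta> x)\<^sup>2)"
    and ae: "AE x in lebesgue. \<bar>trace_map (H x)\<bar> \<le> N * \<bar>u x\<bar> + \<bar>\<zeta> x\<bar>"
    and N: "N \<ge> 0" and \<delta>: "0 < \<delta>" "\<delta> \<le> R"
    and \<alpha>: "\<alpha> \<ge> 2" "\<alpha>\<^sup>2 \<ge> 2 * (real DIM('a) - 1)\<^sup>2" "\<alpha>^3 \<ge> 131072 * N\<^sup>2 * R^4"
    and J: "finite J" and cover: "\<And>x. x \<in> K \<Longrightarrow> \<exists>k\<in>J. x \<in> cball (c k) R"
    and S: "S \<in> sets lebesgue" "\<And>k. k \<in> J \<Longrightarrow> ball (c k) \<delta> \<subseteq> S"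
    and disj: "\<And>k l. k \<in> J \<Longrightarrow> l \<in> J \<Longrightarrow> k \<noteq> l \<Longrightarrow> ball (c k) \<delta> \<inter> ball (c l) \<delta> = {}"
    and overlap: "\<And>x. real (card {k\<in>J. x \<in> cball (c k) (8*R)}) \<le> m" and m: "m \<ge> 1"
  defines "D \<equiv> 100 * (6 * real DIM('a) + 128)^3"
  assumes \<alpha>D: "256 * D * m \<le> 4 powr \<alpha>"
  shows "(LINT x|lebesgue. (u x)\<^sup>2) \<le> 258 * D * m * (4 * R / \<delta>) powr (2 * \<alpha>) * (R / \<delta>)\<^sup>2 *
    ((LINT x|lebesgue. indicator S x * (u x)\<^sup>2) + \<delta>\<^sup>2 * R\<^sup>2 * (LINT x|lebesgue. (\<zeta> x)\<^sup>2))"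
proof -
  have R: "R > 0" using \<delta> by linarith
  have D1: "D \<ge> 1"
  proof -
    have "(1::real) \<le> (6 * real DIM('a) + 128)^3" by (intro one_le_power) simp
    then show ?thesis unfolding D_def by linarith
  qed
  define w where "w = carleman_weight \<alpha> (1 / (16 * R))"
  have w_pos: "w t > 0" for t unfolding w_def by (rule carleman_weight_pos)
  have G0: "G x = 0" "trace_map (H x) = 0" if "x \<notin> K" for x
    using C2_on_support[OF u compact_imp_closed[OF K(1)] K(2), of x] that by (auto simp: trace_map_def)
  have iu: "integrable lebesgue (\<lambda>x. (u x)\<^sup>2)" "integrable lebesgue (\<lambda>x. (norm (G x))\<^sup>2)"
     "integrable lebesgue (\<lambda>x. u x * trace_map (H x))"
    by (rule integrable_compact_support[OF K(1)];
        use C2_onD(5,6)[OF u] C2_on_continuous_trace[OF u] K(2) G0 in \<open>auto intro!: continuous_intros intro: continuous_on_subset\<close>)+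
  let ?I = "\<lambda>A f. LINT x|lebesgue. indicator A x * f x"
  let ?ann = "\<lambda>k. cball (c k) R - ball (c k) (\<delta>/2)"
  let ?g = "\<lambda>x. (u x)\<^sup>2 / R\<^sup>2 + (norm (G x))\<^sup>2"
  have ig: "integrable lebesgue ?g" by (intro Bochner_Integration.integrable_add integrable_divide iu)
  define U where "U = (LINT x|lebesgue. (u x)\<^sup>2)"
  define Us where "Us = ?I S (\<lambda>x. (u x)\<^sup>2)"
  define Zt where "Zt = (LINT x|lebesgue. (\<zeta> x)\<^sup>2)"
  define Gt where "Gt = (LINT x|lebesgue. (norm (G x))\<^sup>2)"
  have nn: "U \<ge> 0" "Us \<ge> 0" "Zt \<ge> 0" "Gt \<ge> 0"
    unfolding U_def Us_def Zt_def Gt_def by (auto intro!: integral_nonneg_AE)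
  \<comment> \<open>A point of the support outside \<open>S\<close> lies in some
    \<open>R\<close>-ball but not in the \<open>\<delta>\<close>-ball of that site, hence in its
    annulus.\<close>
  have s1: "U \<le> (\<Sum>k\<in>J. ?I (?ann k) (\<lambda>x. (u x)\<^sup>2)) + Us"
  proof -
    have "U \<le> (LINT x|lebesgue. (\<Sum>k\<in>J. indicator (?ann k) x * (u x)\<^sup>2) + indicator S x * (u x)\<^sup>2)"
      unfolding U_def
    proof (rule integral_mono[OF iu(1)])
      show "integrable lebesgue (\<lambda>x. (\<Sum>k\<in>J. indicator (?ann k) x * (u x)\<^sup>2) + indicator S x * (u x)\<^sup>2)"
        by (intro Bochner_Integration.integrable_add Bochner_Integration.integrable_sum integrable_indicator_mult iu S) auto
      fix x
      show "(u x)\<^sup>2 \<le> (\<Sum>k\<in>J. indicator (?ann k) x * (u x)\<^sup>2) + indicator S x * (u x)\<^sup>2"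
      proof (cases "x \<in> K \<and> x \<notin> S")
        case False
        then show ?thesis using K(2)[of x] by (auto intro!: sum_nonneg)
      next
        case True
        then obtain k where k: "k \<in> J" "x \<in> cball (c k) R" using cover by blast
        have "x \<notin> ball (c k) \<delta>" using S(2)[OF k(1)] True by blast
        then have "x \<notin> ball (c k) (\<delta>/2)" using \<delta> by auto
        then have "(u x)\<^sup>2 = indicator (?ann k) x * (u x)\<^sup>2" using k(2) by simp
        also have "\<dots> \<le> (\<Sum>k\<in>J. indicator (?ann k) x * (u x)\<^sup>2)"
          using k(1) J by (intro member_le_sum[where f = "\<lambda>k. indicator (?ann k) x * (u x)\<^sup>2"]) auto
        finally show ?thesis by (simp add: add_increasing2)
      qed
    qed
    also have "\<dots> = (\<Sum>k\<in>J. ?I (?ann k) (\<lambda>x. (u x)\<^sup>2)) + Us"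
      unfolding Us_def
      by (intro has_bochner_integral_integral_eq has_bochner_integral_add has_bochner_integral_sum
          has_bochner_integral_integrable integrable_indicator_mult iu S) auto
    finally show ?thesis .
  qed
  have s3: "(\<Sum>k\<in>J. ?I (ball (c k) \<delta>) (\<lambda>x. (u x)\<^sup>2)) \<le> Us"
  proof -
    have "(\<Sum>k\<in>J. ?I (ball (c k) \<delta>) (\<lambda>x. (u x)\<^sup>2)) = (LINT x|lebesgue. (\<Sum>k\<in>J. indicator (ball (c k) \<delta>) x * (u x)\<^sup>2))"
      by (intro Bochner_Integration.integral_sum[symmetric] integrable_indicator_mult iu) auto
    also have "\<dots> \<le> Us" unfolding Us_def
    proof (rule integral_mono)
      fix x
      have "(\<Sum>k\<in>J. indicator (ball (c k) \<delta>) x) \<le> (indicator S x :: real)"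
      proof (cases "\<exists>k\<in>J. x \<in> ball (c k) \<delta>")
        case True
        then obtain k where k: "k \<in> J" "x \<in> ball (c k) \<delta>" by blast
        have nb: "x \<notin> ball (c l) \<delta>" if "l \<in> J" "l \<noteq> k" for l
          using disj[OF k(1) that(1)] k(2) that by blast
        have "(\<Sum>l\<in>J. indicator (ball (c l) \<delta>) x) = (\<Sum>l\<in>{k}. indicator (ball (c l) \<delta>) x :: real)"
          using J k nb by (intro sum.mono_neutral_right) (auto simp: indicator_def simp del: mem_ball)
        then show ?thesis using k S(2)[of k] by (auto simp: indicator_def)
      next
        case False then show ?thesis by (simp add: indicator_def)
      qed
      then show "(\<Sum>k\<in>J. indicator (ball (c k) \<delta>) x * (u x)\<^sup>2) \<le> indicator S x * (u x)\<^sup>2"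
        unfolding sum_distrib_right[symmetric] by (intro mult_right_mono) auto
    qed (intro Bochner_Integration.integrable_sum integrable_indicator_mult iu S; simp)+
    finally show ?thesis .
  qed
  have s4: "(\<Sum>k\<in>J. ?I (cball (c k) (8*R)) f) \<le> m * (LINT x|lebesgue. f x)"
    if f: "integrable lebesgue f" "\<And>x. 0 \<le> f x" for f :: "'a \<Rightarrow> real"
  proof -
    have "(\<Sum>k\<in>J. ?I (cball (c k) (8*R)) f) = (LINT x|lebesgue. (\<Sum>k\<in>J. indicator (cball (c k) (8*R)) x * f x))"
      by (intro Bochner_Integration.integral_sum[symmetric] integrable_indicator_mult f) auto
    also have "\<dots> \<le> (LINT x|lebesgue. m * f x)"
    proof (rule integral_mono)
      fix x
      have "(\<Sum>k\<in>J. indicator (cball (c k) (8*R)) x) = real (card {k\<in>J. x \<in> cball (c k) (8*R)})"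
        using J by (simp add: indicator_def sum.If_cases Int_def flip: mem_cball)
      then have "(\<Sum>k\<in>J. indicator (cball (c k) (8*R)) x) \<le> m" using overlap[of x] by simp
      then show "(\<Sum>k\<in>J. indicator (cball (c k) (8*R)) x * f x) \<le> m * f x"
        unfolding sum_distrib_right[symmetric] using f(2) by (intro mult_right_mono) auto
    qed (intro Bochner_Integration.integrable_sum integrable_indicator_mult integrable_mult_right f; simp)+
    finally show ?thesis by simp
  qed
  \<comment> \<open>The energy identity with the constant cutoff 1 controls the gradient globally,
    at scale \<open>R\<close>.\<close>
  have s5: "Gt \<le> (1 / R\<^sup>2 + R\<^sup>2 * N\<^sup>2) * U + R\<^sup>2 * Zt"
  proof -
    have one: "C2_on UNIV (\<lambda>x::'a. 1::real) (\<lambda>x. 0) (\<lambda>x h. 0)"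
      unfolding C2_on_def by (auto intro!: derivative_eq_intros)
    have "Gt = - (LINT x|lebesgue. u x * trace_map (H x))"
      using energy_identity[OF u one K] unfolding Gt_def by (simp add: trace_map_def)
    also have "\<dots> = (LINT x|lebesgue. - (u x * trace_map (H x)))" by simp
    also have "\<dots> \<le> (LINT x|lebesgue. (1 / R\<^sup>2 + R\<^sup>2 * N\<^sup>2) * (u x)\<^sup>2 + R\<^sup>2 * (\<zeta> x)\<^sup>2)"
    proof (rule integral_mono_AE)
      show "AE x in lebesgue. - (u x * trace_map (H x)) \<le> (1 / R\<^sup>2 + R\<^sup>2 * N\<^sup>2) * (u x)\<^sup>2 + R\<^sup>2 * (\<zeta> x)\<^sup>2"
        using ae
      proof eventually_elim
        fix x assume ax: "\<bar>trace_map (H x)\<bar> \<le> N * \<bar>u x\<bar> + \<bar>\<zeta> x\<bar>"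
        have "trace_map (H x) ^ 2 \<le> (N * \<bar>u x\<bar> + \<bar>\<zeta> x\<bar>)\<^sup>2"
          using ax N by (intro power2_le_iff_abs_le[THEN iffD2]) auto
        also have "\<dots> \<le> 2 * N\<^sup>2 * (u x)\<^sup>2 + 2 * (\<zeta> x)\<^sup>2"
          using sum_square_le[of "N * \<bar>u x\<bar>" "\<bar>\<zeta> x\<bar>"] by (simp add: power_mult_distrib)
        finally have "R\<^sup>2 * trace_map (H x) ^ 2 \<le> R\<^sup>2 * (2 * N\<^sup>2 * (u x)\<^sup>2 + 2 * (\<zeta> x)\<^sup>2)"
          by (intro mult_left_mono) auto
        moreover have "2 * (\<bar>u x\<bar> / R) * (R * \<bar>trace_map (H x)\<bar>) \<le> (\<bar>u x\<bar> / R)\<^sup>2 + (R * \<bar>trace_map (H x)\<bar>)\<^sup>2"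
          by (rule sum_squares_bound)
        then have "2 * (\<bar>u x\<bar> * \<bar>trace_map (H x)\<bar>) \<le> (u x)\<^sup>2 / R\<^sup>2 + R\<^sup>2 * (trace_map (H x))\<^sup>2"
          using R by (simp add: power_mult_distrib power_divide)
        moreover have "- (u x * trace_map (H x)) \<le> \<bar>u x\<bar> * \<bar>trace_map (H x)\<bar>" by (simp flip: abs_mult)
        moreover have "(u x)\<^sup>2 / R\<^sup>2 \<ge> 0" by simp
        moreover have "1 / R\<^sup>2 * (u x)\<^sup>2 = (u x)\<^sup>2 / R\<^sup>2"
          "R\<^sup>2 * (2 * N\<^sup>2 * (u x)\<^sup>2 + 2 * (\<zeta> x)\<^sup>2) = 2 * (R\<^sup>2 * N\<^sup>2 * (u x)\<^sup>2) + 2 * (R\<^sup>2 * (\<zeta> x)\<^sup>2)"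
          by (simp_all add: algebra_simps)
        ultimately show "- (u x * trace_map (H x)) \<le> (1 / R\<^sup>2 + R\<^sup>2 * N\<^sup>2) * (u x)\<^sup>2 + R\<^sup>2 * (\<zeta> x)\<^sup>2"
          unfolding distrib_right by linarith
      qed
    qed (intro Bochner_Integration.integrable_add integrable_minus integrable_mult_right iu \<zeta>)+
    also have "\<dots> = (1 / R\<^sup>2 + R\<^sup>2 * N\<^sup>2) * U + R\<^sup>2 * Zt"
      unfolding U_def Zt_def
      by (intro has_bochner_integral_integral_eq has_bochner_integral_add has_bochner_integral_mult_right
          has_bochner_integral_integrable iu \<zeta>)
    finally show ?thesis .
  qed
  define w1 where "w1 = (w R)\<^sup>2"
  define wi where "wi = (w (\<delta>/4))\<^sup>2"
  define wo where "wo = (w (4*R))\<^sup>2"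
  define Q where "Q = (4 * R / \<delta>) powr (2 * \<alpha>)"
  define C where "C = \<alpha>^3 / (64 * R\<^sup>2) * w1"
  have w1: "w1 > 0" unfolding w1_def using w_pos[of R] by simp
  have a3: "\<alpha>^3 \<ge> 8" using power_mono[OF \<alpha>(1), of 3] by simp
  have C0: "C > 0" unfolding C_def using w1 R \<alpha>(1) by simp
  have wi: "wi \<le> Q * w1" "wi \<ge> 0"
  proof -
    have "w (\<delta>/4) \<le> (R / (\<delta>/4)) powr \<alpha> * w R"
      unfolding w_def using \<delta> R \<alpha>(1) by (intro carleman_weight_ratio) auto
    then have "wi \<le> ((R / (\<delta>/4)) powr \<alpha> * w R)\<^sup>2"
      unfolding wi_def using w_pos[of "\<delta>/4"] by (intro power_mono) auto
    also have "\<dots> = Q * w1" unfolding Q_def w1_def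
      by (simp add: power_mult_distrib power2_eq_square powr_add[symmetric] mult.commute[of R])
    finally show "wi \<le> Q * w1" .
    show "wi \<ge> 0" unfolding wi_def by simp
  qed
  have Q1: "Q \<ge> 1" unfolding Q_def using \<delta> R \<alpha>(1) by (intro ge_one_powr_ge_zero) (auto simp: field_simps)
  \<comment> \<open>The decay of the weight from \<open>R\<close> to \<open>4 R\<close>, squared, is
    at most \<open>4 powr (- \<alpha>)\<close>, which by \<open>\<alpha>D\<close> beats both the
    constant and the overlap.\<close>
  have wo: "D * wo * m \<le> w1 / 256"
  proof -
    have "w (4*R) \<le> 2 powr (- \<alpha>) * w R"
      unfolding w_def using R \<alpha>(1) by (intro carleman_weight_quadruple) (auto simp: field_simps)
    then have "wo \<le> (2 powr (- \<alpha>) * w R)\<^sup>2"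
      unfolding wo_def using w_pos[of "4*R"] by (intro power_mono) auto
    also have "\<dots> = w1 / 4 powr \<alpha>"
    proof -
      have "(4::real) powr \<alpha> = (2 powr \<alpha>)\<^sup>2"
        using powr_mult[of 2 2 \<alpha>] by (simp add: power2_eq_square)
      then show ?thesis unfolding w1_def by (simp add: powr_minus power_mult_distrib field_simps)
    qed
    finally have "D * wo * m \<le> D * (w1 / 4 powr \<alpha>) * m" using D1 m by (intro mult_right_mono mult_left_mono) auto
    also have "\<dots> = (256 * D * m) * (w1 / 256 / 4 powr \<alpha>)" by simp
    also have "\<dots> \<le> 4 powr \<alpha> * (w1 / 256 / 4 powr \<alpha>)" using w1 by (intro mult_right_mono \<alpha>D) auto
    also have "\<dots> = w1 / 256" by simp
    finally show ?thesis .
  qed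
  have s2: "C * (\<Sum>k\<in>J. ?I (?ann k) (\<lambda>x. (u x)\<^sup>2))
     \<le> D * wi * ((1 / \<delta>\<^sup>2 + N) * Us + \<delta>\<^sup>2 * (m * Zt)) + D * wo * (m * (U / R\<^sup>2 + Gt))"
  proof -
    have "C * (\<Sum>k\<in>J. ?I (?ann k) (\<lambda>x. (u x)\<^sup>2)) \<le> (\<Sum>k\<in>J. D * wi * ((1 / \<delta>\<^sup>2 + N) * ?I (ball (c k) \<delta>) (\<lambda>x. (u x)\<^sup>2)
         + \<delta>\<^sup>2 * ?I (cball (c k) (8*R)) (\<lambda>x. (\<zeta> x)\<^sup>2)) + D * wo * ?I (cball (c k) (8*R)) ?g)"
      unfolding sum_distrib_left C_def w1_def wi_def wo_def w_def D_def
      by (intro sum_mono site_estimate[OF u K(1) _ \<zeta> ae N \<delta> \<alpha>] K(2))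
    also have "\<dots> = D * wi * ((1 / \<delta>\<^sup>2 + N) * (\<Sum>k\<in>J. ?I (ball (c k) \<delta>) (\<lambda>x. (u x)\<^sup>2))
         + \<delta>\<^sup>2 * (\<Sum>k\<in>J. ?I (cball (c k) (8*R)) (\<lambda>x. (\<zeta> x)\<^sup>2))) + D * wo * (\<Sum>k\<in>J. ?I (cball (c k) (8*R)) ?g)"
      by (simp only: sum.distrib sum_distrib_left[symmetric] distrib_left)
    also have "\<dots> \<le> D * wi * ((1 / \<delta>\<^sup>2 + N) * Us + \<delta>\<^sup>2 * (m * Zt)) + D * wo * (m * (LINT x|lebesgue. ?g x))"
      using D1 wi(2) N unfolding Zt_def
      by (intro add_mono mult_left_mono s3 s4 \<zeta> ig) (auto simp: wo_def)
    also have "(LINT x|lebesgue. ?g x) = U / R\<^sup>2 + Gt"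
      unfolding U_def Gt_def using iu by simp
    finally show ?thesis .
  qed
  \<comment> \<open>The second bound goes through squares:
    \<open>(R^2 N)^2 \<le> \<alpha>^3 \<le> \<alpha>^6\<close>, the last step because
    \<open>\<alpha>^3 \<ge> 1\<close>.\<close>
  have RN: "R\<^sup>2 * N\<^sup>2 \<le> \<alpha>^3 / R\<^sup>2" "R\<^sup>2 * N \<le> \<alpha>^3"
  proof -
    have 1: "N\<^sup>2 * R^4 \<le> \<alpha>^3" 
    proof -
      have "0 \<le> N\<^sup>2 * R^4" by simp
      then show ?thesis using \<alpha>(3) unfolding mult.assoc by linarith
    qed
    then show "R\<^sup>2 * N\<^sup>2 \<le> \<alpha>^3 / R\<^sup>2" using R by (simp add: field_simps eval_nat_numeral)
    have "(R\<^sup>2 * N)\<^sup>2 \<le> \<alpha>^3" using 1 by (simp add: power_mult_distrib mult.commute flip: power_mult)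
    also have "\<dots> \<le> (\<alpha>^3)\<^sup>2" using mult_right_mono[of 1 "\<alpha>^3" "\<alpha>^3"] a3 unfolding power2_eq_square by linarith
    finally have f: "(R\<^sup>2 * N)\<^sup>2 \<le> (\<alpha>^3)\<^sup>2" .
    show "R\<^sup>2 * N \<le> \<alpha>^3" by (rule power2_le_imp_le[OF f]) (use a3 in linarith)
  qed
  \<comment> \<open>The number 256 in \<open>\<alpha>D\<close> is tuned here:
    \<open>w1 / 256\<close> times \<open>2 \<alpha>^3 / R^2\<close> is exactly \<open>C / 2\<close>,
    so half of the left-hand side absorbs the outer error.\<close>
  have outer: "D * wo * (m * (U / R\<^sup>2 + Gt)) \<le> C / 2 * U + w1 * R\<^sup>2 / 256 * Zt"
  proof -
    have a: "1 / R\<^sup>2 + (1 / R\<^sup>2 + R\<^sup>2 * N\<^sup>2) \<le> 2 * \<alpha>^3 / R\<^sup>2"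
    proof -
      have "2 / R\<^sup>2 \<le> \<alpha>^3 / R\<^sup>2" using a3 by (intro divide_right_mono) auto
      then show ?thesis using RN(1) by simp
    qed
    have "U / R\<^sup>2 + Gt \<le> (1 / R\<^sup>2 + (1 / R\<^sup>2 + R\<^sup>2 * N\<^sup>2)) * U + R\<^sup>2 * Zt"
    proof -
      have "1 / R\<^sup>2 * U = U / R\<^sup>2" by simp
      then show ?thesis using s5 unfolding distrib_right by linarith
    qed
    also have "\<dots> \<le> 2 * \<alpha>^3 / R\<^sup>2 * U + R\<^sup>2 * Zt"
      by (intro add_right_mono mult_right_mono a nn)
    finally have b: "U / R\<^sup>2 + Gt \<le> 2 * \<alpha>^3 / R\<^sup>2 * U + R\<^sup>2 * Zt" .
    have "D * wo * (m * (U / R\<^sup>2 + Gt)) = (D * wo * m) * (U / R\<^sup>2 + Gt)" by simp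
    also have "\<dots> \<le> w1 / 256 * (2 * \<alpha>^3 / R\<^sup>2 * U + R\<^sup>2 * Zt)"
      using wo b w1 nn by (intro mult_mono) auto
    also have "\<dots> = C / 2 * U + w1 * R\<^sup>2 / 256 * Zt" unfolding C_def by (simp add: algebra_simps)
    finally show ?thesis .
  qed
  have "C * U \<le> C * ((\<Sum>k\<in>J. ?I (?ann k) (\<lambda>x. (u x)\<^sup>2)) + Us)" using s1 C0 by (intro mult_left_mono) auto
  then have "C / 2 * U \<le> C * Us + D * wi * ((1 / \<delta>\<^sup>2 + N) * Us + \<delta>\<^sup>2 * (m * Zt)) + w1 * R\<^sup>2 / 256 * Zt"
    using s2 outer unfolding distrib_left[of C] by linarith
  also have "\<dots> \<le> C * Us + D * (Q * w1) * ((1 / \<delta>\<^sup>2 + N) * Us + \<delta>\<^sup>2 * (m * Zt)) + w1 * R\<^sup>2 / 256 * Zt"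
    using wi D1 nn N m by (intro add_right_mono add_left_mono mult_right_mono mult_left_mono) auto
  \<comment> \<open>Factoring out \<open>C / 2 = \<alpha>^3 w1 / (128 R^2)\<close> prepares for
    cancelling it; this is where 128 comes from.\<close>
  also have "\<dots> = C / 2 * ((2 + 128 * D * Q * (R\<^sup>2 / \<delta>\<^sup>2 + R\<^sup>2 * N) / \<alpha>^3) * Us
      + (128 * D * Q * m * \<delta>\<^sup>2 * R\<^sup>2 + R^4 / 2) / \<alpha>^3 * Zt)"
    unfolding C_def using R \<open>\<alpha> \<ge> 2\<close> w1 \<delta>(1)
    by (simp add: field_simps power2_eq_square eval_nat_numeral)
  finally have "U \<le> (2 + 128 * D * Q * (R\<^sup>2 / \<delta>\<^sup>2 + R\<^sup>2 * N) / \<alpha>^3) * Us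
      + (128 * D * Q * m * \<delta>\<^sup>2 * R\<^sup>2 + R^4 / 2) / \<alpha>^3 * Zt"
    using C0 by simp
  \<comment> \<open>The coefficient of \<open>Us\<close> is at most 2 plus twice 128 times the
    common factor, hence 258; the coefficient of \<open>Zt\<close> fits below the same
    number.\<close>
  also have "\<dots> \<le> 258 * D * m * Q * (R / \<delta>)\<^sup>2 * Us + 258 * D * m * Q * (R / \<delta>)\<^sup>2 * (\<delta>\<^sup>2 * R\<^sup>2) * Zt"
  proof -
    let ?y = "(R / \<delta>)\<^sup>2"
    have y1: "?y \<ge> 1" using \<delta> by (intro one_le_power) simp
    have DQ: "1 \<le> D * Q" using mult_mono[OF D1 Q1] D1 by simp
    have DQm: "D * Q \<le> D * Q * m" using DQ m mult_left_mono[of 1 m "D * Q"] by linarith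
    have DQmy: "D * Q * m \<le> D * Q * m * ?y" using DQ DQm y1 mult_left_mono[of 1 ?y "D * Q * m"] by linarith
    have DQy: "D * Q * ?y \<le> D * Q * m * ?y" using DQm y1 by (intro mult_right_mono) auto
    have "(R\<^sup>2 / \<delta>\<^sup>2 + R\<^sup>2 * N) / \<alpha>^3 \<le> 2 * ?y"
    proof -
      have "?y / \<alpha>^3 \<le> ?y / 1" using a3 \<alpha>(1) by (intro divide_left_mono) auto
      moreover have "R\<^sup>2 * N / \<alpha>^3 \<le> 1" using RN(2) \<alpha>(1) by (simp add: field_simps)
      ultimately show ?thesis using y1 by (simp add: add_divide_distrib power_divide)
    qed
    then have "128 * D * Q * ((R\<^sup>2 / \<delta>\<^sup>2 + R\<^sup>2 * N) / \<alpha>^3) \<le> 128 * D * Q * (2 * ?y)"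
      using DQ by (intro mult_left_mono) auto
    then have 1: "2 + 128 * D * Q * (R\<^sup>2 / \<delta>\<^sup>2 + R\<^sup>2 * N) / \<alpha>^3 \<le> 258 * D * m * Q * ?y"
    proof -
      have "128 * D * Q * (R\<^sup>2 / \<delta>\<^sup>2 + R\<^sup>2 * N) / \<alpha>^3 = 128 * D * Q * ((R\<^sup>2 / \<delta>\<^sup>2 + R\<^sup>2 * N) / \<alpha>^3)" by simp
      moreover have "128 * D * Q * (2 * ?y) = 256 * (D * Q * ?y)" "258 * D * m * Q * ?y = 258 * (D * Q * m * ?y)" by simp_all
      ultimately show ?thesis using DQ DQm DQmy DQy \<open>128 * D * Q * ((R\<^sup>2 / \<delta>\<^sup>2 + R\<^sup>2 * N) / \<alpha>^3) \<le> 128 * D * Q * (2 * ?y)\<close> by linarith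
    qed
    have "(128 * D * Q * m * \<delta>\<^sup>2 * R\<^sup>2 + R^4 / 2) / \<alpha>^3 \<le> (128 * D * Q * m * \<delta>\<^sup>2 * R\<^sup>2 + R^4 / 2) / 1"
      using DQ DQm a3 \<alpha>(1) m D1 Q1 by (intro divide_left_mono) auto
    also have "\<dots> = (128 * (D * Q * m) + ?y / 2) * (\<delta>\<^sup>2 * R\<^sup>2)"
      using \<delta> by (simp add: field_simps power2_eq_square eval_nat_numeral)
    also have "\<dots> \<le> (258 * D * m * Q * ?y) * (\<delta>\<^sup>2 * R\<^sup>2)"
    proof (rule mult_right_mono)
      have "?y \<le> D * Q * m * ?y" using DQ DQm y1 mult_right_mono[of 1 "D * Q * m" ?y] by linarith
      moreover have eq: "258 * D * m * Q * ?y = 258 * (D * Q * m * ?y)" by simp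
      ultimately show "128 * (D * Q * m) + ?y / 2 \<le> 258 * D * m * Q * ?y"
        unfolding eq using DQmy y1 by linarith
    qed auto
    finally have 2: "(128 * D * Q * m * \<delta>\<^sup>2 * R\<^sup>2 + R^4 / 2) / \<alpha>^3 \<le> 258 * D * m * Q * ?y * (\<delta>\<^sup>2 * R\<^sup>2)" .
    show ?thesis by (intro add_mono mult_right_mono 1 2 nn)
  qed
  also have "\<dots> = 258 * D * m * Q * (R / \<delta>)\<^sup>2 * (Us + \<delta>\<^sup>2 * R\<^sup>2 * Zt)"
    by (simp only: distrib_left mult.assoc)
  finally show ?thesis unfolding U_def Us_def Zt_def Q_def .
qed

subsection \<open>Geometry of equidistributed sequences\<close>

text \<open>Divided by \<open>M\<close>, each coordinate is an integer in an interval of length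
  \<open>2 c\<close>, which leaves at most \<open>2 c + 1\<close> values. The bound is independent
  of \<open>x\<close> and \<open>M\<close>.\<close>

lemma lattice_count:
  fixes x :: "'a::euclidean_space"
  assumes M: "M > 0" and c: "c \<ge> 0"
  shows "finite {k \<in> lattice M. norm (k - x) \<le> c * M}"
    and "real (card {k \<in> lattice M. norm (k - x) \<le> c * M}) \<le> (2 * c + 1) ^ DIM('a)"
proof -
  let ?A = "{k \<in> lattice M. norm (k - x) \<le> c * M}"
  let ?f = "\<lambda>k::'a. restrict (\<lambda>b. \<lfloor>(k \<bullet> b) / M\<rfloor>) Basis"
  let ?I = "\<lambda>b::'a. {\<lceil>(x \<bullet> b) / M - c\<rceil>..\<lfloor>(x \<bullet> b) / M + c\<rfloor>}"
  have fl: "M * of_int \<lfloor>(k \<bullet> b) / M\<rfloor> = k \<bullet> b" if "k \<in> lattice M" "b \<in> Basis" for k b :: 'a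
  proof -
    obtain z :: int where "k \<bullet> b = M * of_int z" using \<open>k \<in> lattice M\<close> \<open>b \<in> Basis\<close> unfolding lattice_def by blast
    then show ?thesis using M by simp
  qed
  have inj: "inj_on ?f ?A"
  proof (rule inj_onI)
    fix k l assume k: "k \<in> ?A" and l: "l \<in> ?A" and eq: "?f k = ?f l"
    show "k = l"
    proof (rule euclidean_eqI)
      fix b :: 'a assume b: "b \<in> Basis"
      have "\<lfloor>(k \<bullet> b) / M\<rfloor> = \<lfloor>(l \<bullet> b) / M\<rfloor>" using fun_cong[OF eq, of b] b by (simp only: restrict_apply')
      moreover have "k \<in> lattice M" "l \<in> lattice M" using k l by auto
      ultimately show "k \<bullet> b = l \<bullet> b" using fl[of k b] fl[of l b] b by metis
    qed
  qed
  have sub: "?f ` ?A \<subseteq> PiE Basis ?I"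
  proof (clarsimp simp: PiE_iff)
    fix k b :: 'a assume k: "k \<in> lattice M" "norm (k - x) \<le> c * M" and b: "b \<in> Basis"
    have "\<bar>(k - x) \<bullet> b\<bar> \<le> c * M" using Basis_le_norm[OF b, of "k - x"] k(2) by simp
    then have h: "x \<bullet> b / M - c \<le> k \<bullet> b / M" "k \<bullet> b / M \<le> x \<bullet> b / M + c"
    proof -
      have "x \<bullet> b - c * M \<le> k \<bullet> b" "k \<bullet> b \<le> x \<bullet> b + c * M"
        using \<open>\<bar>(k - x) \<bullet> b\<bar> \<le> c * M\<close> unfolding inner_diff_left by linarith+
      then have "(x \<bullet> b - c * M) / M \<le> (k \<bullet> b) / M" "(k \<bullet> b) / M \<le> (x \<bullet> b + c * M) / M"
        using M by (simp_all add: divide_right_mono)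
      then show "x \<bullet> b / M - c \<le> k \<bullet> b / M" "k \<bullet> b / M \<le> x \<bullet> b / M + c"
        using M by (simp_all add: diff_divide_distrib add_divide_distrib)
    qed
    have "(k \<bullet> b) / M = (M * of_int \<lfloor>(k \<bullet> b) / M\<rfloor>) / M" unfolding fl[OF k(1) b] ..
    also have "\<dots> = of_int \<lfloor>(k \<bullet> b) / M\<rfloor>" using M by simp
    finally have "of_int \<lfloor>(k \<bullet> b) / M\<rfloor> = (k \<bullet> b) / M" ..
    then show "\<lceil>x \<bullet> b / M - c\<rceil> \<le> \<lfloor>k \<bullet> b / M\<rfloor> \<and> \<lfloor>k \<bullet> b / M\<rfloor> \<le> \<lfloor>x \<bullet> b / M + c\<rfloor>"
      using h by (auto simp: ceiling_le_iff intro: floor_mono)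
  qed
  have fin: "finite (PiE Basis ?I)" by (intro finite_PiE) auto
  show "finite ?A" using inj_on_finite[OF inj sub fin] .
  have "card ?A \<le> card (PiE Basis ?I)" by (rule card_inj_on_le[OF inj sub fin])
  also have "card (PiE Basis ?I) = (\<Prod>b\<in>Basis. card (?I b))" by (rule card_PiE) simp
  finally have "real (card ?A) \<le> (\<Prod>b\<in>(Basis::'a set). real (card (?I b)))"
    using of_nat_mono[where 'a = real] by fastforce
  also have "\<dots> \<le> (\<Prod>b\<in>(Basis::'a set). 2 * c + 1)"
  proof (intro prod_mono conjI)
    fix b :: 'a
    have "real (card (?I b)) = real_of_int (max 0 (\<lfloor>(x \<bullet> b) / M + c\<rfloor> - \<lceil>(x \<bullet> b) / M - c\<rceil> + 1))"
      by (simp add: max_def)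
    also have "\<dots> \<le> 2 * c + 1" using c by (simp add: max_def) linarith
    finally show "real (card (?I b)) \<le> 2 * c + 1" .
  qed simp
  also have "\<dots> = (2 * c + 1) ^ DIM('a)" by simp
  finally show "real (card ?A) \<le> (2 * c + 1) ^ DIM('a)" .
qed

lemma norm_le_DIM_mult:
  fixes x :: "'a::euclidean_space"
  assumes "\<And>b. b \<in> Basis \<Longrightarrow> \<bar>x \<bullet> b\<bar> \<le> c"
  shows "norm x \<le> real DIM('a) * c"
proof -
  have "norm x \<le> (\<Sum>b\<in>Basis. \<bar>x \<bullet> b\<bar>)" by (rule norm_le_l1)
  also have "\<dots> \<le> (\<Sum>b\<in>(Basis::'a set). c)" by (intro sum_mono assms)
  finally show ?thesis by simp
qed

text \<open>Each coordinate of \<open>x / M\<close> is rounded to the nearest integer.\<close>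

lemma lattice_approx:
  fixes x :: "'a::euclidean_space"
  assumes M: "M > 0"
  obtains k where "k \<in> lattice M" "norm (x - k) \<le> real DIM('a) * (M / 2)"
proof -
  define k where "k = (\<Sum>b\<in>Basis. (M * of_int (round ((x \<bullet> b) / M))) *\<^sub>R b)"
  have kb: "k \<bullet> b = M * of_int (round ((x \<bullet> b) / M))" if "b \<in> Basis" for b :: 'a
    using that unfolding k_def by simp
  have "k \<in> lattice M" unfolding lattice_def using kb by auto
  moreover have "norm (x - k) \<le> real DIM('a) * (M / 2)"
  proof (rule norm_le_DIM_mult)
    fix b :: 'a assume b: "b \<in> Basis"
    have "\<bar>of_int (round ((x \<bullet> b) / M)) - (x \<bullet> b) / M\<bar> \<le> 1/2" by (rule of_int_round_abs_le)
    then have "M * \<bar>of_int (round ((x \<bullet> b) / M)) - (x \<bullet> b) / M\<bar> \<le> M * (1/2)" using M by (intro mult_left_mono) auto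
    moreover have "M * \<bar>of_int (round ((x \<bullet> b) / M)) - (x \<bullet> b) / M\<bar> = \<bar>(x - k) \<bullet> b\<bar>"
    proof -
      have "M * \<bar>of_int (round ((x \<bullet> b) / M)) - (x \<bullet> b) / M\<bar> = \<bar>M * (of_int (round ((x \<bullet> b) / M)) - (x \<bullet> b) / M)\<bar>"
        using M by (simp add: abs_mult)
      also have "M * (of_int (round ((x \<bullet> b) / M)) - (x \<bullet> b) / M) = - ((x - k) \<bullet> b)"
        using M by (simp add: kb[OF b] inner_diff_left right_diff_distrib)
      finally show ?thesis by simp
    qed
    ultimately show "\<bar>(x - k) \<bullet> b\<bar> \<le> M / 2" by simp
  qed
  ultimately show ?thesis by (rule that)
qed

text \<open>In each coordinate two centres would differ by less than \<open>M\<close>, that is, two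
  integers by less than 1.\<close>

lemma cubes_disjoint:
  fixes x :: "'a::euclidean_space"
  assumes M: "M > 0" and k: "k \<in> lattice M" "l \<in> lattice M" and x: "x \<in> cube M k" "x \<in> cube M l"
  shows "k = l"
proof (rule euclidean_eqI)
  fix b :: 'a assume b: "b \<in> Basis"
  obtain i j :: int where ij: "k \<bullet> b = M * of_int i" "l \<bullet> b = M * of_int j"
    using k b unfolding lattice_def by blast
  have "\<bar>(x - k) \<bullet> b\<bar> < M / 2" "\<bar>(x - l) \<bullet> b\<bar> < M / 2" using x b unfolding cube_def by auto
  then have "\<bar>k \<bullet> b - l \<bullet> b\<bar> < M" unfolding inner_diff_left by linarith
  then have "M * \<bar>of_int i - of_int j\<bar> < M * 1"
    using M unfolding ij by (simp add: abs_mult flip: right_diff_distrib)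
  then have "\<bar>real_of_int i - of_int j\<bar> < 1" using M by simp
  then have "i = j" by linarith
  then show "k \<bullet> b = l \<bullet> b" using ij by simp
qed

section \<open>The inequality for compactly supported functions of class C2\<close>

text \<open>It remains to choose parameters. The ansatz for \<alpha> is affine in
  \<open>X = M powr (4/3) * N powr (2/3)\<close> with dimensional coefficients, and
  \<open>M / \<delta> \<ge> 2\<close> lets every dimensional factor be written as a power of
  \<open>M / \<delta>\<close>. The Laplacian is constrained only by an inequality, so the same
  statement covers all potentials bounded by \<open>N\<close>.\<close>

lemma unique_continuation_C2_compact:
  obtains K1 :: real where "K1 \<ge> 1"
    "\<And>M \<delta> Z N (u :: 'a::euclidean_space \<Rightarrow> real) G H K \<zeta>.
       \<lbrakk>M > 0; 0 < \<delta>; \<delta> < M / 2; equidistributed M \<delta> Z; N \<ge> 0;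
        C2_on UNIV u G H; compact K; \<And>x. x \<notin> K \<Longrightarrow> u x = 0;
        integrable lebesgue (\<lambda>x. (\<zeta> x)\<^sup>2);
        AE x in lebesgue. \<bar>trace_map (H x)\<bar> \<le> N * \<bar>u x\<bar> + \<bar>\<zeta> x\<bar>\<rbrakk>
       \<Longrightarrow> (\<delta> / M) powr (K1 * (1 + M powr (4/3) * N powr (2/3))) * (LINT x|lebesgue. (u x)\<^sup>2)
         \<le> (LINT x|lebesgue. indicator (S_set M \<delta> Z) x * (u x)\<^sup>2) + \<delta>\<^sup>2 * M\<^sup>2 * (LINT x|lebesgue. (\<zeta> x)\<^sup>2)"
proof -
  define d where "d = real DIM('a)"
  have d1: "d \<ge> 1" unfolding d_def using DIM_positive[where 'a = 'a] by linarith
  define D where "D = 100 * (6 * d + 128)^3"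
  \<comment> \<open>Sites within \<open>8 R = 8 d M\<close> of a point have lattice points within
    \<open>9 d M\<close> of it, since a site is at most \<open>d M / 2\<close> from its lattice
    point; the count is then \<open>2 * 9 d + 1\<close> per coordinate.\<close>
  define m where "m = (18 * d + 1) ^ DIM('a)"
  have D1: "D \<ge> 1"
  proof -
    have "(1::real) \<le> (6 * d + 128)^3" using d1 by (intro one_le_power) simp
    then show ?thesis unfolding D_def by linarith
  qed
  have m1: "m \<ge> 1" unfolding m_def using d1 by (intro one_le_power) simp
  \<comment> \<open>The summand \<open>2 d\<close> secures both \<open>\<alpha> \<ge> 2\<close> and
    \<open>\<alpha>^2 \<ge> 2 (d - 1)^2\<close>; the logarithm secures
    \<open>256 D m \<le> 4 powr \<alpha>\<close>.\<close>
  define \<alpha>0 where "\<alpha>0 = 2 * d + log 4 (256 * D * m)"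
  \<comment> \<open>Chosen so that \<open>\<alpha> \<le> A (1 + X)\<close>.\<close>
  define A where "A = \<alpha>0 + 64 * d powr (4/3)"
  \<comment> \<open>With \<open>\<gamma>\<close> below, this writes the dimensional factors as
    powers of 2, which are at most the same powers of \<open>M / \<delta>\<close>.\<close>
  define \<beta> where "\<beta> = log 2 (258 * D * m * d^4)"
  define \<gamma> where "\<gamma> = log 2 (4 * d)"
  define K1 where "K1 = \<beta> + 2 * A * (\<gamma> + 1) + 2"
  have Dm: "256 * D * m \<ge> 256"
    using mult_mono[OF D1 m1] D1 by simp
  have \<alpha>0: "\<alpha>0 \<ge> 2 * d" unfolding \<alpha>0_def using Dm by simp
  have A0: "A \<ge> 0" unfolding A_def using \<alpha>0 d1 by simp
  have \<gamma>0: "\<gamma> \<ge> 0" unfolding \<gamma>_def using d1 by simp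
  have d4: "d^4 \<ge> 1" using d1 by (rule one_le_power)
  have DmD: "258 * D * m * d^4 \<ge> 1"
    using mult_mono[of 1 "258 * D * m" 1 "d^4"] Dm d4 by simp
  have \<beta>0: "\<beta> \<ge> 0" unfolding \<beta>_def using DmD by simp
  have K1: "K1 \<ge> 1" unfolding K1_def using A0 \<gamma>0 \<beta>0 by simp
  show thesis
  proof (rule that[OF K1])
    fix M \<delta> N :: real and Z :: "'a \<Rightarrow> 'a" and u :: "'a \<Rightarrow> real" and G H K \<zeta>
    assume M: "M > 0" and \<delta>: "0 < \<delta>" "\<delta> < M / 2" and eq: "equidistributed M \<delta> Z" and N: "N \<ge> 0"
      and u: "C2_on UNIV u G H" and K: "compact K" "\<And>x. x \<notin> K \<Longrightarrow> u x = 0"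
      and \<zeta>: "integrable lebesgue (\<lambda>x. (\<zeta> x)\<^sup>2)"
      and ae: "AE x in lebesgue. \<bar>trace_map (H x)\<bar> \<le> N * \<bar>u x\<bar> + \<bar>\<zeta> x\<bar>"
    define R where "R = d * M"
    define X where "X = M powr (4/3) * N powr (2/3)"
    define \<alpha> where "\<alpha> = \<alpha>0 + 64 * (d powr (4/3) * X)"
    have RM: "R \<ge> M" unfolding R_def using d1 M by simp
    have R: "R > 0" "\<delta> \<le> R" using RM M \<delta> by auto
    have X0: "X \<ge> 0" unfolding X_def by simp
    have \<alpha>_ge: "\<alpha> \<ge> \<alpha>0" unfolding \<alpha>_def using X0 by simp
    have \<alpha>2: "\<alpha> \<ge> 2" using \<alpha>_ge \<alpha>0 d1 by linarith
    have \<alpha>d: "\<alpha>\<^sup>2 \<ge> 2 * (real DIM('a) - 1)\<^sup>2"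
    proof -
      have "(2 * (d - 1))\<^sup>2 \<le> \<alpha>\<^sup>2" using \<alpha>_ge \<alpha>0 d1 by (intro power_mono) auto
      moreover have "2 * (d - 1)\<^sup>2 \<le> (2 * (d - 1))\<^sup>2" unfolding power_mult_distrib by simp
      ultimately show ?thesis unfolding d_def by linarith
    qed
    \<comment> \<open>The cube of \<open>64 d powr (4/3) X\<close> is \<open>64^3 N^2 R^4\<close>,
      and \<open>64^3 = 262144\<close> is twice the required constant.\<close>
    have \<alpha>3: "\<alpha>^3 \<ge> 131072 * N\<^sup>2 * R^4"
    proof -
      have dX: "d powr (4/3) * X = R powr (4/3) * N powr (2/3)"
        unfolding X_def R_def using d1 M by (simp add: powr_mult)
      have "(R powr (4/3))^3 = R^4"
        using R by (simp add: powr_power)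
      moreover have "(N powr (2/3))^3 = N\<^sup>2"
        using N by (cases "N = 0") (simp_all add: powr_power)
      ultimately have c: "(d powr (4/3) * X)^3 = N\<^sup>2 * R^4" unfolding dX by (simp add: power_mult_distrib)
      have "(64 * (d powr (4/3) * X))^3 \<le> \<alpha>^3"
        using \<alpha>0 d1 X0 unfolding \<alpha>_def by (intro power_mono) auto
      then have "262144 * (N\<^sup>2 * R^4) \<le> \<alpha>^3" unfolding power_mult_distrib[of 64] c by simp
      moreover have "0 \<le> N\<^sup>2 * R^4" by simp
      ultimately show ?thesis unfolding mult.assoc by linarith
    qed
    have \<alpha>D: "256 * D * m \<le> 4 powr \<alpha>"
    proof -
      have "256 * D * m = 4 powr (log 4 (256 * D * m))" using Dm by simp
      also have "\<dots> \<le> 4 powr \<alpha>" using \<alpha>_ge d1 unfolding \<alpha>0_def by (intro powr_mono) auto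
      finally show ?thesis .
    qed
    obtain B where B: "\<And>x. x \<in> K \<Longrightarrow> norm x \<le> B" using compact_imp_bounded[OF K(1)] unfolding bounded_iff by auto
    \<comment> \<open>The cutoff radius \<open>|B| + d M\<close> is large enough for
      \<open>J\<close> to contain the approximating lattice point of every point of the
      support.\<close>
    define J :: "'a set" where "J = {k \<in> lattice M. norm (k - 0) \<le> (\<bar>B\<bar> / M + d) * M}"
    have J: "finite J" unfolding J_def using M d1 by (intro lattice_count) auto
    have Jl: "k \<in> lattice M" if "k \<in> J" for k using that unfolding J_def by simp
    have Zk: "norm (Z k - k) \<le> d * (M / 2)" if "k \<in> lattice M" for k
    proof -
      have "Z k \<in> ball (Z k) \<delta>" using \<delta>(1) by simp
      then have "Z k \<in> cube M k" using eq that unfolding equidistributed_def by blast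
      then have "\<bar>(Z k - k) \<bullet> b\<bar> \<le> M / 2" if "b \<in> Basis" for b
        using that unfolding cube_def by (auto intro: less_imp_le)
      then show ?thesis unfolding d_def by (rule norm_le_DIM_mult)
    qed
    \<comment> \<open>Both the point and the site lie within \<open>d M / 2\<close> of the lattice
      point; this is the reason for \<open>R = d M\<close>.\<close>
    have cover: "\<exists>k\<in>J. x \<in> cball (Z k) R" if x: "x \<in> K" for x
    proof -
      obtain k where k: "k \<in> lattice M" "norm (x - k) \<le> d * (M / 2)"
        using lattice_approx[OF M, of x] unfolding d_def by blast
      have "norm k \<le> norm x + norm (x - k)" by norm
      also have "\<dots> \<le> \<bar>B\<bar> + d * M" using B[OF x] k(2) mult_left_mono[of "M/2" M d] d1 M by linarith
      also have "\<dots> = (\<bar>B\<bar> / M + d) * M" using M by (simp add: field_simps)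
      finally have "k \<in> J" unfolding J_def using k by simp
      moreover have "dist (Z k) x \<le> norm (x - k) + norm (Z k - k)" by norm
      then have "dist (Z k) x \<le> R" using k Zk[OF k(1)] unfolding R_def by linarith
      ultimately show ?thesis by auto
    qed
    have So: "open (S_set M \<delta> Z)" unfolding S_set_def by (intro open_UN) auto
    have S: "S_set M \<delta> Z \<in> sets lebesgue" using So by simp
    have SZ: "ball (Z k) \<delta> \<subseteq> S_set M \<delta> Z" if "k \<in> J" for k using Jl[OF that] unfolding S_set_def by blast
    have disj: "ball (Z k) \<delta> \<inter> ball (Z l) \<delta> = {}" if "k \<in> J" "l \<in> J" "k \<noteq> l" for k l
      using cubes_disjoint[OF M Jl[OF that(1)] Jl[OF that(2)]] that(3) eq Jl[OF that(1)] Jl[OF that(2)]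
      unfolding equidistributed_def by blast
    have overlap: "real (card {k\<in>J. x \<in> cball (Z k) (8*R)}) \<le> m" for x
    proof -
      have c9: "9 * d \<ge> 0" using d1 by simp
      have "{k\<in>J. x \<in> cball (Z k) (8*R)} \<subseteq> {k \<in> lattice M. norm (k - x) \<le> (9 * d) * M}"
      proof clarsimp
        fix k assume k: "k \<in> J" "dist (Z k) x \<le> 8 * R"
        have "norm (k - x) \<le> dist (Z k) x + norm (Z k - k)" by norm
        also have "\<dots> \<le> 8 * (d * M) + d * (M / 2)" using k Zk[OF Jl[OF k(1)]] unfolding R_def by linarith
        also have "\<dots> \<le> 9 * d * M" using d1 M by (simp add: field_simps)
        finally show "k \<in> lattice M \<and> norm (k - x) \<le> 9 * d * M" using Jl[OF k(1)] by simp
      qed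
      then have "card {k\<in>J. x \<in> cball (Z k) (8*R)} \<le> card {k \<in> lattice M. norm (k - x) \<le> (9 * d) * M}"
        by (intro card_mono lattice_count M c9)
      also have "real \<dots> \<le> (2 * (9 * d) + 1) ^ DIM('a)" by (intro lattice_count M c9)
      finally show ?thesis unfolding m_def by simp
    qed
    define U where "U = (LINT x|lebesgue. (u x)\<^sup>2)"
    define Us where "Us = (LINT x|lebesgue. indicator (S_set M \<delta> Z) x * (u x)\<^sup>2)"
    define Zt where "Zt = (LINT x|lebesgue. (\<zeta> x)\<^sup>2)"
    have nn: "Us \<ge> 0" "Zt \<ge> 0" unfolding Us_def Zt_def by (auto intro!: integral_nonneg_AE)
    define y where "y = M / \<delta>"
    have y2: "y \<ge> 2" unfolding y_def using \<delta> by (simp add: field_simps)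
    have "U \<le> 258 * D * m * (4 * R / \<delta>) powr (2 * \<alpha>) * (R / \<delta>)\<^sup>2 * (Us + \<delta>\<^sup>2 * R\<^sup>2 * Zt)"
      unfolding U_def Us_def Zt_def D_def d_def
      by (rule sum_sites[OF u K(1) _ \<zeta> ae N \<delta>(1) R(2) \<alpha>2 \<alpha>d \<alpha>3 J cover S SZ disj overlap m1 \<alpha>D[unfolded D_def d_def]])
        (auto simp: K(2))
    also have "\<dots> \<le> 258 * D * m * (4 * R / \<delta>) powr (2 * \<alpha>) * (R / \<delta>)\<^sup>2 * (d\<^sup>2 * (Us + \<delta>\<^sup>2 * M\<^sup>2 * Zt))"
    proof (rule mult_left_mono)
      have "1 * Us \<le> d\<^sup>2 * Us" using d1 nn by (intro mult_right_mono) auto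
      then show "Us + \<delta>\<^sup>2 * R\<^sup>2 * Zt \<le> d\<^sup>2 * (Us + \<delta>\<^sup>2 * M\<^sup>2 * Zt)"
        unfolding R_def by (simp add: power_mult_distrib algebra_simps)
    qed (use D1 m1 in auto)
    also have "\<dots> = 258 * D * m * d^4 * ((4 * d) * y) powr (2 * \<alpha>) * y\<^sup>2 * (Us + \<delta>\<^sup>2 * M\<^sup>2 * Zt)"
    proof -
      have e: "4 * (d * M) / \<delta> = 4 * d * (M / \<delta>)" by simp
      show ?thesis unfolding R_def y_def e by (simp add: power_mult_distrib power_divide eval_nat_numeral)
    qed
    also have "\<dots> \<le> y powr (K1 * (1 + X)) * (Us + \<delta>\<^sup>2 * M\<^sup>2 * Zt)"
    proof (rule mult_right_mono)
      have "258 * D * m * d^4 = 2 powr \<beta>" unfolding \<beta>_def using DmD by simp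
      also have "\<dots> \<le> y powr \<beta>" using y2 \<beta>0 by (intro powr_mono2) auto
      finally have 1: "258 * D * m * d^4 \<le> y powr \<beta>" .
      have "4 * d = 2 powr \<gamma>" unfolding \<gamma>_def using d1 by simp
      also have "\<dots> \<le> y powr \<gamma>" using y2 \<gamma>0 by (intro powr_mono2) auto
      finally have "(4 * d) * y \<le> y powr \<gamma> * y" using y2 by (intro mult_right_mono) auto
      also have "\<dots> = y powr (\<gamma> + 1)" using y2 by (simp add: powr_add)
      finally have "((4 * d) * y) powr (2 * \<alpha>) \<le> (y powr (\<gamma> + 1)) powr (2 * \<alpha>)"
        using y2 d1 \<alpha>2 by (intro powr_mono2) auto
      then have 2: "((4 * d) * y) powr (2 * \<alpha>) \<le> y powr ((\<gamma> + 1) * (2 * \<alpha>))" by (simp add: powr_powr)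
      have 3: "y\<^sup>2 = y powr 2" using y2 by simp
      have "258 * D * m * d^4 * ((4 * d) * y) powr (2 * \<alpha>) * y\<^sup>2 \<le> y powr \<beta> * y powr ((\<gamma> + 1) * (2 * \<alpha>)) * y powr 2"
        unfolding 3 using y2 by (intro mult_mono 1 2) auto
      also have "\<dots> = y powr (\<beta> + (\<gamma> + 1) * (2 * \<alpha>) + 2)" by (simp add: powr_add)
      also have "\<dots> \<le> y powr (K1 * (1 + X))"
      proof (rule powr_mono)
        have "\<alpha> \<le> A * (1 + X)"
          unfolding \<alpha>_def A_def using \<alpha>0 d1 X0 by (simp add: algebra_simps)
        then have "(\<gamma> + 1) * (2 * \<alpha>) \<le> (\<gamma> + 1) * (2 * (A * (1 + X)))" using \<gamma>0 by (intro mult_left_mono) auto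
        moreover have "\<beta> \<le> \<beta> * (1 + X)" "2 \<le> 2 * (1 + X)" using \<beta>0 X0 by (auto simp: algebra_simps)
        moreover have "K1 * (1 + X) = \<beta> * (1 + X) + (\<gamma> + 1) * (2 * (A * (1 + X))) + 2 * (1 + X)"
          unfolding K1_def by (simp add: algebra_simps)
        ultimately show "\<beta> + (\<gamma> + 1) * (2 * \<alpha>) + 2 \<le> K1 * (1 + X)" by linarith
      qed (use y2 in auto)
      finally show "258 * D * m * d^4 * ((4 * d) * y) powr (2 * \<alpha>) * y\<^sup>2 \<le> y powr (K1 * (1 + X))" .
    qed (use nn in auto)
    finally have fin: "U \<le> y powr (K1 * (1 + X)) * (Us + \<delta>\<^sup>2 * M\<^sup>2 * Zt)" .
    have "(\<delta> / M) powr (K1 * (1 + X)) = inverse (y powr (K1 * (1 + X)))"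
      unfolding y_def using M \<delta> by (simp add: powr_divide)
    moreover have "inverse (y powr (K1 * (1 + X))) * U \<le> inverse (y powr (K1 * (1 + X))) * (y powr (K1 * (1 + X)) * (Us + \<delta>\<^sup>2 * M\<^sup>2 * Zt))"
      by (intro mult_left_mono fin) auto
    ultimately have "(\<delta> / M) powr (K1 * (1 + X)) * U \<le> Us + \<delta>\<^sup>2 * M\<^sup>2 * Zt"
      using y2 by (simp flip: mult.assoc)
    then show "(\<delta> / M) powr (K1 * (1 + M powr (4/3) * N powr (2/3))) * (LINT x|lebesgue. (u x)\<^sup>2)
         \<le> (LINT x|lebesgue. indicator (S_set M \<delta> Z) x * (u x)\<^sup>2) + \<delta>\<^sup>2 * M\<^sup>2 * (LINT x|lebesgue. (\<zeta> x)\<^sup>2)"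
      unfolding X_def U_def Us_def Zt_def .
  qed
qed

subsection \<open>Smooth bump functions\<close>

text \<open>The functions \<open>p(1/t) e^{-1/t}\<close>, extended by 0. With a polynomial factor
  the family is closed under differentiation, as required for a witness of smoothness.\<close>

definition flat_exp :: "real poly \<Rightarrow> real \<Rightarrow> real" where
  "flat_exp p t = (if t > 0 then poly p (1 / t) / exp (1 / t) else 0)"

lemma poly_div_exp_tendsto_0: "((\<lambda>x. poly p x / exp x) \<longlongrightarrow> (0::real)) at_top"
proof -
  have "((\<lambda>x. \<Sum>i\<le>degree p. coeff p i * (x ^ i / exp x)) \<longlongrightarrow> (\<Sum>i\<le>degree p. coeff p i * 0)) at_top"
    by (intro tendsto_intros tendsto_power_div_exp_0)
  moreover have "(\<lambda>x. poly p x / exp x) = (\<lambda>x. \<Sum>i\<le>degree p. coeff p i * (x ^ i / exp x))"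
    by (simp add: poly_altdef sum_divide_distrib)
  ultimately show ?thesis by simp
qed

text \<open>For \<open>t > 0\<close> the derivative is \<open>(p(1/t) - p'(1/t)) / t^2\<close> times
  the exponential, whence the polynomial. At 0, substituting \<open>x = 1/h\<close> turns the
  right-hand difference quotient into \<open>x p(x) / e^x\<close>, which tends to 0 at
  infinity.\<close>

lemma DERIV_flat_exp:
  "(flat_exp p has_field_derivative flat_exp ([:0, 0, 1:] * (p - pderiv p)) t) (at t)"
proof -
  consider "t > 0" | "t < 0" | "t = 0" by linarith
  then show ?thesis
  proof cases
    case 1
    have "((\<lambda>t. poly p (1 / t) / exp (1 / t)) has_field_derivative flat_exp ([:0, 0, 1:] * (p - pderiv p)) t) (at t)"
      using 1 by (auto intro!: derivative_eq_intros DERIV_chain2[OF poly_DERIV]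
          simp: flat_exp_def field_simps power2_eq_square)
    then show ?thesis
      by (rule DERIV_cong_ev[OF refl _ refl, THEN iffD1, rotated])
        (use 1 in \<open>auto intro!: eventually_mono[OF eventually_nhds_in_open[of "{0<..}"]] simp: flat_exp_def\<close>)
  next
    case 2
    have "((\<lambda>t. 0) has_field_derivative flat_exp ([:0, 0, 1:] * (p - pderiv p)) t) (at t)"
      using 2 by (simp add: flat_exp_def)
    then show ?thesis
      by (rule DERIV_cong_ev[OF refl _ refl, THEN iffD1, rotated])
        (use 2 in \<open>auto intro!: eventually_mono[OF eventually_nhds_in_open[of "{..<0}"]] simp: flat_exp_def\<close>)
  next
    case 3
    have "((\<lambda>h. flat_exp p h / h) \<longlongrightarrow> 0) (at_left 0)"
    proof (rule tendsto_eventually)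
      show "\<forall>\<^sub>F h in at_left 0. flat_exp p h / h = 0"
        by (auto simp: flat_exp_def eventually_at_filter)
    qed
    moreover have "((\<lambda>h. flat_exp p h / h) \<longlongrightarrow> 0) (at_right 0)"
    proof (rule Lim_transform_eventually)
      show "((\<lambda>h. poly (pCons 0 p) (inverse h) / exp (inverse h)) \<longlongrightarrow> 0) (at_right 0)"
        by (rule filterlim_compose[OF poly_div_exp_tendsto_0 filterlim_inverse_at_top_right])
      show "\<forall>\<^sub>F h in at_right 0. poly (pCons 0 p) (inverse h) / exp (inverse h) = flat_exp p h / h"
        by (auto simp: flat_exp_def eventually_at_filter field_simps)
    qed
    ultimately have "((\<lambda>h. flat_exp p h / h) \<longlongrightarrow> 0) (at 0)" by (rule filterlim_split_at)
    then show ?thesis using 3 by (simp add: DERIV_def flat_exp_def)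
  qed
qed

definition bump :: "'a::euclidean_space \<Rightarrow> real \<Rightarrow> 'a \<Rightarrow> real" where
  "bump z e x = flat_exp 1 (1 - (norm (x - z))\<^sup>2 / e\<^sup>2)"

text \<open>Smoothness is defined through a class of functions closed under partial derivatives;
  this is such a class. Linear functions and constants appear on differentiating the squared norm,
  and together they also generate all polynomials.\<close>

inductive bump_algebra :: "'a::euclidean_space \<Rightarrow> real \<Rightarrow> ('a \<Rightarrow> real) \<Rightarrow> bool" for z e where
  linear: "bounded_linear f \<Longrightarrow> bump_algebra z e f"
| const: "bump_algebra z e (\<lambda>x. c)"
| flat: "bump_algebra z e (\<lambda>x. flat_exp p (1 - (norm (x - z))\<^sup>2 / e\<^sup>2))"
| add: "bump_algebra z e f \<Longrightarrow> bump_algebra z e g \<Longrightarrow> bump_algebra z e (\<lambda>x. f x + g x)"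
| mult: "bump_algebra z e f \<Longrightarrow> bump_algebra z e g \<Longrightarrow> bump_algebra z e (\<lambda>x. f x * g x)"

lemma bump_algebra_derivative:
  assumes "bump_algebra z e f" "e > 0"
  shows "\<exists>f'. (\<forall>x. (f has_derivative f' x) (at x)) \<and> (\<forall>b. bump_algebra z e (\<lambda>x. f' x b))"
  using assms(1)
proof induction
  case (linear f)
  show ?case
    by (rule exI[of _ "\<lambda>x. f"]) (auto intro: bounded_linear_imp_has_derivative linear bump_algebra.const)
next
  case (const c)
  show ?case
    by (rule exI[of _ "\<lambda>x h. 0"]) (auto intro: bump_algebra.const)
next
  case (flat p)
  let ?q = "[:0, 0, 1:] * (p - pderiv p)"
  let ?Q = "\<lambda>x. 1 - (norm (x - z))\<^sup>2 / e\<^sup>2"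
  \<comment> \<open>The derivative of \<open>?Q\<close> at \<open>x\<close> in direction
    \<open>h\<close>, written as an affine function of \<open>x\<close> so that it visibly lies in
    the algebra.\<close>
  let ?l = "\<lambda>h x. ((- 2 / e\<^sup>2) *\<^sub>R h) \<bullet> x + (2 / e\<^sup>2) * (z \<bullet> h)"
  show ?case
  proof (intro exI[of _ "\<lambda>x h. ?l h x * flat_exp ?q (?Q x)"] conjI allI)
    fix x
    have "(?Q has_derivative (\<lambda>h. ?l h x)) (at x)"
    proof -
      define c where "c = 1 / e\<^sup>2"
      have Q: "?Q = (\<lambda>x. 1 - c * ((x - z) \<bullet> (x - z)))" by (simp add: c_def power2_norm_eq_inner)
      have l: "(\<lambda>h. ?l h x) = (\<lambda>h. - (2 * c) * (h \<bullet> x) + 2 * c * (z \<bullet> h))" by (simp add: c_def)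
      show ?thesis
        unfolding Q l by (auto intro!: derivative_eq_intros simp: fun_eq_iff inner_simps inner_commute algebra_simps)
    qed
    from DERIV_compose_FDERIV[OF DERIV_flat_exp this]
    show "((\<lambda>x. flat_exp p (?Q x)) has_derivative (\<lambda>h. ?l h x * flat_exp ?q (?Q x))) (at x)" .
    show "bump_algebra z e (\<lambda>x. ?l h x * flat_exp ?q (?Q x))" for h
      by (intro bump_algebra.mult bump_algebra.add bump_algebra.const bump_algebra.flat bump_algebra.linear bounded_linear_inner_right)
  qed
next
  case (add f g)
  then obtain f' g' where "\<forall>x. (f has_derivative f' x) (at x)" "\<forall>b. bump_algebra z e (\<lambda>x. f' x b)"
    "\<forall>x. (g has_derivative g' x) (at x)" "\<forall>b. bump_algebra z e (\<lambda>x. g' x b)" by blast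
  then show ?case
    by (intro exI[of _ "\<lambda>x h. f' x h + g' x h"]) (auto intro!: has_derivative_add bump_algebra.add)
next
  case (mult f g)
  then obtain f' g' where fg: "\<forall>x. (f has_derivative f' x) (at x)" "\<forall>b. bump_algebra z e (\<lambda>x. f' x b)"
    "\<forall>x. (g has_derivative g' x) (at x)" "\<forall>b. bump_algebra z e (\<lambda>x. g' x b)" by blast
  show ?case
  proof (intro exI[of _ "\<lambda>x h. f x * g' x h + f' x h * g x"] conjI allI)
    show "((\<lambda>x. f x * g x) has_derivative (\<lambda>h. f x * g' x h + f' x h * g x)) (at x)" for x
      using fg by (auto intro!: has_derivative_mult)
    show "bump_algebra z e (\<lambda>x. f x * g' x b + f' x b * g x)" for b
      using fg mult by (auto intro!: bump_algebra.add bump_algebra.mult)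
  qed
qed

lemma bump_algebra_smooth:
  assumes "bump_algebra z e f" "e > 0"
  shows "smooth_fun f"
  unfolding smooth_fun_def
  by (rule exI[of _ "Collect (bump_algebra z e)"])
    (use assms bump_algebra_derivative[OF _ assms(2)] in \<open>fastforce\<close>)

lemma bump_pos: "norm (x - z) < e \<Longrightarrow> bump z e x > 0"
proof -
  assume a: "norm (x - z) < e"
  then have "(norm (x - z))\<^sup>2 < e\<^sup>2" by (intro power_strict_mono) auto
  moreover have "0 < e" using a norm_ge_zero[of "x - z"] by linarith
  ultimately show ?thesis unfolding bump_def flat_exp_def by simp
qed

lemma bump_nonneg: "bump z e x \<ge> 0"
  unfolding bump_def flat_exp_def by simp

lemma bump_eq_0: "e > 0 \<Longrightarrow> e \<le> norm (x - z) \<Longrightarrow> bump z e x = 0"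
proof -
  assume a: "e > 0" "e \<le> norm (x - z)"
  then have "e\<^sup>2 \<le> (norm (x - z))\<^sup>2" by (intro power_mono) auto
  then show ?thesis using a unfolding bump_def flat_exp_def by (simp add: not_less)
qed

text \<open>The polynomial factor opens the way to Stone-Weierstrass in the uniqueness argument;
  constant factors give normalized mollifiers.\<close>

lemma test_fun_polynomial_bump:
  assumes p: "real_polynomial_function p" and e: "e > 0"
  shows "test_fun (\<lambda>x. p x * bump z e x)"
proof -
  have "bump_algebra z e p" using p
    by induction (auto intro: bump_algebra.intros)
  then have "bump_algebra z e (\<lambda>x. p x * bump z e x)"
    unfolding bump_def by (intro bump_algebra.mult bump_algebra.flat)
  then have "smooth_fun (\<lambda>x. p x * bump z e x)" using e by (rule bump_algebra_smooth)
  moreover have "{x. p x * bump z e x \<noteq> 0} \<subseteq> cball z e"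
    using bump_eq_0[OF e, of _ z] by (force simp: dist_norm norm_minus_commute)
  then have "bounded {x. p x * bump z e x \<noteq> 0}" using bounded_cball bounded_subset by blast
  then have "compact (closure {x. p x * bump z e x \<noteq> 0})" by (simp add: compact_closure)
  ultimately show ?thesis unfolding test_fun_def by blast
qed

section \<open>Weak derivatives tested against smooth functions\<close>

lemma partial_eq:
  assumes "(f has_derivative f') (at x)"
  shows "partial b f x = f' b"
  unfolding partial_def frechet_derivative_at[OF assms, symmetric] ..

lemma test_fun_partial:
  assumes t: "test_fun f" and b: "b \<in> Basis"
  shows "test_fun (partial b f)"
proof -
  obtain F where F: "f \<in> F" "\<And>g. g \<in> F \<Longrightarrow> \<exists>g'. (\<forall>x. (g has_derivative g' x) (at x)) \<and> (\<forall>b\<in>Basis. (\<lambda>x. g' x b) \<in> F)"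
    using t unfolding test_fun_def smooth_fun_def by blast
  obtain f' where f': "\<And>x. (f has_derivative f' x) (at x)" "\<And>b. b \<in> Basis \<Longrightarrow> (\<lambda>x. f' x b) \<in> F"
    using F by blast
  have eq: "partial b f = (\<lambda>x. f' x b)" using partial_eq[OF f'(1)] by blast
  have "smooth_fun (partial b f)" unfolding eq smooth_fun_def using f'(2)[OF b] F(2) by blast
  moreover have "{x. partial b f x \<noteq> 0} \<subseteq> closure {x. f x \<noteq> 0}"
  proof (rule subsetI, rule ccontr)
    fix x assume x: "x \<in> {x. partial b f x \<noteq> 0}" "x \<notin> closure {x. f x \<noteq> 0}"
    have o: "open (- closure {x. f x \<noteq> 0})" by (simp add: open_Compl)
    have "(f has_derivative (\<lambda>h. 0)) (at x)"
      by (rule has_derivative_transform_within_open[OF _ o, where f = "\<lambda>x. 0"])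
        (use x closure_subset[of "{x. f x \<noteq> 0}"] in \<open>auto simp: subset_eq\<close>)
    then have "partial b f x = 0" by (rule partial_eq)
    then show False using x by simp
  qed
  then have "closure {x. partial b f x \<noteq> 0} \<subseteq> closure {x. f x \<noteq> 0}"
    by (simp add: closure_minimal)
  then have "compact (closure {x. partial b f x \<noteq> 0})"
    using t unfolding test_fun_def by (metis closed_closure compact_Int_closed inf.absorb_iff2)
  ultimately show ?thesis unfolding test_fun_def by blast
qed

lemma weak_deriv_integral:
  assumes "weak_deriv f b g" "test_fun \<phi>"
  shows "integrable lebesgue (\<lambda>x. g x * \<phi> x)"
    "(LINT x|lebesgue. f x * partial b \<phi> x) = - (LINT x|lebesgue. g x * \<phi> x)"
  using assms unfolding weak_deriv_def by auto

lemma weak_deriv_twice: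
  assumes "weak_deriv f b g" "weak_deriv g b h" "test_fun \<phi>" "b \<in> Basis"
  shows "(LINT x|lebesgue. f x * partial b (partial b \<phi>) x) = (LINT x|lebesgue. h x * \<phi> x)"
  using weak_deriv_integral(2)[OF assms(1) test_fun_partial[OF assms(3,4)]] weak_deriv_integral(2)[OF assms(2,3)] by simp

subsection \<open>Uniqueness of weak derivatives\<close>

text \<open>By Stone-Weierstrass \<open>v\<close> is orthogonal to all continuous functions, and bounded continuous functions
converge almost everywhere to the sign of \<open>v\<close>.\<close>

lemma AE_zero_if_orthogonal_to_polynomials:
  fixes v :: "'a::euclidean_space \<Rightarrow> real"
  assumes v: "integrable lebesgue v" and K: "compact K" "\<And>x. x \<notin> K \<Longrightarrow> v x = 0"
    and ip: "\<And>p. real_polynomial_function p \<Longrightarrow> integrable lebesgue (\<lambda>x. p x * v x)"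
    and z: "\<And>p. real_polynomial_function p \<Longrightarrow> (LINT x|lebesgue. p x * v x) = 0"
  shows "AE x in lebesgue. v x = 0"
proof -
  have vm: "v \<in> borel_measurable lebesgue" using v by auto
  have "(\<lambda>x. sgn (v x)) \<in> borel_measurable lebesgue" using vm by measurable
  then have "(\<lambda>x. sgn (v x)) measurable_on UNIV"
    by (rule lebesgue_measurable_imp_measurable_on) simp
  then obtain X g where X: "negligible X" and g: "\<And>n. continuous_on UNIV (g n)"
    "\<And>x. x \<notin> X \<Longrightarrow> (\<lambda>n. g n x) \<longlonglongrightarrow> sgn (v x)"
    unfolding measurable_on_def by auto
  \<comment> \<open>Clamping to \<open>[-1, 1]\<close> leaves the limit \<open>sgn (v x)\<close>
    unchanged and provides the majorant \<open>|v|\<close>.\<close>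
  define c where "c n x = max (-1) (min 1 (g n x))" for n x
  have cc: "continuous_on UNIV (c n)" for n unfolding c_def[abs_def] by (intro continuous_intros g)
  have c1: "\<bar>c n x\<bar> \<le> 1" for n x unfolding c_def by auto
  have clim: "(\<lambda>n. c n x) \<longlonglongrightarrow> sgn (v x)" if "x \<notin> X" for x
  proof -
    have "(\<lambda>n. max (-1) (min 1 (g n x))) \<longlonglongrightarrow> max (-1) (min 1 (sgn (v x)))"
      by (intro tendsto_intros g that)
    moreover have "max (-1) (min 1 (sgn (v x))) = sgn (v x)" by (simp add: sgn_if)
    ultimately show ?thesis unfolding c_def by simp
  qed
  have cvm: "(\<lambda>x. c n x * v x) \<in> borel_measurable lebesgue" for n
    using vm continuous_imp_lebesgue_measurable[OF cc] by (intro borel_measurable_times) auto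
  have cvb: "\<bar>c n x * v x\<bar> \<le> \<bar>v x\<bar>" for n x
    using mult_right_mono[OF c1, of "\<bar>v x\<bar>"] by (simp add: abs_mult)
  have icv: "integrable lebesgue (\<lambda>x. c n x * v x)" for n
    by (rule Bochner_Integration.integrable_bound[OF integrable_abs[OF v] cvm]) (use cvb in auto)
  define I where "I = (LINT x|lebesgue. \<bar>v x\<bar>)"
  have I0: "I \<ge> 0" unfolding I_def by simp
  have cz: "(LINT x|lebesgue. c n x * v x) = 0" for n
  proof (rule ccontr)
    assume ne: "(LINT x|lebesgue. c n x * v x) \<noteq> 0"
    define a where "a = \<bar>LINT x|lebesgue. c n x * v x\<bar>"
    have a: "a > 0" unfolding a_def using ne by simp
    \<comment> \<open>An approximation within \<open>e\<close> on \<open>K\<close> forces the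
      integral to be at most \<open>e I\<close>, which is less than \<open>a\<close>.\<close>
    define e where "e = a / (I + 1)"
    have e: "e > 0" unfolding e_def using a I0 by simp
    obtain p where p: "real_polynomial_function p" "\<And>x. x \<in> K \<Longrightarrow> \<bar>c n x - p x\<bar> < e"
      by (rule Stone_Weierstrass_real_polynomial_function[OF K(1) continuous_on_subset[OF cc] e]) auto
    have "a = \<bar>LINT x|lebesgue. c n x * v x - p x * v x\<bar>"
      unfolding a_def using icv ip[OF p(1)] z[OF p(1)] by simp
    also have "\<dots> \<le> (LINT x|lebesgue. e * \<bar>v x\<bar>)"
    proof (rule Bochner_Integration.integral_norm_bound_integral[where f = "\<lambda>x. c n x * v x - p x * v x", unfolded real_norm_def])
      show "integrable lebesgue (\<lambda>x. c n x * v x - p x * v x)" using icv ip[OF p(1)] by simp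
      show "integrable lebesgue (\<lambda>x. e * \<bar>v x\<bar>)" using v by simp
      show "\<bar>c n x * v x - p x * v x\<bar> \<le> e * \<bar>v x\<bar>" for x
      proof (cases "x \<in> K")
        case True
        have "\<bar>c n x * v x - p x * v x\<bar> = \<bar>c n x - p x\<bar> * \<bar>v x\<bar>"
          by (simp add: left_diff_distrib flip: abs_mult)
        then show ?thesis using p(2)[OF True] by (simp add: mult_right_mono)
      qed (simp add: K(2))
    qed
    also have "\<dots> = e * I" unfolding I_def by simp
    also have "\<dots> < a" unfolding e_def using a I0 by (simp add: field_simps)
    finally show False by simp
  qed
  have "(\<lambda>n. LINT x|lebesgue. c n x * v x) \<longlonglongrightarrow> (LINT x|lebesgue. sgn (v x) * v x)"
  proof (rule integral_dominated_convergence[where w = "\<lambda>x. \<bar>v x\<bar>"])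
    show "(\<lambda>x. sgn (v x) * v x) \<in> borel_measurable lebesgue" using vm by measurable
    have "AE x in lebesgue. x \<notin> X" using X unfolding negligible_iff_null_sets by (rule AE_not_in)
    then show "AE x in lebesgue. (\<lambda>n. c n x * v x) \<longlonglongrightarrow> sgn (v x) * v x"
      by eventually_elim (intro tendsto_intros clim)
  qed (use cvm v cvb in auto)
  then have "(LINT x|lebesgue. sgn (v x) * v x) = 0" using cz by (simp add: LIMSEQ_const_iff)
  moreover have "sgn (v x) * v x = \<bar>v x\<bar>" for x by (simp add: sgn_if)
  ultimately have "I = 0" unfolding I_def by simp
  then have "AE x in lebesgue. \<bar>v x\<bar> = 0"
    unfolding I_def by (subst (asm) integral_nonneg_eq_0_iff_AE) (use v in auto)
  then show ?thesis by simp
qed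

text \<open>Multiplying \<open>u\<close> by a bump localizes it, and a polynomial times a bump is a
  test function, so the polynomial criterion applies to the product. The bumps are positive on balls
  exhausting the space.\<close>

lemma AE_zero_if_orthogonal_to_test_funs:
  fixes u :: "'a::euclidean_space \<Rightarrow> real"
  assumes "\<And>\<phi>. test_fun \<phi> \<Longrightarrow> integrable lebesgue (\<lambda>x. u x * \<phi> x)"
    and "\<And>\<phi>. test_fun \<phi> \<Longrightarrow> (LINT x|lebesgue. u x * \<phi> x) = 0"
  shows "AE x in lebesgue. u x = 0"
proof -
  have "AE x in lebesgue. u x * bump 0 (real (Suc n)) x = 0" for n
  proof (rule AE_zero_if_orthogonal_to_polynomials)
    note t = test_fun_polynomial_bump[of _ "real (Suc n)" 0]
    have eq: "p x * (u x * bump 0 (real (Suc n)) x) = u x * (p x * bump 0 (real (Suc n)) x)" for p x by simp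
    show i: "integrable lebesgue (\<lambda>x. p x * (u x * bump 0 (real (Suc n)) x))" if "real_polynomial_function p" for p
      unfolding eq by (rule assms(1)[OF t]) (use that in auto)
    show "(LINT x|lebesgue. p x * (u x * bump 0 (real (Suc n)) x)) = 0" if "real_polynomial_function p" for p
      unfolding eq by (rule assms(2)[OF t]) (use that in auto)
    show "integrable lebesgue (\<lambda>x. u x * bump 0 (real (Suc n)) x)"
      using i[OF real_polynomial_function.intros(2)[of 1]] by simp
    show "compact (cball (0::'a) (real (Suc n)))" by simp
    show "u x * bump 0 (real (Suc n)) x = 0" if "x \<notin> cball 0 (real (Suc n))" for x
      using that bump_eq_0[of "real (Suc n)" x 0] by simp
  qed
  then have "AE x in lebesgue. \<forall>n. u x * bump 0 (real (Suc n)) x = 0" unfolding AE_all_countable by blast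
  then show ?thesis
  proof eventually_elim
    fix x assume a: "\<forall>n. u x * bump 0 (real (Suc n)) x = 0"
    obtain n where "norm x < real n" using reals_Archimedean2 by blast
    then have "bump 0 (real (Suc n)) x > 0" by (intro bump_pos) simp
    then show "u x = 0" using a[rule_format, of n] by simp
  qed
qed

subsection \<open>Square integrable functions and mollification\<close>

lemma L2_add:
  fixes f g :: "'a::euclidean_space \<Rightarrow> real"
  assumes "L2 f" "L2 g"
  shows "L2 (\<lambda>x. f x + g x)"
  unfolding L2_def
proof
  show m: "(\<lambda>x. f x + g x) \<in> borel_measurable lebesgue" using assms unfolding L2_def by auto
  have i: "integrable lebesgue (\<lambda>x. 2 * (f x)\<^sup>2 + 2 * (g x)\<^sup>2)" using assms unfolding L2_def by auto
  show "integrable lebesgue (\<lambda>x. (f x + g x)\<^sup>2)"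
    by (rule Bochner_Integration.integrable_bound[OF i]) (use m sum_square_le in auto)
qed

lemma L2_cmult: "L2 f \<Longrightarrow> L2 (\<lambda>x. c * f x)"
  unfolding L2_def by (auto simp: power_mult_distrib)

lemma L2_diff: "L2 f \<Longrightarrow> L2 g \<Longrightarrow> L2 (\<lambda>x. f x - g x)"
  using L2_add[of f "\<lambda>x. (-1) * g x"] L2_cmult[of g "-1"] by simp

lemma L2_sum: "finite A \<Longrightarrow> (\<And>i. i \<in> A \<Longrightarrow> L2 (f i)) \<Longrightarrow> L2 (\<lambda>x. \<Sum>i\<in>A. f i x)"
proof (induction A rule: finite_induct)
  case empty
  then show ?case by (simp add: L2_def)
next
  case (insert i A)
  then show ?case by (simp add: L2_add)
qed

lemma L2norm_sq_nonneg: "L2norm_sq f \<ge> 0"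
  unfolding L2norm_sq_def by (rule integral_nonneg_AE) simp

lemma L2norm_sq_add_le:
  assumes "L2 f" "L2 g"
  shows "L2norm_sq (\<lambda>x. f x + g x) \<le> 2 * L2norm_sq f + 2 * L2norm_sq g"
proof -
  have "L2norm_sq (\<lambda>x. f x + g x) \<le> (LINT x|lebesgue. 2 * (f x)\<^sup>2 + 2 * (g x)\<^sup>2)"
    unfolding L2norm_sq_def
    by (rule integral_mono) (use assms L2_add[OF assms] sum_square_le in \<open>auto simp: L2_def\<close>)
  also have "\<dots> = 2 * L2norm_sq f + 2 * L2norm_sq g"
    using assms unfolding L2norm_sq_def L2_def by simp
  finally show ?thesis .
qed

lemma integrable_imp_loc_integrable: "integrable lebesgue g \<Longrightarrow> loc_integrable g"
  unfolding loc_integrable_def by (auto intro!: integrable_indicator_mult lmeasurable_compact fmeasurableD)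

lemma L2_imp_loc_integrable:
  assumes "L2 g"
  shows "loc_integrable g"
  unfolding loc_integrable_def
proof (intro conjI allI impI)
  show gm: "g \<in> borel_measurable lebesgue" using assms unfolding L2_def by simp
  fix K :: "'a set" assume K: "compact K"
  have Ks: "K \<in> sets lebesgue" using K by (intro lmeasurable_compact fmeasurableD)
  have i: "integrable lebesgue (\<lambda>x. indicator K x + (g x)\<^sup>2)"
    using assms lmeasurable_compact[OF K] unfolding L2_def
    by (auto intro!: Bochner_Integration.integrable_add integrable_real_indicator simp: fmeasurable_def)
  show "integrable lebesgue (\<lambda>x. indicator K x * g x)"
  proof (rule Bochner_Integration.integrable_bound[OF i])
    show "(\<lambda>x. indicator K x * g x) \<in> borel_measurable lebesgue" using gm Ks by measurable
    have "norm (indicator K x * g x) \<le> norm (indicator K x + (g x)\<^sup>2)" for x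
    proof -
      have "2 * 1 * \<bar>g x\<bar> \<le> 1\<^sup>2 + \<bar>g x\<bar>\<^sup>2" by (rule sum_squares_bound)
      then show ?thesis by (auto simp: indicator_def)
    qed
    then show "AE x in lebesgue. norm (indicator K x * g x) \<le> norm (indicator K x + (g x)\<^sup>2)" by simp
  qed
qed

lemma integrable_indicator_cball: "integrable lebesgue (indicator (cball (x::'a::euclidean_space) r) :: 'a \<Rightarrow> real)"
  using lmeasurable_compact[OF compact_cball, of x r]
  by (auto intro!: integrable_real_indicator simp: fmeasurable_def)

section \<open>Mollification in L2\<close>

text \<open>The radius is a parameter because one kernel has to approximate both
  \<open>\<psi>\<close> and its Laplacian: closeness is obtained for all radii below a threshold,
  and two thresholds can be combined.\<close>

definition is_mollifier :: "('a::euclidean_space \<Rightarrow> real) \<Rightarrow> real \<Rightarrow> bool" where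
  "is_mollifier \<kappa> r \<longleftrightarrow> continuous_on UNIV \<kappa> \<and> (\<forall>x. 0 \<le> \<kappa> x) \<and> (\<forall>x. norm x > r \<longrightarrow> \<kappa> x = 0) \<and>
     (LINT x|lebesgue. \<kappa> x) = 1"

lemma is_mollifierD:
  assumes "is_mollifier \<kappa> r"
  shows "continuous_on UNIV \<kappa>" "0 \<le> \<kappa> x" "norm x > r \<Longrightarrow> \<kappa> x = 0" "(LINT x|lebesgue. \<kappa> x) = 1"
    "integrable lebesgue (\<lambda>y. \<kappa> (x - y))" "(LINT y|lebesgue. \<kappa> (x - y)) = 1" "(LINT y|lebesgue. \<kappa> (y - x)) = 1"
    "integrable lebesgue (\<lambda>y. \<kappa> (y - x))"
proof -
  show c: "continuous_on UNIV \<kappa>" "0 \<le> \<kappa> x" "norm x > r \<Longrightarrow> \<kappa> x = 0" "(LINT x|lebesgue. \<kappa> x) = 1" for x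
    using assms unfolding is_mollifier_def by auto
  have m: "\<kappa> \<in> borel_measurable lebesgue" by (rule continuous_imp_lebesgue_measurable[OF c(1)])
  have i: "integrable lebesgue \<kappa>"
    by (rule integrable_compact_support[of "cball 0 r"]) (use c in \<open>auto intro: continuous_on_subset\<close>)
  show "integrable lebesgue (\<lambda>y. \<kappa> (x - y))" by (rule lebesgue_integral_translate_reflect(3)[OF m i])
  show "(LINT y|lebesgue. \<kappa> (x - y)) = 1"
    using lebesgue_integral_translate_reflect(1)[OF m] c(4) by simp
  show "(LINT y|lebesgue. \<kappa> (y - x)) = 1"
    using lebesgue_integral_translate_reflect(2)[OF m, of "-x"] c(4) by simp
  show "integrable lebesgue (\<lambda>y. \<kappa> (y - x))"
    by (rule integrable_compact_support[of "cball x r"])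
      (use c in \<open>auto intro!: continuous_intros continuous_on_compose2[OF c(1)] simp: dist_norm norm_minus_commute\<close>)
qed

text \<open>With \<open>c\<close> the mean of \<open>h\<close> for the probability density
  \<open>\<kappa> (x - y)\<close>, this is nonnegativity of the variance.\<close>

lemma conv_mollifier_jensen:
  assumes h: "L2 h" and \<kappa>: "is_mollifier \<kappa> r"
  shows "(LINT y|lebesgue. h y * \<kappa> (x - y))\<^sup>2 \<le> (LINT y|lebesgue. (h y)\<^sup>2 * \<kappa> (x - y))"
    and "integrable lebesgue (\<lambda>y. (h y)\<^sup>2 * \<kappa> (x - y))"
proof -
  note k = is_mollifierD[OF \<kappa>]
  have i1: "integrable lebesgue (\<lambda>y. h y * \<kappa> (x - y))"
    using integrable_conv[OF L2_imp_loc_integrable[OF h] k(1) k(3)] by simp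
  show i2: "integrable lebesgue (\<lambda>y. (h y)\<^sup>2 * \<kappa> (x - y))"
    using integrable_conv[OF integrable_imp_loc_integrable k(1) k(3), of "\<lambda>y. (h y)\<^sup>2"] h unfolding L2_def by simp
  define c where "c = (LINT y|lebesgue. h y * \<kappa> (x - y))"
  have "0 \<le> (LINT y|lebesgue. (h y - c)\<^sup>2 * \<kappa> (x - y))"
    by (rule integral_nonneg_AE) (use k(2) in auto)
  also have "\<dots> = (LINT y|lebesgue. (h y)\<^sup>2 * \<kappa> (x - y) - 2 * c * (h y * \<kappa> (x - y)) + c\<^sup>2 * \<kappa> (x - y))"
    by (rule Bochner_Integration.integral_cong) (auto simp: power2_eq_square algebra_simps)
  also have "\<dots> = (LINT y|lebesgue. (h y)\<^sup>2 * \<kappa> (x - y)) - 2 * c * c + c\<^sup>2 * 1"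
    unfolding c_def k(6)[symmetric, of x]
    by (intro has_bochner_integral_integral_eq has_bochner_integral_add has_bochner_integral_diff has_bochner_integral_mult_right
      has_bochner_integral_integrable i1 i2 k(5))
  finally show "(LINT y|lebesgue. h y * \<kappa> (x - y))\<^sup>2 \<le> (LINT y|lebesgue. (h y)\<^sup>2 * \<kappa> (x - y))"
    unfolding c_def[symmetric] by (simp add: power2_eq_square)
qed

text \<open>Jensen's inequality pointwise, then Tonelli: the integral of
  \<open>\<kappa> (x - y)\<close> over \<open>x\<close> is 1.\<close>

lemma conv_mollifier_L2:
  fixes h :: "'a::euclidean_space \<Rightarrow> real"
  assumes h: "L2 h" and \<kappa>: "is_mollifier \<kappa> r"
  shows "L2 (\<lambda>x. LINT y|lebesgue. h y * \<kappa> (x - y))"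
    and "L2norm_sq (\<lambda>x. LINT y|lebesgue. h y * \<kappa> (x - y)) \<le> L2norm_sq h"
proof -
  note k = is_mollifierD[OF \<kappa>]
  let ?c = "\<lambda>x. LINT y|lebesgue. h y * \<kappa> (x - y)"
  have cc: "continuous_on UNIV ?c"
    using conv_continuous[OF L2_imp_loc_integrable[OF h] k(1) k(3)] by simp
  have hm: "h \<in> borel_measurable lebesgue" and hi: "integrable lebesgue (\<lambda>x. (h x)\<^sup>2)" using h unfolding L2_def by auto
  \<comment> \<open>A Borel version of \<open>h\<close> makes the two-variable integrand measurable
    for the product; the change on a null set does not affect the integrals.\<close>
  obtain h' where h': "h' \<in> borel_measurable lborel" "AE x in lborel. h x = h' x"
    using completion_ex_borel_measurable_real[OF hm] by blast
  have km: "\<kappa> \<in> borel_measurable borel" using k(1) by (rule borel_measurable_continuous_onI)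
  have "(\<integral>\<^sup>+x. ennreal ((?c x)\<^sup>2) \<partial>lebesgue) \<le> (\<integral>\<^sup>+x. (\<integral>\<^sup>+y. ennreal ((h y)\<^sup>2 * \<kappa> (x - y)) \<partial>lebesgue) \<partial>lebesgue)"
  proof (rule nn_integral_mono)
    fix x
    have "(\<integral>\<^sup>+y. ennreal ((h y)\<^sup>2 * \<kappa> (x - y)) \<partial>lebesgue) = ennreal (LINT y|lebesgue. (h y)\<^sup>2 * \<kappa> (x - y))"
      by (rule nn_integral_eq_integral[OF conv_mollifier_jensen(2)[OF h \<kappa>]]) (use k(2) in auto)
    then show "ennreal ((?c x)\<^sup>2) \<le> (\<integral>\<^sup>+y. ennreal ((h y)\<^sup>2 * \<kappa> (x - y)) \<partial>lebesgue)"
      using conv_mollifier_jensen(1)[OF h \<kappa>, of x] by (simp add: ennreal_leI)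
  qed
  also have "\<dots> = (\<integral>\<^sup>+x. (\<integral>\<^sup>+y. ennreal ((h' y)\<^sup>2 * \<kappa> (x - y)) \<partial>lborel) \<partial>lborel)"
    unfolding nn_integral_completion
    by (intro nn_integral_cong nn_integral_cong_AE) (use h'(2) in \<open>auto elim!: eventually_mono\<close>)
  also have "\<dots> = (\<integral>\<^sup>+y. (\<integral>\<^sup>+x. ennreal ((h' y)\<^sup>2 * \<kappa> (x - y)) \<partial>lborel) \<partial>lborel)"
  proof (rule lborel_pair.Fubini'[where f = "\<lambda>y x. ennreal ((h' y)\<^sup>2 * \<kappa> (x - y))"])
    show "(\<lambda>(y, x). ennreal ((h' y)\<^sup>2 * \<kappa> (x - y))) \<in> borel_measurable (lborel \<Otimes>\<^sub>M lborel)"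
      using h'(1) km by measurable
  qed
  also have "\<dots> = (\<integral>\<^sup>+y. ennreal ((h' y)\<^sup>2) \<partial>lborel)"
  proof (rule nn_integral_cong)
    fix y
    have "(\<integral>\<^sup>+x. ennreal (\<kappa> (x - y)) \<partial>lborel) = (\<integral>\<^sup>+x. ennreal (\<kappa> (x - y)) \<partial>lebesgue)"
      by (simp add: nn_integral_completion)
    also have "\<dots> = ennreal (LINT x|lebesgue. \<kappa> (x - y))"
      by (rule nn_integral_eq_integral[OF k(8)]) (use k(2) in auto)
    finally have 1: "(\<integral>\<^sup>+x. ennreal (\<kappa> (x - y)) \<partial>lborel) = 1" using k(7) by simp
    have "(\<integral>\<^sup>+x. ennreal ((h' y)\<^sup>2 * \<kappa> (x - y)) \<partial>lborel) = ennreal ((h' y)\<^sup>2) * (\<integral>\<^sup>+x. ennreal (\<kappa> (x - y)) \<partial>lborel)"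
      using km by (simp add: ennreal_mult' nn_integral_cmult)
    then show "(\<integral>\<^sup>+x. ennreal ((h' y)\<^sup>2 * \<kappa> (x - y)) \<partial>lborel) = ennreal ((h' y)\<^sup>2)" using 1 by simp
  qed
  also have "\<dots> = (\<integral>\<^sup>+y. ennreal ((h y)\<^sup>2) \<partial>lebesgue)"
    unfolding nn_integral_completion
    by (intro nn_integral_cong_AE) (use h'(2) in \<open>auto elim!: eventually_mono\<close>)
  also have "\<dots> = ennreal (L2norm_sq h)"
    unfolding L2norm_sq_def by (rule nn_integral_eq_integral[OF hi]) simp
  finally have fin: "(\<integral>\<^sup>+x. ennreal ((?c x)\<^sup>2) \<partial>lebesgue) \<le> ennreal (L2norm_sq h)" .
  have cm: "?c \<in> borel_measurable lebesgue" by (rule continuous_imp_lebesgue_measurable[OF cc])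
  have ci: "integrable lebesgue (\<lambda>x. (?c x)\<^sup>2)"
  proof (rule integrableI_bounded)
    show "(\<lambda>x. (?c x)\<^sup>2) \<in> borel_measurable lebesgue" using cm by simp
    show "(\<integral>\<^sup>+x. ennreal (norm ((?c x)\<^sup>2)) \<partial>lebesgue) < \<infinity>"
      using fin by (simp add: order_le_less_trans)
  qed
  then show "L2 ?c" using cm unfolding L2_def by simp
  have "ennreal (L2norm_sq ?c) \<le> ennreal (L2norm_sq h)"
    using fin unfolding L2norm_sq_def by (subst nn_integral_eq_integral[OF ci, symmetric]) auto
  then show "L2norm_sq ?c \<le> L2norm_sq h" using L2norm_sq_nonneg[of h] by simp
qed

lemma tendsto_imp_small:
  assumes "f \<longlonglongrightarrow> (0::real)" "e > 0"
  shows "\<exists>n. f n < e"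
proof -
  have "\<forall>\<^sub>F n in sequentially. f n < e" using order_tendstoD(2)[OF assms] .
  then show ?thesis by (auto simp: eventually_sequentially)
qed

text \<open>Truncation in space and height approximates \<open>h\<close> by dominated convergence
  with majorant \<open>h^2\<close>. Continuous functions converging to \<open>h\<close> almost
  everywhere are then truncated in the same way, which gives the majorant \<open>(2 n)^2\<close> on
  a fixed ball.\<close>

lemma L2_approx_continuous:
  fixes h :: "'a::euclidean_space \<Rightarrow> real"
  assumes h: "L2 h" and e: "e > 0"
  obtains g B where "continuous_on UNIV g" "\<And>x. norm x > B \<Longrightarrow> g x = 0" "L2 g" "L2norm_sq (\<lambda>x. h x - g x) < e"
proof -
  have hm: "h \<in> borel_measurable lebesgue" and hi: "integrable lebesgue (\<lambda>x. (h x)\<^sup>2)" using h unfolding L2_def by auto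
  define \<theta> where "\<theta> n x = max 0 (min 1 (real n + 1 - norm x))" for n and x :: 'a
  define cl where "cl n t = max (- real n) (min (real n) t)" for n t
  define T where "T n x = \<theta> n x * cl n (h x)" for n x
  have \<theta>: "0 \<le> \<theta> n x" "\<theta> n x \<le> 1" "norm x > real n + 1 \<Longrightarrow> \<theta> n x = 0" "continuous_on UNIV (\<theta> n)" for n x
    unfolding \<theta>_def by (auto intro!: continuous_intros)
  have \<theta>m: "\<theta> n \<in> borel_measurable lebesgue" for n by (rule continuous_imp_lebesgue_measurable[OF \<theta>(4)])
  have cl: "\<bar>cl n t\<bar> \<le> \<bar>t\<bar>" "\<bar>cl n t\<bar> \<le> real n" "\<bar>t - cl n t\<bar> \<le> \<bar>t\<bar>" for n t unfolding cl_def by auto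
  have Tm: "T n \<in> borel_measurable lebesgue" for n
    unfolding T_def[abs_def] cl_def using hm \<theta>m by measurable
  have hT: "\<bar>h x - T n x\<bar> \<le> \<bar>h x\<bar>" for n x
  proof -
    have "0 \<le> cl n (h x) * h x"
      by (cases "h x \<ge> 0") (auto simp: cl_def intro!: mult_nonneg_nonneg mult_nonpos_nonpos)
    moreover have "\<bar>cl n (h x)\<bar> \<le> \<bar>h x\<bar>" by (rule cl)
    moreover have "\<bar>T n x\<bar> \<le> \<bar>cl n (h x)\<bar>" unfolding T_def abs_mult using \<theta>(1,2)[of n x] by (simp add: mult_left_le_one_le)
    moreover have "0 \<le> T n x * h x" unfolding T_def using \<theta>(1) calculation(1) by (simp add: mult.assoc)
    ultimately show ?thesis by (auto simp: zero_le_mult_iff abs_le_iff)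
  qed
  have "(\<lambda>n. LINT x|lebesgue. (h x - T n x)\<^sup>2) \<longlonglongrightarrow> (LINT x|(lebesgue :: 'a measure). (0::real))"
  proof (rule integral_dominated_convergence[where w = "\<lambda>x. (h x)\<^sup>2"])
    show "AE x in lebesgue. (\<lambda>n. (h x - T n x)\<^sup>2) \<longlonglongrightarrow> 0"
    proof (rule AE_I2)
      fix x
      obtain N where N: "norm x + \<bar>h x\<bar> < real N" using reals_Archimedean2 by blast
      have "h x - T n x = 0" if "n \<ge> N" for n
      proof -
        have "real n \<ge> real N" using that by simp
        then have "norm x \<le> real n" "\<bar>h x\<bar> \<le> real n" using N norm_ge_zero[of x] by linarith+
        then have "\<theta> n x = 1" "cl n (h x) = h x" unfolding \<theta>_def cl_def max_def min_def by auto
        then show ?thesis unfolding T_def by simp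
      qed
      then have "\<forall>\<^sub>F n in sequentially. (h x - T n x)\<^sup>2 = 0" unfolding eventually_sequentially by auto
      then show "(\<lambda>n. (h x - T n x)\<^sup>2) \<longlonglongrightarrow> 0" by (rule tendsto_eventually)
    qed
    show "AE x in lebesgue. norm ((h x - T n x)\<^sup>2) \<le> (h x)\<^sup>2" for n
    proof -
      have "\<bar>h x - T n x\<bar>\<^sup>2 \<le> \<bar>h x\<bar>\<^sup>2" for x by (intro power_mono hT) simp
      then show ?thesis by simp
    qed
  qed (use hm Tm hi in auto)
  then obtain n where n: "(LINT x|lebesgue. (h x - T n x)\<^sup>2) < e / 4"
    using tendsto_imp_small[of "\<lambda>n. LINT x|lebesgue. (h x - T n x)\<^sup>2" "e / 4"] e by auto
  have "h measurable_on UNIV" using hm by (rule lebesgue_measurable_imp_measurable_on) simp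
  then obtain X g where X: "negligible X" and g: "\<And>k. continuous_on UNIV (g k)"
    "\<And>x. x \<notin> X \<Longrightarrow> (\<lambda>k. g k x) \<longlonglongrightarrow> h x"
    unfolding measurable_on_def by auto
  define G where "G k x = \<theta> n x * cl n (g k x)" for k x
  have Gc: "continuous_on UNIV (G k)" for k
    unfolding G_def[abs_def] cl_def by (intro continuous_intros \<theta> g)
  have Gm: "G k \<in> borel_measurable lebesgue" for k by (rule continuous_imp_lebesgue_measurable[OF Gc])
  have G0: "G k x = 0" if "norm x > real n + 1" for k x unfolding G_def using \<theta>(3)[OF that] by simp
  have "(\<lambda>k. LINT x|lebesgue. (T n x - G k x)\<^sup>2) \<longlonglongrightarrow> (LINT x|(lebesgue :: 'a measure). (0::real))"
  proof (rule integral_dominated_convergence[where w = "\<lambda>x. indicator (cball 0 (real n + 1)) x * (2 * real n)\<^sup>2"])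
    have "AE x in lebesgue. x \<notin> X" using X unfolding negligible_iff_null_sets by (rule AE_not_in)
    then show "AE x in lebesgue. (\<lambda>k. (T n x - G k x)\<^sup>2) \<longlonglongrightarrow> 0"
    proof eventually_elim
      fix x assume "x \<notin> X"
      then have "(\<lambda>k. (T n x - G k x)\<^sup>2) \<longlonglongrightarrow> (T n x - \<theta> n x * max (- real n) (min (real n) (h x)))\<^sup>2"
        unfolding G_def cl_def by (intro tendsto_intros g)
      then show "(\<lambda>k. (T n x - G k x)\<^sup>2) \<longlonglongrightarrow> 0" unfolding T_def cl_def by simp
    qed
    show "integrable lebesgue (\<lambda>x. indicator (cball 0 (real n + 1)) x * (2 * real n)\<^sup>2)"
      by (intro integrable_mult_left integrable_indicator_cball)
    fix k
    show "AE x in lebesgue. norm ((T n x - G k x)\<^sup>2) \<le> indicator (cball 0 (real n + 1)) x * (2 * real n)\<^sup>2"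
    proof (rule AE_I2)
      fix x
      show "norm ((T n x - G k x)\<^sup>2) \<le> indicator (cball 0 (real n + 1)) x * (2 * real n)\<^sup>2"
      proof (cases "norm x > real n + 1")
        case True
        then show ?thesis using G0[OF True] \<theta>(3)[OF True] unfolding T_def by simp
      next
        case False
        have "\<bar>T n x\<bar> \<le> 1 * real n" "\<bar>G k x\<bar> \<le> 1 * real n"
          unfolding T_def G_def abs_mult using \<theta>(1,2)[of n x] cl(2) by (intro mult_mono; auto)+
        then have "\<bar>T n x - G k x\<bar> \<le> 2 * real n" by linarith
        then have "\<bar>T n x - G k x\<bar>\<^sup>2 \<le> (2 * real n)\<^sup>2" by (intro power_mono) auto
        then show ?thesis using False by (simp add: indicator_def)
      qed
    qed
  qed (use Tm Gm in auto)
  then obtain k where k: "(LINT x|lebesgue. (T n x - G k x)\<^sup>2) < e / 4"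
    using tendsto_imp_small[of "\<lambda>k. LINT x|lebesgue. (T n x - G k x)\<^sup>2" "e / 4"] e by auto
  have GL: "L2 (G k)"
    unfolding L2_def using Gm
    by (auto intro!: integrable_compact_support[of "cball 0 (real n + 1)"] continuous_intros continuous_on_subset[OF Gc] simp: G0)
  have TL: "L2 (T n)"
    unfolding L2_def
  proof
    show "integrable lebesgue (\<lambda>x. (T n x)\<^sup>2)"
    proof (rule Bochner_Integration.integrable_bound[OF hi])
      have "\<bar>T n x\<bar> \<le> 1 * \<bar>h x\<bar>" for x
        unfolding T_def abs_mult using \<theta>(1,2)[of n x] cl(1) by (intro mult_mono) auto
      then have "\<bar>T n x\<bar>\<^sup>2 \<le> \<bar>h x\<bar>\<^sup>2" for x by (intro power_mono) auto
      then show "AE x in lebesgue. norm ((T n x)\<^sup>2) \<le> norm ((h x)\<^sup>2)" by simp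
    qed (use Tm in auto)
  qed (rule Tm)
  have "L2norm_sq (\<lambda>x. (h x - T n x) + (T n x - G k x)) \<le> 2 * L2norm_sq (\<lambda>x. h x - T n x) + 2 * L2norm_sq (\<lambda>x. T n x - G k x)"
    by (intro L2norm_sq_add_le L2_diff h TL GL)
  also have "\<dots> < e" using n k unfolding L2norm_sq_def by linarith
  finally have "L2norm_sq (\<lambda>x. h x - G k x) < e" by simp
  then show thesis using that[OF Gc G0 GL] by blast
qed

text \<open>By uniform continuity the error is at most \<open>\<eta>\<close> on the ball of radius
  \<open>|B| + 1\<close>; outside it the error vanishes because \<open>r < 1\<close>. Thus
  \<open>\<eta>^2\<close> times the volume \<open>v\<close> has to be below
  \<open>e\<close>.\<close>

lemma conv_mollifier_continuous_close:
  fixes g :: "'a::euclidean_space \<Rightarrow> real"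
  assumes g: "continuous_on UNIV g" "\<And>x. norm x > B \<Longrightarrow> g x = 0" "L2 g" and e: "e > 0"
  obtains d where "d > 0"
    "\<And>\<kappa> r. is_mollifier \<kappa> r \<Longrightarrow> r < d \<Longrightarrow> L2norm_sq (\<lambda>x. (LINT y|lebesgue. g y * \<kappa> (x - y)) - g x) < e"
proof -
  define v where "v = measure lebesgue (cball (0::'a) (\<bar>B\<bar> + 1))"
  have v0: "v \<ge> 0" unfolding v_def by simp
  define \<eta> where "\<eta> = sqrt (e / (v + 1))"
  have \<eta>: "\<eta> > 0" unfolding \<eta>_def using e v0 by simp
  have \<eta>v: "\<eta>\<^sup>2 * v < e" unfolding \<eta>_def using e v0 by (simp add: field_simps)
  have "uniformly_continuous_on (cball 0 (\<bar>B\<bar>+2)) g"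
    using g(1) by (intro compact_uniformly_continuous) (auto intro: continuous_on_subset)
  then obtain d0 where d0: "d0 > 0"
    "\<And>x y. x \<in> cball 0 (\<bar>B\<bar>+2) \<Longrightarrow> y \<in> cball 0 (\<bar>B\<bar>+2) \<Longrightarrow> dist y x < d0 \<Longrightarrow> dist (g y) (g x) < \<eta>"
    using \<eta> unfolding uniformly_continuous_on_def by metis
  define d where "d = min 1 d0"
  show thesis
  proof (rule that[of d])
    show "d > 0" unfolding d_def using d0 by simp
    fix \<kappa> :: "'a \<Rightarrow> real" and r assume \<kappa>: "is_mollifier \<kappa> r" and r: "r < d"
    note k = is_mollifierD[OF \<kappa>]
    let ?c = "\<lambda>x. LINT y|lebesgue. g y * \<kappa> (x - y)"
    have i1: "integrable lebesgue (\<lambda>y. g y * \<kappa> (x - y))" for x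
      using integrable_conv[OF L2_imp_loc_integrable[OF g(3)] k(1) k(3)] by simp
    have cd: "?c x - g x = (LINT y|lebesgue. (g y - g x) * \<kappa> (x - y))" for x
    proof -
      have "(LINT y|lebesgue. (g y - g x) * \<kappa> (x - y)) = (LINT y|lebesgue. g y * \<kappa> (x - y) - g x * \<kappa> (x - y))"
        by (simp add: left_diff_distrib)
      also have "\<dots> = ?c x - g x" using i1 k(5,6) by simp
      finally show ?thesis ..
    qed
    have b1: "\<bar>?c x - g x\<bar> \<le> \<eta>" if x: "norm x \<le> \<bar>B\<bar> + 1" for x
    proof -
      have "\<bar>?c x - g x\<bar> \<le> (LINT y|lebesgue. \<eta> * \<kappa> (x - y))"
        unfolding cd
      proof (rule Bochner_Integration.integral_norm_bound_integral[where f = "\<lambda>y. (g y - g x) * \<kappa> (x - y)", unfolded real_norm_def])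
        show "integrable lebesgue (\<lambda>y. (g y - g x) * \<kappa> (x - y))" using i1 k(5) by (simp add: left_diff_distrib)
        show "integrable lebesgue (\<lambda>y. \<eta> * \<kappa> (x - y))" using k(5) by simp
        fix y
        show "\<bar>(g y - g x) * \<kappa> (x - y)\<bar> \<le> \<eta> * \<kappa> (x - y)"
        proof (cases "norm (x - y) > r")
          case False
          then have "norm (x - y) < d" using r by simp
          moreover have "norm y \<le> norm x + norm (x - y)" by norm
          ultimately have "dist (g y) (g x) < \<eta>" using x unfolding d_def
            by (intro d0(2)) (auto simp: dist_norm norm_minus_commute)
          then show ?thesis using k(2) by (simp add: abs_mult dist_real_def mult_right_mono)
        qed (simp add: k(3))
      qed
      also have "\<dots> = \<eta>" using k(6) by simp
      finally show ?thesis .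
    qed
    have b2: "?c x - g x = 0" if x: "norm x > \<bar>B\<bar> + 1" for x
    proof -
      have "(g y - g x) * \<kappa> (x - y) = 0" for y
      proof (cases "norm (x - y) > r")
        case False
        then have "norm (x - y) < 1" using r unfolding d_def by simp
        moreover have "norm y \<ge> norm x - norm (x - y)" by norm
        ultimately have "norm y > B" "norm x > B" using x by auto
        then show ?thesis using g(2) by simp
      qed (simp add: k(3))
      then have "(\<lambda>y. (g y - g x) * \<kappa> (x - y)) = (\<lambda>y. 0)" by blast
      then show ?thesis unfolding cd by simp
    qed
    have iv: "integrable lebesgue (\<lambda>x. indicator (cball (0::'a) (\<bar>B\<bar> + 1)) x :: real)"
      by (rule integrable_indicator_cball)
    have "L2norm_sq (\<lambda>x. ?c x - g x) \<le> (LINT x|lebesgue. \<eta>\<^sup>2 * indicator (cball (0::'a) (\<bar>B\<bar> + 1)) x)"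
      unfolding L2norm_sq_def
    proof (rule integral_mono)
      show "integrable lebesgue (\<lambda>x. (?c x - g x)\<^sup>2)"
        using L2_diff[OF conv_mollifier_L2(1)[OF g(3) \<kappa>] g(3)] unfolding L2_def by simp
      show "integrable lebesgue (\<lambda>x. \<eta>\<^sup>2 * indicator (cball (0::'a) (\<bar>B\<bar> + 1)) x)" using iv by simp
      fix x
      show "(?c x - g x)\<^sup>2 \<le> \<eta>\<^sup>2 * indicator (cball 0 (\<bar>B\<bar> + 1)) x"
      proof (cases "norm x > \<bar>B\<bar> + 1")
        case True then show ?thesis using b2 by simp
      next
        case False
        then have "\<bar>?c x - g x\<bar>\<^sup>2 \<le> \<eta>\<^sup>2" by (intro power_mono b1) auto
        then show ?thesis using False by simp
      qed
    qed
    also have "\<dots> = \<eta>\<^sup>2 * v" unfolding v_def by simp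
    also have "\<dots> < e" by (rule \<eta>v)
    finally show "L2norm_sq (\<lambda>x. ?c x - g x) < e" .
  qed
qed

text \<open>The error splits into the convolution of \<open>h - g\<close>, the error for the
  continuous \<open>g\<close>, and \<open>g - h\<close>; convolution does not increase the norm. The
  shares of \<open>e / 16\<close> add up to \<open>10 e / 16\<close>.\<close>

lemma conv_mollifier_close:
  fixes h :: "'a::euclidean_space \<Rightarrow> real"
  assumes h: "L2 h" and e: "e > 0"
  obtains d where "d > 0"
    "\<And>\<kappa> r. is_mollifier \<kappa> r \<Longrightarrow> r < d \<Longrightarrow> L2norm_sq (\<lambda>x. (LINT y|lebesgue. h y * \<kappa> (x - y)) - h x) < e"
proof -
  obtain g B where g: "continuous_on UNIV g" "\<And>x. norm x > B \<Longrightarrow> g x = 0" "L2 g" and hg: "L2norm_sq (\<lambda>x. h x - g x) < e / 16"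
    by (rule L2_approx_continuous[OF h, of "e/16"]) (use e in auto)
  obtain d where d: "d > 0" "\<And>\<kappa> r. is_mollifier \<kappa> r \<Longrightarrow> r < d \<Longrightarrow> L2norm_sq (\<lambda>x. (LINT y|lebesgue. g y * \<kappa> (x - y)) - g x) < e / 16"
    by (rule conv_mollifier_continuous_close[OF g, of B "e/16"]) (use e in auto)
  show thesis
  proof (rule that[OF d(1)])
    fix \<kappa> :: "'a \<Rightarrow> real" and r assume \<kappa>: "is_mollifier \<kappa> r" and r: "r < d"
    note k = is_mollifierD[OF \<kappa>]
    let ?c = "\<lambda>h x. LINT y|lebesgue. h y * \<kappa> (x - y)"
    have hgL: "L2 (\<lambda>x. h x - g x)" by (rule L2_diff[OF h g(3)])
    have i: "integrable lebesgue (\<lambda>y. f y * \<kappa> (x - y))" if "L2 f" for f x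
      using integrable_conv[OF L2_imp_loc_integrable[OF that] k(1) k(3)] by simp
    have eq: "?c h x - h x = (?c (\<lambda>x. h x - g x) x + (?c g x - g x)) + (-1) * (h x - g x)" for x
      using i[OF h] i[OF g(3)] by (simp add: left_diff_distrib)
    have L: "L2 (\<lambda>x. ?c (\<lambda>x. h x - g x) x)" "L2 (\<lambda>x. ?c g x - g x)" "L2 (\<lambda>x. (-1) * (h x - g x))"
      by (intro conv_mollifier_L2(1)[OF _ \<kappa>] L2_diff L2_cmult h g)+
    have "L2norm_sq (\<lambda>x. ?c h x - h x) \<le> 2 * L2norm_sq (\<lambda>x. ?c (\<lambda>x. h x - g x) x + (?c g x - g x)) + 2 * L2norm_sq (\<lambda>x. (-1) * (h x - g x))"
      unfolding eq by (intro L2norm_sq_add_le L2_add L)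
    also have "\<dots> \<le> 2 * (2 * L2norm_sq (\<lambda>x. ?c (\<lambda>x. h x - g x) x) + 2 * L2norm_sq (\<lambda>x. ?c g x - g x)) + 2 * L2norm_sq (\<lambda>x. (-1) * (h x - g x))"
      by (intro add_right_mono mult_left_mono L2norm_sq_add_le[OF L(1,2)]) simp
    also have "L2norm_sq (\<lambda>x. (-1) * (h x - g x)) = L2norm_sq (\<lambda>x. h x - g x)"
      unfolding L2norm_sq_def by (simp add: power2_commute)
    also have "2 * (2 * L2norm_sq (\<lambda>x. ?c (\<lambda>x. h x - g x) x) + 2 * L2norm_sq (\<lambda>x. ?c g x - g x)) + 2 * L2norm_sq (\<lambda>x. h x - g x) < e"
    proof -
      have "2 * (2 * a + 2 * b) + 2 * c < e" if "c < e / 16" "b < e / 16" "a \<le> c" for a b c :: real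
        using that e by (simp add: field_simps)
      then show ?thesis using hg d(2)[OF \<kappa> r] conv_mollifier_L2(2)[OF hgL \<kappa>] by blast
    qed
    finally show "L2norm_sq (\<lambda>x. ?c h x - h x) < e" .
  qed
qed

subsection \<open>Density of compactly supported functions\<close>

text \<open>Two views of one kernel are delivered: explicit second derivatives for differentiating
  convolutions, and reflected translates as test functions for moving derivatives onto weak
  ones.\<close>

lemma mollifier_exists:
  assumes r: "r > 0"
  obtains \<kappa> :: "'a::euclidean_space \<Rightarrow> real" and G H where
    "is_mollifier \<kappa> r" "C2_on UNIV \<kappa> G H" "\<And>x. test_fun (\<lambda>y. \<kappa> (x - y))"
proof -
  define p1 p2 :: "real poly" where "p1 = [:0, 0, 1:] * (1 - pderiv 1)" and "p2 = [:0, 0, 1:] * (p1 - pderiv p1)"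
  define c where "c = (LINT x|lebesgue. bump (0::'a) r x)"
  let ?f = "\<lambda>t. flat_exp 1 (1 - t / r\<^sup>2) / c"
  let ?fd = "\<lambda>t. flat_exp p1 (1 - t / r\<^sup>2) * (- (1 / r\<^sup>2)) / c"
  let ?fdd = "\<lambda>t. flat_exp p2 (1 - t / r\<^sup>2) * (- (1 / r\<^sup>2)) * (- (1 / r\<^sup>2)) / c"
  let ?G = "\<lambda>x::'a. ?fd ((norm (x - 0))\<^sup>2) *\<^sub>R (2 *\<^sub>R (x - 0))"
  let ?H = "\<lambda>x h::'a. ?fd ((norm (x - 0))\<^sup>2) *\<^sub>R (2 *\<^sub>R h) + (?fdd ((norm (x - 0))\<^sup>2) * ((2 *\<^sub>R (x - 0)) \<bullet> h)) *\<^sub>R (2 *\<^sub>R (x - 0))"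
  have di: "((\<lambda>t. 1 - t / r\<^sup>2) has_field_derivative - (1 / r\<^sup>2)) (at t)" for t
    using r by (auto intro!: derivative_eq_intros simp: power2_eq_square eval_nat_numeral)
  have d1: "(?f has_field_derivative ?fd t) (at t)" for t
    unfolding p1_def by (rule DERIV_cdivide[OF DERIV_chain2[OF DERIV_flat_exp di]])
  have d2: "(?fd has_field_derivative ?fdd t) (at t)" for t
    unfolding p2_def by (rule DERIV_cdivide[OF DERIV_cmult_right[OF DERIV_chain2[OF DERIV_flat_exp di]]])
  have cflat: "continuous_on UNIV (flat_exp p)" for p
    by (intro continuous_at_imp_continuous_on ballI DERIV_isCont[OF DERIV_flat_exp])
  have cdd: "continuous_on A ?fdd" for A
    unfolding divide_inverse
    by (intro continuous_intros continuous_on_compose2[OF cflat]) auto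
  have C: "C2_on UNIV (\<lambda>x. ?f ((norm (x - 0))\<^sup>2)) ?G ?H"
    by (rule C2_on_compose[OF C2_on_norm_square d1 d2 cdd])
  have bc: "continuous_on UNIV (bump (0::'a) r)"
    unfolding bump_def[abs_def] using r
    by (intro continuous_on_compose2[OF cflat] continuous_intros) auto
  have b0: "bump 0 r x = 0" if "norm x > r" for x :: 'a using bump_eq_0[OF r, of x 0] that by simp
  have bi: "integrable lebesgue (bump (0::'a) r)"
    by (rule integrable_compact_support[of "cball 0 r"]) (use bc b0 in \<open>auto intro: continuous_on_subset\<close>)
  \<comment> \<open>A vanishing integral would make the bump zero almost everywhere, yet it is
    positive on a ball, which is not negligible.\<close>
  have c: "c > 0"
  proof (rule ccontr)
    assume "\<not> c > 0"
    moreover have "c \<ge> 0" unfolding c_def by (rule integral_nonneg_AE) (simp add: bump_nonneg)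
    ultimately have "c = 0" by simp
    then have "AE x in lebesgue. bump (0::'a) r x = 0"
      unfolding c_def by (subst (asm) integral_nonneg_eq_0_iff_AE[OF bi]) (auto simp: bump_nonneg)
    then have "AE x in lebesgue. x \<notin> ball (0::'a) r"
      by eventually_elim (use bump_pos[of _ 0 r] in force)
    then have "negligible (ball (0::'a) r)"
      unfolding negligible_iff_null_sets by (subst (asm) AE_iff_null_sets[symmetric]) auto
    then show False using r by (simp add: open_not_negligible)
  qed
  define \<kappa> where "\<kappa> x = bump (0::'a) r x / c" for x
  have \<kappa>f: "\<kappa> = (\<lambda>x. ?f ((norm (x - 0))\<^sup>2))" unfolding \<kappa>_def bump_def by simp
  have "is_mollifier \<kappa> r"
    unfolding is_mollifier_def \<kappa>_def using c r b0 bc bump_nonneg[of 0 r]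
    by (auto intro!: continuous_intros divide_nonneg_pos simp: c_def[symmetric])
  moreover have "test_fun (\<lambda>y. \<kappa> (x - y))" for x
  proof -
    have "test_fun (\<lambda>y. (1 / c) * bump x r y)"
      by (rule test_fun_polynomial_bump[OF real_polynomial_function.intros(2) r])
    then show ?thesis unfolding \<kappa>_def by (simp add: bump_def norm_minus_commute)
  qed
  ultimately show thesis using that C unfolding \<kappa>f by blast
qed

lemma C2_on_conv:
  fixes \<kappa> :: "'a::euclidean_space \<Rightarrow> real"
  assumes g: "loc_integrable g" and C: "C2_on UNIV \<kappa> G H" and supp: "\<And>x. norm x > r \<Longrightarrow> \<kappa> x = 0"
  shows "C2_on UNIV (\<lambda>x. LINT y|lebesgue. g y * \<kappa> (x - y)) (\<lambda>x. LINT y|lebesgue. g y *\<^sub>R G (x - y))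
     (\<lambda>x h. LINT y|lebesgue. g y *\<^sub>R H (x - y) h)"
proof -
  note D = C2_onD[OF C, simplified]
  have s: "G x = 0" "H x h = 0" if "norm x > r" for x h
    using C2_on_support[OF C closed_cball[of 0 r], of x] supp that by auto
  have iG: "integrable lebesgue (\<lambda>y. g y *\<^sub>R G (x - y))" for x
    by (rule integrable_conv[OF g D(6) s(1)])
  have iH: "integrable lebesgue (\<lambda>y. g y *\<^sub>R H (x - y) h)" for x h
    by (rule integrable_conv[OF g D(4) s(2)])
  have iHk: "(LINT y|lebesgue. g y *\<^sub>R H (x - y) h) \<bullet> k = (LINT y|lebesgue. g y * (H (x - y) h \<bullet> k))" for x h k
    using iH by (simp flip: integral_inner_left)
  show ?thesis
    unfolding C2_on_def
  proof (intro conjI ballI allI)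
    fix x :: 'a
    have "((\<lambda>x. LINT y|lebesgue. g y *\<^sub>R \<kappa> (x - y)) has_derivative (\<lambda>h. LINT y|lebesgue. g y *\<^sub>R (G (x - y) \<bullet> h))) (at x)"
      by (rule conv_has_derivative[OF g D(1) _ supp]) (intro continuous_intros D)
    moreover have "(LINT y|lebesgue. g y *\<^sub>R (G (x - y) \<bullet> h)) = (LINT y|lebesgue. g y *\<^sub>R G (x - y)) \<bullet> h" for h
      using iG by (simp flip: integral_inner_left)
    ultimately show "((\<lambda>x. LINT y|lebesgue. g y * \<kappa> (x - y)) has_derivative (\<lambda>h. (LINT y|lebesgue. g y *\<^sub>R G (x - y)) \<bullet> h)) (at x)"
      by simp
    show "((\<lambda>x. LINT y|lebesgue. g y *\<^sub>R G (x - y)) has_derivative (\<lambda>h. LINT y|lebesgue. g y *\<^sub>R H (x - y) h)) (at x)"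
      by (rule conv_has_derivative[OF g D(2) D(4) s(1)])
    show "(LINT y|lebesgue. g y *\<^sub>R H (x - y) h) \<bullet> k = (LINT y|lebesgue. g y *\<^sub>R H (x - y) k) \<bullet> h" for h k
      unfolding iHk using D(3)[of "x - y" h k for y] by simp
  next
    fix h
    show "continuous_on UNIV (\<lambda>x. LINT y|lebesgue. g y *\<^sub>R H (x - y) h)"
      by (rule conv_continuous[OF g D(4) s(2)])
  qed
qed

text \<open>Reflection costs one sign per derivative: the gradient changes sign, the Hessian does
  not. The first sign cancels the one in the definition of a weak derivative.\<close>

lemma partial_reflect:
  assumes C: "C2_on UNIV \<kappa> G H"
  shows "partial b (\<lambda>y. \<kappa> (x - y)) = (\<lambda>y. - (G (x - y) \<bullet> b))"
    and "partial b (partial b (\<lambda>y. \<kappa> (x - y))) = (\<lambda>y. H (x - y) b \<bullet> b)"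
proof -
  note D = C2_onD[OF C, simplified]
  have l: "((\<lambda>y. x - y) has_derivative (\<lambda>h. - h)) (at y)" for y by (auto intro!: derivative_eq_intros)
  show 1: "partial b (\<lambda>y. \<kappa> (x - y)) = (\<lambda>y. - (G (x - y) \<bullet> b))"
    using partial_eq[OF has_derivative_compose[OF l D(1)], of b] by (simp add: fun_eq_iff)
  have "((\<lambda>y. - (G (x - y) \<bullet> b)) has_derivative (\<lambda>h. - (H (x - y) (- h) \<bullet> b))) (at y)" for y
    by (intro has_derivative_minus has_derivative_inner_left has_derivative_compose[OF l D(2)])
  from partial_eq[OF this, of b] show "partial b (partial b (\<lambda>y. \<kappa> (x - y))) = (\<lambda>y. H (x - y) b \<bullet> b)"
    unfolding 1 using D(7) by (simp add: fun_eq_iff linear_neg)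
qed

text \<open>The weak derivatives behind \<open>L\<close> need not be the square integrable ones that
  \<open>W22\<close> provides. Both second derivatives have the same pairings with test functions,
  since each equals the pairing of \<open>\<psi>\<close> with the second partial derivative;
  uniqueness identifies them almost everywhere, and \<open>L\<close> inherits measurability and
  integrability.\<close>

lemma L2_Laplacian:
  fixes \<psi> :: "'a::euclidean_space \<Rightarrow> real"
  assumes W: "W22 \<psi>" and L: "is_laplacian \<psi> L"
  obtains g h where "L2 \<psi>" "\<And>b. b \<in> Basis \<Longrightarrow> L2 (g b)" "\<And>b. b \<in> Basis \<Longrightarrow> weak_deriv \<psi> b (g b)"
    "\<And>b. b \<in> Basis \<Longrightarrow> L2 (h b)" "\<And>b. b \<in> Basis \<Longrightarrow> weak_deriv (g b) b (h b)"
    "L2 L" "AE x in lebesgue. L x = (\<Sum>b\<in>Basis. h b x)"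
proof -
  have "\<forall>b\<in>Basis. \<exists>g h. L2 g \<and> weak_deriv \<psi> b g \<and> L2 h \<and> weak_deriv g b h"
    using W unfolding W22_def by blast
  then obtain g h where gh: "\<And>b. b \<in> Basis \<Longrightarrow> L2 (g b) \<and> weak_deriv \<psi> b (g b) \<and> L2 (h b) \<and> weak_deriv (g b) b (h b)"
    by metis
  obtain D1 D2 where D: "\<And>b. b \<in> Basis \<Longrightarrow> weak_deriv \<psi> b (D1 b) \<and> weak_deriv (D1 b) b (D2 b)"
    "\<And>x. L x = (\<Sum>b\<in>Basis. D2 b x)"
    using L unfolding is_laplacian_def by blast
  have "AE x in lebesgue. h b x - D2 b x = 0" if b: "b \<in> Basis" for b
  proof (rule AE_zero_if_orthogonal_to_test_funs)
    fix \<phi> :: "'a \<Rightarrow> real" assume t: "test_fun \<phi>"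
    have i: "integrable lebesgue (\<lambda>x. h b x * \<phi> x)" "integrable lebesgue (\<lambda>x. D2 b x * \<phi> x)"
      using weak_deriv_integral(1)[OF _ t] gh[OF b] D(1)[OF b] by blast+
    then show "integrable lebesgue (\<lambda>x. (h b x - D2 b x) * \<phi> x)" by (simp add: left_diff_distrib)
    have "(LINT x|lebesgue. h b x * \<phi> x) = (LINT x|lebesgue. D2 b x * \<phi> x)"
    proof -
      have w: "weak_deriv \<psi> b (g b)" "weak_deriv (g b) b (h b)" "weak_deriv \<psi> b (D1 b)" "weak_deriv (D1 b) b (D2 b)"
        using gh[OF b] D(1)[OF b] by auto
      show ?thesis using weak_deriv_twice[OF w(1,2) t b] weak_deriv_twice[OF w(3,4) t b] by simp
    qed
    then show "(LINT x|lebesgue. (h b x - D2 b x) * \<phi> x) = 0" using i by (simp add: left_diff_distrib)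
  qed
  then have "AE x in lebesgue. \<forall>b\<in>Basis. h b x - D2 b x = 0" by (intro AE_finite_allI) auto
  then have ae: "AE x in lebesgue. L x = (\<Sum>b\<in>Basis. h b x)"
    by eventually_elim (auto simp: D(2) intro!: sum.cong)
  have L2h: "L2 (\<lambda>x. \<Sum>b\<in>Basis. h b x)" using gh by (intro L2_sum) auto
  obtain N where N: "N \<in> null_sets lebesgue" "{x. L x \<noteq> (\<Sum>b\<in>Basis. h b x)} \<subseteq> N"
    using ae unfolding eventually_ae_filter by auto
  have "(\<lambda>x. \<Sum>b\<in>Basis. h b x) measurable_on UNIV"
    using L2h unfolding L2_def by (intro lebesgue_measurable_imp_measurable_on) auto
  then have "L measurable_on UNIV"
    by (rule measurable_on_spike[where S = N]) (use N in \<open>auto simp: negligible_iff_null_sets\<close>)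
  then have Lm: "L \<in> borel_measurable lebesgue" by (rule measurable_on_imp_borel_measurable_lebesgue_UNIV)
  have "L2 L" unfolding L2_def
  proof (rule conjI[OF Lm])
    show "integrable lebesgue (\<lambda>x. (L x)\<^sup>2)"
    proof (rule integrable_cong_AE_imp)
      show "integrable lebesgue (\<lambda>x. (\<Sum>b\<in>Basis. h b x)\<^sup>2)" using L2h unfolding L2_def by simp
      show "AE x in lebesgue. (\<Sum>b\<in>Basis. h b x)\<^sup>2 = (L x)\<^sup>2" using ae by eventually_elim simp
    qed (use Lm in simp)
  qed
  moreover have "L2 \<psi>" using W unfolding W22_def by simp
  ultimately show thesis by (intro that[of g h, OF _ _ _ _ _ _ ae]) (use gh in auto)
qed

text \<open>The reflected kernel is a test function, so the classical derivatives of the convolution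
  are the mollified weak derivatives. In particular its Laplacian is the mollified \<open>L\<close>,
  and both required limits follow from mollification in L2. The gradient bound is kept for the
  cutoff step.\<close>

lemma W22_C2_approx:
  fixes \<psi> :: "'a::euclidean_space \<Rightarrow> real"
  assumes W: "W22 \<psi>" and L: "is_laplacian \<psi> L" and e: "e > 0"
  obtains u G H where "C2_on UNIV u G H" "L2 u" "L2 (\<lambda>x. norm (G x))" "L2 (\<lambda>x. trace_map (H x))"
    "L2norm_sq (\<lambda>x. u x - \<psi> x) < e" "L2norm_sq (\<lambda>x. trace_map (H x) - L x) < e"
proof -
  obtain g h where g: "L2 \<psi>" "\<And>b. b \<in> Basis \<Longrightarrow> L2 (g b)" "\<And>b. b \<in> Basis \<Longrightarrow> weak_deriv \<psi> b (g b)"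
    "\<And>b. b \<in> Basis \<Longrightarrow> L2 (h b)" "\<And>b. b \<in> Basis \<Longrightarrow> weak_deriv (g b) b (h b)"
    and L2L: "L2 L" and ae: "AE x in lebesgue. L x = (\<Sum>b\<in>Basis. h b x)"
    by (rule L2_Laplacian[OF W L]) blast
  obtain d1 where d1: "d1 > 0" "\<And>\<kappa> r. is_mollifier \<kappa> r \<Longrightarrow> r < d1 \<Longrightarrow> L2norm_sq (\<lambda>x. (LINT y|lebesgue. \<psi> y * \<kappa> (x - y)) - \<psi> x) < e"
    by (rule conv_mollifier_close[OF g(1) e]) blast
  obtain d2 where d2: "d2 > 0" "\<And>\<kappa> r. is_mollifier \<kappa> r \<Longrightarrow> r < d2 \<Longrightarrow> L2norm_sq (\<lambda>x. (LINT y|lebesgue. L y * \<kappa> (x - y)) - L x) < e"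
    by (rule conv_mollifier_close[OF L2L e]) blast
  define r where "r = min d1 d2 / 2"
  have r: "r > 0" "r < d1" "r < d2" unfolding r_def using d1(1) d2(1) by auto
  obtain \<kappa> :: "'a \<Rightarrow> real" and G H where \<kappa>: "is_mollifier \<kappa> r" "C2_on UNIV \<kappa> G H" "\<And>x. test_fun (\<lambda>y. \<kappa> (x - y))"
    by (rule mollifier_exists[OF r(1)]) blast
  note k = is_mollifierD[OF \<kappa>(1)]
  note D = C2_onD[OF \<kappa>(2), simplified]
  have \<psi>l: "loc_integrable \<psi>" by (rule L2_imp_loc_integrable[OF g(1)])
  note C = C2_on_conv[OF \<psi>l \<kappa>(2) k(3)]
  let ?u = "\<lambda>x. LINT y|lebesgue. \<psi> y * \<kappa> (x - y)"
  let ?G = "\<lambda>x. LINT y|lebesgue. \<psi> y *\<^sub>R G (x - y)"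
  let ?H = "\<lambda>x h. LINT y|lebesgue. \<psi> y *\<^sub>R H (x - y) h"
  have s: "G x = 0" "H x h = 0" if "norm x > r" for x h
    using C2_on_support[OF \<kappa>(2) closed_cball[of 0 r], of x] k(3) that by auto
  have Gb: "?G x \<bullet> b = (LINT y|lebesgue. g b y * \<kappa> (x - y))" if b: "b \<in> Basis" for x b
  proof -
    have "?G x \<bullet> b = (LINT y|lebesgue. \<psi> y * (G (x - y) \<bullet> b))"
      using integrable_conv[OF \<psi>l D(6) s(1)] by (simp flip: integral_inner_left)
    also have "\<dots> = - (LINT y|lebesgue. \<psi> y * partial b (\<lambda>y. \<kappa> (x - y)) y)"
      unfolding partial_reflect(1)[OF \<kappa>(2)] by simp
    also have "\<dots> = (LINT y|lebesgue. g b y * \<kappa> (x - y))"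
      using weak_deriv_integral(2)[OF g(3)[OF b] \<kappa>(3)] by simp
    finally show ?thesis .
  qed
  have Hb: "?H x b \<bullet> b = (LINT y|lebesgue. h b y * \<kappa> (x - y))" if b: "b \<in> Basis" for x b
  proof -
    have "?H x b \<bullet> b = (LINT y|lebesgue. \<psi> y * (H (x - y) b \<bullet> b))"
      using integrable_conv[OF \<psi>l D(4) s(2)] by (simp flip: integral_inner_left)
    also have "\<dots> = (LINT y|lebesgue. \<psi> y * partial b (partial b (\<lambda>y. \<kappa> (x - y))) y)"
      unfolding partial_reflect(2)[OF \<kappa>(2)] by simp
    also have "\<dots> = (LINT y|lebesgue. h b y * \<kappa> (x - y))"
      by (rule weak_deriv_twice[OF g(3)[OF b] g(5)[OF b] \<kappa>(3) b])
    finally show ?thesis .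
  qed
  have ih: "integrable lebesgue (\<lambda>y. f y * \<kappa> (x - y))" if "L2 f" for f x
    using integrable_conv[OF L2_imp_loc_integrable[OF that] k(1) k(3)] by simp
  have T: "trace_map (?H x) = (LINT y|lebesgue. L y * \<kappa> (x - y))" for x
  proof -
    have "trace_map (?H x) = (\<Sum>b\<in>Basis. LINT y|lebesgue. h b y * \<kappa> (x - y))"
      unfolding trace_map_def by (intro sum.cong refl Hb)
    also have "\<dots> = (LINT y|lebesgue. (\<Sum>b\<in>Basis. h b y * \<kappa> (x - y)))"
      by (intro Bochner_Integration.integral_sum[symmetric] ih g)
    also have "\<dots> = (LINT y|lebesgue. L y * \<kappa> (x - y))"
    proof (rule integral_cong_AE)
      show "(\<lambda>y. \<Sum>b\<in>Basis. h b y * \<kappa> (x - y)) \<in> borel_measurable lebesgue"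
        by (intro borel_measurable_sum borel_measurable_integrable ih g)
      show "(\<lambda>y. L y * \<kappa> (x - y)) \<in> borel_measurable lebesgue"
        by (intro borel_measurable_integrable ih L2L)
      show "AE y in lebesgue. (\<Sum>b\<in>Basis. h b y * \<kappa> (x - y)) = L y * \<kappa> (x - y)"
        using ae by eventually_elim (simp add: sum_distrib_right)
    qed
    finally show ?thesis .
  qed
  have L2T: "L2 (\<lambda>x. trace_map (?H x))" unfolding T by (rule conv_mollifier_L2(1)[OF L2L \<kappa>(1)])
  have L2G: "L2 (\<lambda>x. norm (?G x))"
    unfolding L2_def
  proof
    show "(\<lambda>x. norm (?G x)) \<in> borel_measurable lebesgue"
      by (intro continuous_imp_lebesgue_measurable continuous_intros C2_onD(6)[OF C])
    have "(norm (?G x))\<^sup>2 = (\<Sum>b\<in>Basis. (LINT y|lebesgue. g b y * \<kappa> (x - y))\<^sup>2)" for x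
      unfolding power2_norm_eq_inner by (subst euclidean_inner) (simp add: Gb power2_eq_square)
    then show "integrable lebesgue (\<lambda>x. (norm (?G x))\<^sup>2)"
      using conv_mollifier_L2(1)[OF g(2) \<kappa>(1)] unfolding L2_def by simp
  qed
  show thesis
    by (rule that[OF C conv_mollifier_L2(1)[OF g(1) \<kappa>(1)] L2G L2T])
      (use d1(2)[OF \<kappa>(1) r(2)] d2(2)[OF \<kappa>(1) r(3)] T in auto)
qed

text \<open>The Laplacian of the cut off function differs from that of \<open>u\<close> by terms in
  \<open>u\<close>, \<open>\<nabla>u\<close> and \<open>\<Delta>u\<close>, all square integrable,
  whose coefficients are bounded uniformly and vanish on growing balls; dominated convergence
  finishes. The radii \<open>n + 1\<close> are at least 1, so one bound \<open>c\<close> holds for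
  all cutoffs.\<close>

lemma W22_C2_compact_approx:
  fixes \<psi> :: "'a::euclidean_space \<Rightarrow> real"
  assumes W: "W22 \<psi>" and L: "is_laplacian \<psi> L" and e: "e > 0"
  obtains u G H K where "C2_on UNIV u G H" "compact K" "\<And>x. x \<notin> K \<Longrightarrow> u x = 0"
    "L2 u" "L2 (\<lambda>x. trace_map (H x))"
    "L2norm_sq (\<lambda>x. u x - \<psi> x) < e" "L2norm_sq (\<lambda>x. trace_map (H x) - L x) < e"
proof -
  have L2\<psi>: "L2 \<psi>" using W unfolding W22_def by simp
  have L2L: "L2 L" by (rule L2_Laplacian[OF W L]) blast
  obtain u G H where C: "C2_on UNIV u G H" and u: "L2 u" "L2 (\<lambda>x. norm (G x))" "L2 (\<lambda>x. trace_map (H x))"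
    and close: "L2norm_sq (\<lambda>x. u x - \<psi> x) < e/4" "L2norm_sq (\<lambda>x. trace_map (H x) - L x) < e/4"
    by (rule W22_C2_approx[OF W L, of "e/4"]) (use e in auto)
  define c where "c = 6 * real DIM('a) + 128"
  have "\<forall>n. \<exists>\<eta> Ge He. C2_on UNIV \<eta> Ge He \<and> (\<forall>x::'a. 0 \<le> \<eta> x \<and> \<eta> x \<le> 1 \<and>
     (norm x \<le> real (Suc n) \<longrightarrow> \<eta> x = 0 \<and> Ge x = 0 \<and> trace_map (He x) = 0) \<and>
     (2 * real (Suc n) \<le> norm x \<longrightarrow> \<eta> x = 1) \<and> norm (Ge x) \<le> c \<and> \<bar>trace_map (He x)\<bar> \<le> c)"
  proof
    fix n
    obtain \<eta> Ge He where \<eta>: "C2_on UNIV \<eta> Ge He" "\<And>x. 0 \<le> \<eta> x" "\<And>x. \<eta> x \<le> 1"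
    "\<And>x::'a. norm (x - 0) \<le> real (Suc n) \<Longrightarrow> \<eta> x = 0" "\<And>x. 2 * real (Suc n) \<le> norm (x - 0) \<Longrightarrow> \<eta> x = 1"
    "\<And>x. norm (x - 0) \<le> real (Suc n) \<or> 2 * real (Suc n) \<le> norm (x - 0) \<Longrightarrow> Ge x = 0"
    "\<And>x. norm (x - 0) \<le> real (Suc n) \<or> 2 * real (Suc n) \<le> norm (x - 0) \<Longrightarrow> trace_map (He x) = 0"
    "\<And>x. norm (Ge x) \<le> c / real (Suc n)" "\<And>x. \<bar>trace_map (He x)\<bar> \<le> c / (real (Suc n))\<^sup>2"
      unfolding c_def by (rule cutoff_exists[of "real (Suc n)" 0]) auto
    have "c / real (Suc n) \<le> c / 1" "c / (real (Suc n))\<^sup>2 \<le> c / 1"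
      by (intro divide_left_mono one_le_power; simp add: c_def)+
    then have "norm (Ge x) \<le> c" "\<bar>trace_map (He x)\<bar> \<le> c" for x
      using \<eta>(8,9)[of x] by linarith+
    then show "\<exists>\<eta> Ge He. C2_on UNIV \<eta> Ge He \<and> (\<forall>x::'a. 0 \<le> \<eta> x \<and> \<eta> x \<le> 1 \<and>
       (norm x \<le> real (Suc n) \<longrightarrow> \<eta> x = 0 \<and> Ge x = 0 \<and> trace_map (He x) = 0) \<and>
       (2 * real (Suc n) \<le> norm x \<longrightarrow> \<eta> x = 1) \<and> norm (Ge x) \<le> c \<and> \<bar>trace_map (He x)\<bar> \<le> c)"
      using \<eta> by (intro exI[of _ \<eta>] exI[of _ Ge] exI[of _ He]) auto
  qed
  then obtain \<eta> Ge He where \<eta>: "\<And>n. C2_on UNIV (\<eta> n) (Ge n) (He n)" "\<And>n x::'a. 0 \<le> \<eta> n x" "\<And>n x. \<eta> n x \<le> 1"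
    "\<And>n x. norm x \<le> real (Suc n) \<Longrightarrow> \<eta> n x = 0 \<and> Ge n x = 0 \<and> trace_map (He n x) = 0"
    "\<And>n x. 2 * real (Suc n) \<le> norm x \<Longrightarrow> \<eta> n x = 1"
    "\<And>n x. norm (Ge n x) \<le> c" "\<And>n x. \<bar>trace_map (He n x)\<bar> \<le> c"
    by metis
  define v where "v n x = u x * (1 - \<eta> n x)" for n x
  define Tv where "Tv n x = u x * - trace_map (He n x) + (1 - \<eta> n x) * trace_map (H x) - 2 * (G x \<bullet> Ge n x)" for n x
  note Cv = C2_on_mult[OF C C2_on_diff_const[OF \<eta>(1), of 1], folded v_def]
  have tv: "trace_map (\<lambda>h. u x *\<^sub>R - He n x h + (1 - \<eta> n x) *\<^sub>R H x h + (G x \<bullet> h) *\<^sub>R - Ge n x + (- Ge n x \<bullet> h) *\<^sub>R G x) = Tv n x" for n x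
    unfolding trace_map_simps Tv_def by (simp add: inner_commute)
  have mv: "v n \<in> borel_measurable lebesgue" for n
    by (rule continuous_imp_lebesgue_measurable[OF C2_onD(5)[OF Cv]])
  have mT: "Tv n \<in> borel_measurable lebesgue" for n
    using continuous_imp_lebesgue_measurable[OF C2_on_continuous_trace[OF Cv]] unfolding tv by simp
  have um: "u \<in> borel_measurable lebesgue" "(\<lambda>x. trace_map (H x)) \<in> borel_measurable lebesgue"
    using u unfolding L2_def by auto
  have ev: "\<forall>\<^sub>F n in sequentially. v n x = u x \<and> Tv n x = trace_map (H x)" for x
  proof -
    obtain N where N: "norm x < real N" using reals_Archimedean2 by blast
    have "v n x = u x \<and> Tv n x = trace_map (H x)" if "n \<ge> N" for n
    proof -
      have "norm x \<le> real (Suc n)" using N that by simp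
      then show ?thesis using \<eta>(4)[of x n] unfolding v_def Tv_def by simp
    qed
    then show ?thesis unfolding eventually_sequentially by blast
  qed
  have lim1: "(\<lambda>n. LINT x|lebesgue. (v n x - u x)\<^sup>2) \<longlonglongrightarrow> (LINT x|(lebesgue::'a measure). (0::real))"
  proof (rule integral_dominated_convergence[where w = "\<lambda>x. (u x)\<^sup>2"])
    show "AE x in lebesgue. (\<lambda>n. (v n x - u x)\<^sup>2) \<longlonglongrightarrow> 0"
      by (intro AE_I2 tendsto_eventually eventually_mono[OF ev]) auto
    have "(v n x - u x)\<^sup>2 \<le> (u x)\<^sup>2" for n x
    proof -
      have "(v n x - u x)\<^sup>2 = (u x)\<^sup>2 * (\<eta> n x)\<^sup>2" unfolding v_def by (simp add: power2_eq_square algebra_simps)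
      also have "\<dots> \<le> (u x)\<^sup>2 * 1" by (intro mult_left_mono power_le_one \<eta>) auto
      finally show ?thesis by simp
    qed
    then show "AE x in lebesgue. norm ((v n x - u x)\<^sup>2) \<le> (u x)\<^sup>2" for n by simp
  qed (use mv um u(1) in \<open>auto simp: L2_def\<close>)
  let ?w = "\<lambda>x. 2 * c\<^sup>2 * (u x)\<^sup>2 + 2 * (2 * (trace_map (H x))\<^sup>2 + 8 * c\<^sup>2 * (norm (G x))\<^sup>2)"
  have lim2: "(\<lambda>n. LINT x|lebesgue. (Tv n x - trace_map (H x))\<^sup>2) \<longlonglongrightarrow> (LINT x|(lebesgue::'a measure). (0::real))"
  proof (rule integral_dominated_convergence[where w = ?w])
    show "AE x in lebesgue. (\<lambda>n. (Tv n x - trace_map (H x))\<^sup>2) \<longlonglongrightarrow> 0"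
      by (intro AE_I2 tendsto_eventually eventually_mono[OF ev]) auto
    have "(Tv n x - trace_map (H x))\<^sup>2 \<le> ?w x" for n x
    proof -
      let ?a = "u x * - trace_map (He n x)" and ?b = "- (\<eta> n x * trace_map (H x))" and ?d = "- 2 * (G x \<bullet> Ge n x)"
      have "Tv n x - trace_map (H x) = ?a + (?b + ?d)" unfolding Tv_def by (simp add: algebra_simps)
      then have "(Tv n x - trace_map (H x))\<^sup>2 \<le> 2 * ?a\<^sup>2 + 2 * (2 * ?b\<^sup>2 + 2 * ?d\<^sup>2)"
        using sum_square_le[of ?a "?b + ?d"] sum_square_le[of ?b ?d] by simp
      moreover have "?a\<^sup>2 \<le> (u x)\<^sup>2 * c\<^sup>2"
      proof -
        have "\<bar>trace_map (He n x)\<bar>\<^sup>2 \<le> c\<^sup>2" by (intro power_mono \<eta>) auto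
        then show ?thesis by (simp add: power_mult_distrib mult_left_mono)
      qed
      moreover have "?b\<^sup>2 \<le> 1 * (trace_map (H x))\<^sup>2"
        unfolding power2_minus power_mult_distrib by (intro mult_right_mono power_le_one \<eta>) auto
      moreover have "?d\<^sup>2 \<le> 4 * ((norm (G x))\<^sup>2 * c\<^sup>2)"
      proof -
        have "(G x \<bullet> Ge n x)\<^sup>2 \<le> (norm (G x))\<^sup>2 * (norm (Ge n x))\<^sup>2"
          using Cauchy_Schwarz_ineq[of "G x" "Ge n x"] by (simp add: power2_norm_eq_inner)
        also have "\<dots> \<le> (norm (G x))\<^sup>2 * c\<^sup>2" by (intro mult_left_mono power_mono \<eta>) auto
        finally show ?thesis by (simp add: power_mult_distrib)
      qed
      moreover have "q \<le> 2 * a' + 2 * (2 * b' + 2 * d')" if "q \<le> 2 * a + 2 * (2 * b + 2 * d)" "a \<le> a'" "b \<le> b'" "d \<le> d'"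
        for q a b d a' b' d' :: real using that by argo
      ultimately have "(Tv n x - trace_map (H x))\<^sup>2 \<le> 2 * ((u x)\<^sup>2 * c\<^sup>2) + 2 * (2 * (1 * (trace_map (H x))\<^sup>2) + 2 * (4 * ((norm (G x))\<^sup>2 * c\<^sup>2)))"
        by blast
      then show ?thesis by (simp add: mult_ac)
    qed
    then show "AE x in lebesgue. norm ((Tv n x - trace_map (H x))\<^sup>2) \<le> ?w x" for n by simp
    show "integrable lebesgue ?w"
      using u unfolding L2_def by (intro Bochner_Integration.integrable_add integrable_mult_right) auto
  qed (use mT um in auto)
  have "\<forall>\<^sub>F n in sequentially. (LINT x|lebesgue. (v n x - u x)\<^sup>2) < e/4 \<and> (LINT x|lebesgue. (Tv n x - trace_map (H x))\<^sup>2) < e/4"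
    using order_tendstoD(2)[OF lim1, of "e/4"] order_tendstoD(2)[OF lim2, of "e/4"] e by (intro eventually_conj) auto
  then obtain n where n: "L2norm_sq (\<lambda>x. v n x - u x) < e/4" "L2norm_sq (\<lambda>x. Tv n x - trace_map (H x)) < e/4"
    unfolding L2norm_sq_def by (auto simp: eventually_sequentially)
  have v0: "v n x = 0" if "x \<notin> cball 0 (2 * real (Suc n))" for x
    using \<eta>(5)[of n x] that unfolding v_def by simp
  have Tv0: "Tv n x = 0" if "x \<notin> cball 0 (2 * real (Suc n))" for x
    using C2_on_support(2)[OF Cv closed_cball v0 _ that] unfolding tv[symmetric] trace_map_def by simp
  have L2v: "L2 (v n)" "L2 (Tv n)"
    unfolding L2_def using mv mT v0 Tv0 C2_onD(5)[OF Cv, of n] C2_on_continuous_trace[OF Cv, of n] unfolding tv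
    by (auto intro!: integrable_compact_support[of "cball 0 (2 * real (Suc n))"] continuous_intros intro: continuous_on_subset)
  show thesis
  proof (rule that[OF Cv compact_cball v0 L2v(1)])
    show "L2 (\<lambda>x. trace_map (\<lambda>h. u x *\<^sub>R - He n x h + (1 - \<eta> n x) *\<^sub>R H x h + (G x \<bullet> h) *\<^sub>R - Ge n x + (- Ge n x \<bullet> h) *\<^sub>R G x))"
      unfolding tv by (rule L2v)
    have "L2norm_sq (\<lambda>x. (v n x - u x) + (u x - \<psi> x)) \<le> 2 * L2norm_sq (\<lambda>x. v n x - u x) + 2 * L2norm_sq (\<lambda>x. u x - \<psi> x)"
      by (intro L2norm_sq_add_le L2_diff L2v u L2\<psi>)
    then show "L2norm_sq (\<lambda>x. v n x - \<psi> x) < e" using n close by simp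
    have "L2norm_sq (\<lambda>x. (Tv n x - trace_map (H x)) + (trace_map (H x) - L x)) \<le> 2 * L2norm_sq (\<lambda>x. Tv n x - trace_map (H x)) + 2 * L2norm_sq (\<lambda>x. trace_map (H x) - L x)"
      by (intro L2norm_sq_add_le L2_diff L2v u L2L)
    then show "L2norm_sq (\<lambda>x. trace_map (\<lambda>h. u x *\<^sub>R - He n x h + (1 - \<eta> n x) *\<^sub>R H x h + (G x \<bullet> h) *\<^sub>R - Ge n x + (- Ge n x \<bullet> h) *\<^sub>R G x) - L x) < e"
      unfolding tv using n close by simp
  qed
qed

section \<open>Passage to the limit\<close>

text \<open>With \<open>a = f\<close> and \<open>b = F n - f\<close>, Young's inequality bounds
  \<open>|2 a b + b^2|\<close> by \<open>t a^2 + (1 + 1/t) b^2\<close>. The first part is made small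
  by the choice of \<open>t\<close>, the second by the convergence.\<close>

lemma L2norm_sq_tendsto:
  fixes f :: "'a::euclidean_space \<Rightarrow> real"
  assumes f: "L2 f" and fn: "\<And>n. L2 (F n)" and lim: "(\<lambda>n. L2norm_sq (\<lambda>x. F n x - f x)) \<longlonglongrightarrow> 0"
  shows "(\<lambda>n. L2norm_sq (F n)) \<longlonglongrightarrow> L2norm_sq f"
proof (rule LIMSEQ_I)
  fix e :: real assume e: "e > 0"
  define t where "t = e / (2 * (L2norm_sq f + 1))"
  have t: "t > 0" unfolding t_def using e L2norm_sq_nonneg[of f] by simp
  have tf: "t * L2norm_sq f < e / 2"
    unfolding t_def using e L2norm_sq_nonneg[of f] by (simp add: field_simps)
  have le: "\<bar>L2norm_sq (F n) - L2norm_sq f\<bar> \<le> t * L2norm_sq f + (1 + 1 / t) * L2norm_sq (\<lambda>x. F n x - f x)" for n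
  proof -
    have i: "integrable lebesgue (\<lambda>x. (F n x)\<^sup>2)" "integrable lebesgue (\<lambda>x. (f x)\<^sup>2)" "integrable lebesgue (\<lambda>x. (F n x - f x)\<^sup>2)"
      using fn[of n] f L2_diff[OF fn[of n] f] unfolding L2_def by auto
    have "\<bar>L2norm_sq (F n) - L2norm_sq f\<bar> = \<bar>LINT x|lebesgue. (F n x)\<^sup>2 - (f x)\<^sup>2\<bar>"
      unfolding L2norm_sq_def using i by simp
    also have "\<dots> \<le> (LINT x|lebesgue. t * (f x)\<^sup>2 + (1 + 1 / t) * (F n x - f x)\<^sup>2)"
    proof (rule Bochner_Integration.integral_norm_bound_integral[where f = "\<lambda>x. (F n x)\<^sup>2 - (f x)\<^sup>2", unfolded real_norm_def])
      fix x
      define a b where "a = f x" and "b = F n x - f x"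
      have "0 \<le> (sqrt t * \<bar>a\<bar> - \<bar>b\<bar> / sqrt t)\<^sup>2" by simp
      also have "\<dots> = t * a\<^sup>2 - 2 * \<bar>a * b\<bar> + b\<^sup>2 / t"
        using t by (simp add: power2_diff power_mult_distrib power_divide abs_mult)
      finally have "2 * \<bar>a * b\<bar> \<le> t * a\<^sup>2 + b\<^sup>2 / t" by simp
      moreover have "(1 + 1 / t) * b\<^sup>2 = b\<^sup>2 + b\<^sup>2 / t" by (simp add: distrib_right)
      moreover have "\<bar>2 * (a * b) + b\<^sup>2\<bar> \<le> 2 * \<bar>a * b\<bar> + b\<^sup>2" using abs_triangle_ineq[of "2 * (a * b)" "b\<^sup>2"] by (simp add: abs_mult)
      ultimately have "\<bar>2 * (a * b) + b\<^sup>2\<bar> \<le> t * a\<^sup>2 + (1 + 1 / t) * b\<^sup>2" by linarith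
      moreover have "(F n x)\<^sup>2 - (f x)\<^sup>2 = 2 * (a * b) + b\<^sup>2"
        unfolding a_def b_def by (simp add: power2_eq_square algebra_simps)
      ultimately show "\<bar>(F n x)\<^sup>2 - (f x)\<^sup>2\<bar> \<le> t * (f x)\<^sup>2 + (1 + 1 / t) * (F n x - f x)\<^sup>2"
        unfolding a_def b_def by simp
    qed (use i in auto)
    also have "\<dots> = t * L2norm_sq f + (1 + 1 / t) * L2norm_sq (\<lambda>x. F n x - f x)"
      unfolding L2norm_sq_def
      by (intro has_bochner_integral_integral_eq has_bochner_integral_add has_bochner_integral_mult_right has_bochner_integral_integrable i)
    finally show ?thesis .
  qed
  have "(\<lambda>n. (1 + 1 / t) * L2norm_sq (\<lambda>x. F n x - f x)) \<longlonglongrightarrow> (1 + 1 / t) * 0"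
    by (intro tendsto_intros lim)
  then have "\<forall>\<^sub>F n in sequentially. (1 + 1 / t) * L2norm_sq (\<lambda>x. F n x - f x) < e / 2"
    using e by (intro order_tendstoD(2)) auto
  then obtain N where N: "\<And>n. n \<ge> N \<Longrightarrow> (1 + 1 / t) * L2norm_sq (\<lambda>x. F n x - f x) < e / 2"
    unfolding eventually_sequentially by blast
  show "\<exists>no. \<forall>n\<ge>no. norm (L2norm_sq (F n) - L2norm_sq f) < e"
  proof (intro exI[of _ N] allI impI)
    fix n assume "N \<le> n"
    from N[OF this] show "norm (L2norm_sq (F n) - L2norm_sq f) < e" using le[of n] tf unfolding real_norm_def by linarith
  qed
qed

text \<open>The essential supremum is an extended real. Boundedness of \<open>V\<close> makes it
  finite, so the conversion to a real loses nothing; it is nonnegative because Lebesgue measure is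
  not zero.\<close>

lemma Linf_norm_bound:
  fixes V :: "'a::euclidean_space \<Rightarrow> real"
  assumes V: "V \<in> borel_measurable lebesgue" "\<And>x. \<bar>V x\<bar> \<le> B"
  shows "AE x in lebesgue. \<bar>V x\<bar> \<le> Linf_norm V" "Linf_norm V \<ge> 0"
proof -
  let ?s = "esssup lebesgue (\<lambda>x. ereal \<bar>V x\<bar>)"
  have ae: "AE x in lebesgue. ereal \<bar>V x\<bar> \<le> ?s" by (rule esssup_AE)
  have m: "(\<lambda>x. ereal \<bar>V x\<bar>) \<in> borel_measurable lebesgue" using V(1) by measurable
  have le: "?s \<le> ereal B" by (rule esssup_I[OF m]) (simp add: V(2))
  have "?s \<ge> 0"
  proof -
    have "AE x in (lebesgue::'a measure). 0 \<le> ?s"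
      using ae by eventually_elim (meson abs_ge_zero ereal_less_eq(5) order_trans)
    moreover have "\<not> (AE x in (lebesgue::'a measure). False)"
      unfolding eventually_False ae_filter_eq_bot_iff by (simp add: emeasure_lborel_UNIV)
    ultimately show ?thesis by (metis (mono_tags, lifting) eventually_mono)
  qed
  then obtain s where s: "?s = ereal s" "s \<ge> 0" using le by (cases ?s) auto
  show "AE x in lebesgue. \<bar>V x\<bar> \<le> Linf_norm V" using ae unfolding Linf_norm_def s by simp
  show "Linf_norm V \<ge> 0" unfolding Linf_norm_def s using s by simp
qed

lemma L2_mult_bounded:
  fixes V f :: "'a::euclidean_space \<Rightarrow> real"
  assumes V: "V \<in> borel_measurable lebesgue" "\<And>x. \<bar>V x\<bar> \<le> B" and f: "L2 f"
  shows "L2 (\<lambda>x. V x * f x)" "L2norm_sq (\<lambda>x. V x * f x) \<le> B\<^sup>2 * L2norm_sq f"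
proof -
  have i: "integrable lebesgue (\<lambda>x. B\<^sup>2 * (f x)\<^sup>2)" using f unfolding L2_def by simp
  have m: "(\<lambda>x. V x * f x) \<in> borel_measurable lebesgue" using V(1) f unfolding L2_def by auto
  have b: "(V x * f x)\<^sup>2 \<le> B\<^sup>2 * (f x)\<^sup>2" for x
  proof -
    have "\<bar>V x\<bar>\<^sup>2 \<le> B\<^sup>2" by (intro power_mono V) auto
    then show ?thesis by (simp add: power_mult_distrib mult_right_mono)
  qed
  have i2: "integrable lebesgue (\<lambda>x. (V x * f x)\<^sup>2)"
    by (rule Bochner_Integration.integrable_bound[OF i]) (use m b in auto)
  then show "L2 (\<lambda>x. V x * f x)" unfolding L2_def using m by simp
  have "L2norm_sq (\<lambda>x. V x * f x) \<le> (LINT x|lebesgue. B\<^sup>2 * (f x)\<^sup>2)"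
    unfolding L2norm_sq_def by (rule integral_mono[OF i2 i b])
  then show "L2norm_sq (\<lambda>x. V x * f x) \<le> B\<^sup>2 * L2norm_sq f" unfolding L2norm_sq_def by simp
qed

text \<open>Every term of the inequality is continuous under L2 convergence of the function and its
  Laplacian: multiplication by the indicator and by the bounded \<open>V\<close> are bounded
  operators. As \<open>K1\<close> and the factor \<open>c\<close> do not depend on the
  approximation, the estimate passes to the limit.\<close>

theorem theorem5:
  shows "\<exists>K1::real. K1 \<ge> 1 \<and>
    (\<forall>(M::real) (\<delta>::real) (Z::'a::euclidean_space \<Rightarrow> 'a) (V::'a \<Rightarrow> real) (\<psi>::'a \<Rightarrow> real) (L::'a \<Rightarrow> real).
       M > 0 \<longrightarrow> 0 < \<delta> \<longrightarrow> \<delta> < M / 2 \<longrightarrow> equidistributed M \<delta> Z \<longrightarrow>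
       V \<in> borel_measurable lebesgue \<longrightarrow> bounded (range V) \<longrightarrow>
       W22 \<psi> \<longrightarrow> is_laplacian \<psi> L \<longrightarrow>
       (\<delta> / M) powr (K1 * (1 + M powr (4/3) * Linf_norm V powr (2/3))) * L2norm_sq \<psi>
         \<le> L2norm_sq (\<lambda>x. indicator (S_set M \<delta> Z) x * \<psi> x)
           + \<delta>\<^sup>2 * M\<^sup>2 * L2norm_sq (\<lambda>x. - L x + V x * \<psi> x))"
proof (rule unique_continuation_C2_compact[where 'a = 'a])
  fix K1 :: real
  assume K1: "K1 \<ge> 1" and main: "\<And>M \<delta> Z N (u :: 'a \<Rightarrow> real) G H K \<zeta>.
       \<lbrakk>M > 0; 0 < \<delta>; \<delta> < M / 2; equidistributed M \<delta> Z; N \<ge> 0;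
        C2_on UNIV u G H; compact K; \<And>x. x \<notin> K \<Longrightarrow> u x = 0;
        integrable lebesgue (\<lambda>x. (\<zeta> x)\<^sup>2);
        AE x in lebesgue. \<bar>trace_map (H x)\<bar> \<le> N * \<bar>u x\<bar> + \<bar>\<zeta> x\<bar>\<rbrakk>
       \<Longrightarrow> (\<delta> / M) powr (K1 * (1 + M powr (4/3) * N powr (2/3))) * (LINT x|lebesgue. (u x)\<^sup>2)
         \<le> (LINT x|lebesgue. indicator (S_set M \<delta> Z) x * (u x)\<^sup>2) + \<delta>\<^sup>2 * M\<^sup>2 * (LINT x|lebesgue. (\<zeta> x)\<^sup>2)"
  show ?thesis
  proof (intro exI[of _ K1] conjI K1 allI impI)
    fix M \<delta> :: real and Z :: "'a \<Rightarrow> 'a" and V \<psi> L :: "'a \<Rightarrow> real"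
    assume M: "M > 0" and \<delta>: "0 < \<delta>" "\<delta> < M / 2" and Z: "equidistributed M \<delta> Z"
      and V: "V \<in> borel_measurable lebesgue" "bounded (range V)" and W: "W22 \<psi>" and L: "is_laplacian \<psi> L"
    obtain B where B: "\<And>x. \<bar>V x\<bar> \<le> B" using V(2) unfolding bounded_iff by auto
    define N where "N = Linf_norm V"
    have N: "AE x in lebesgue. \<bar>V x\<bar> \<le> N" "N \<ge> 0" unfolding N_def by (rule Linf_norm_bound[OF V(1) B])+
    define S where "S = S_set M \<delta> Z"
    have "open S" unfolding S_def S_set_def by (intro open_UN) auto
    then have "S \<in> sets lebesgue" by simp
    then have S: "(indicator S :: 'a \<Rightarrow> real) \<in> borel_measurable lebesgue" by (rule borel_measurable_indicator)
    have L2\<psi>: "L2 \<psi>" using W unfolding W22_def by simp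
    have L2L: "L2 L" by (rule L2_Laplacian[OF W L]) blast
    define c where "c = (\<delta> / M) powr (K1 * (1 + M powr (4/3) * N powr (2/3)))"
    define P where "P n u T \<longleftrightarrow> L2 u \<and> L2 T \<and> L2norm_sq (\<lambda>x. u x - \<psi> x) < inverse (real (Suc n)) \<and>
        L2norm_sq (\<lambda>x. T x - L x) < inverse (real (Suc n)) \<and>
        c * L2norm_sq u \<le> L2norm_sq (\<lambda>x. indicator S x * u x) + \<delta>\<^sup>2 * M\<^sup>2 * L2norm_sq (\<lambda>x. - T x + V x * u x)"
      for n u T
    have "\<forall>n. \<exists>u T. P n u T"
    proof
      fix n
      obtain u G H K where u: "C2_on UNIV u G H" "compact K" "\<And>x. x \<notin> K \<Longrightarrow> u x = 0"
        "L2 u" "L2 (\<lambda>x. trace_map (H x))"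
        "L2norm_sq (\<lambda>x. u x - \<psi> x) < inverse (real (Suc n))" "L2norm_sq (\<lambda>x. trace_map (H x) - L x) < inverse (real (Suc n))"
        by (rule W22_C2_compact_approx[OF W L, of "inverse (real (Suc n))"]) auto
      \<comment> \<open>With this right-hand side the pointwise hypothesis is the triangle
        inequality, using the almost everywhere bound \<open>N\<close> on the potential.\<close>
      let ?\<zeta> = "\<lambda>x. - trace_map (H x) + V x * u x"
      have L2\<zeta>: "L2 ?\<zeta>"
        using L2_diff[OF L2_mult_bounded(1)[OF V(1) B u(4)] u(5)] by simp
      have "c * (LINT x|lebesgue. (u x)\<^sup>2)
         \<le> (LINT x|lebesgue. indicator (S_set M \<delta> Z) x * (u x)\<^sup>2) + \<delta>\<^sup>2 * M\<^sup>2 * (LINT x|lebesgue. (?\<zeta> x)\<^sup>2)"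
        unfolding c_def
      proof (rule main[OF M \<delta> Z N(2) u(1,2) _ _])
        show "x \<notin> K \<Longrightarrow> u x = 0" for x by (rule u(3))
        show "integrable lebesgue (\<lambda>x. (?\<zeta> x)\<^sup>2)" using L2\<zeta> unfolding L2_def by simp
        show "AE x in lebesgue. \<bar>trace_map (H x)\<bar> \<le> N * \<bar>u x\<bar> + \<bar>?\<zeta> x\<bar>"
          using N(1)
        proof eventually_elim
          fix x assume "\<bar>V x\<bar> \<le> N"
          then have "\<bar>V x * u x\<bar> \<le> N * \<bar>u x\<bar>" unfolding abs_mult by (intro mult_right_mono) auto
          then show "\<bar>trace_map (H x)\<bar> \<le> N * \<bar>u x\<bar> + \<bar>?\<zeta> x\<bar>" by linarith
        qed
      qed
      moreover have "(indicator S x * u x)\<^sup>2 = indicator S x * (u x)\<^sup>2" for x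
        by (simp add: indicator_def)
      ultimately have "c * L2norm_sq u \<le> L2norm_sq (\<lambda>x. indicator S x * u x) + \<delta>\<^sup>2 * M\<^sup>2 * L2norm_sq ?\<zeta>"
        unfolding L2norm_sq_def S_def by simp
      then show "\<exists>u T. P n u T" unfolding P_def
        by (intro exI[of _ u] exI[of _ "\<lambda>x. trace_map (H x)"] conjI u(4-7))
    qed
    then obtain u T where P: "\<And>n. P n (u n) (T n)" by metis
    then have u: "\<And>n. L2 (u n)" "\<And>n. L2 (T n)"
      "\<And>n. L2norm_sq (\<lambda>x. u n x - \<psi> x) < inverse (real (Suc n))" "\<And>n. L2norm_sq (\<lambda>x. T n x - L x) < inverse (real (Suc n))"
      "\<And>n. c * L2norm_sq (u n) \<le> L2norm_sq (\<lambda>x. indicator S x * u n x) + \<delta>\<^sup>2 * M\<^sup>2 * L2norm_sq (\<lambda>x. - T n x + V x * u n x)"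
      unfolding P_def by blast+
    have sandwich: "q \<longlonglongrightarrow> 0" if "\<And>n. 0 \<le> q n" "\<And>n. q n < inverse (real (Suc n))" for q :: "nat \<Rightarrow> real"
      by (rule tendsto_sandwich[OF _ _ tendsto_const LIMSEQ_inverse_real_of_nat])
        (use that in \<open>auto intro!: always_eventually intro: less_imp_le simp del: of_nat_Suc\<close>)
    have lu: "(\<lambda>n. L2norm_sq (\<lambda>x. u n x - \<psi> x)) \<longlonglongrightarrow> 0" and lT: "(\<lambda>n. L2norm_sq (\<lambda>x. T n x - L x)) \<longlonglongrightarrow> 0"
      by (rule sandwich[OF L2norm_sq_nonneg u(3)], rule sandwich[OF L2norm_sq_nonneg u(4)])
    have S1: "\<bar>indicator S x\<bar> \<le> (1::real)" for x by (simp add: indicator_def)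
    have l1: "(\<lambda>n. L2norm_sq (u n)) \<longlonglongrightarrow> L2norm_sq \<psi>"
      by (rule L2norm_sq_tendsto[OF L2\<psi> u(1) lu])
    have l2: "(\<lambda>n. L2norm_sq (\<lambda>x. indicator S x * u n x)) \<longlonglongrightarrow> L2norm_sq (\<lambda>x. indicator S x * \<psi> x)"
    proof (rule L2norm_sq_tendsto)
      show "L2 (\<lambda>x. indicator S x * \<psi> x)" "L2 (\<lambda>x. indicator S x * u n x)" for n
        by (intro L2_mult_bounded(1)[OF S S1] L2\<psi> u)+
      have "L2norm_sq (\<lambda>x. indicator S x * u n x - indicator S x * \<psi> x) \<le> 1\<^sup>2 * L2norm_sq (\<lambda>x. u n x - \<psi> x)" for n
        unfolding right_diff_distrib[symmetric] by (intro L2_mult_bounded(2)[OF S S1] L2_diff L2\<psi> u)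
      then show "(\<lambda>n. L2norm_sq (\<lambda>x. indicator S x * u n x - indicator S x * \<psi> x)) \<longlonglongrightarrow> 0"
        by (intro tendsto_sandwich[OF _ _ tendsto_const lu]) (auto intro!: always_eventually L2norm_sq_nonneg)
    qed
    have l3: "(\<lambda>n. L2norm_sq (\<lambda>x. - T n x + V x * u n x)) \<longlonglongrightarrow> L2norm_sq (\<lambda>x. - L x + V x * \<psi> x)"
    proof (rule L2norm_sq_tendsto)
      show "L2 (\<lambda>x. - L x + V x * \<psi> x)" "L2 (\<lambda>x. - T n x + V x * u n x)" for n
        using L2_diff[OF L2_mult_bounded(1)[OF V(1) B L2\<psi>] L2L] L2_diff[OF L2_mult_bounded(1)[OF V(1) B u(1)] u(2)]
        by simp_all
      have le: "L2norm_sq (\<lambda>x. (- T n x + V x * u n x) - (- L x + V x * \<psi> x)) \<le>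
        2 * L2norm_sq (\<lambda>x. T n x - L x) + 2 * (B\<^sup>2 * L2norm_sq (\<lambda>x. u n x - \<psi> x))" for n
      proof -
        have L2V: "L2 (\<lambda>x. V x * (u n x - \<psi> x))" by (intro L2_mult_bounded(1)[OF V(1) B] L2_diff L2\<psi> u)
        have "L2norm_sq (\<lambda>x. (- T n x + V x * u n x) - (- L x + V x * \<psi> x)) =
          L2norm_sq (\<lambda>x. (L x - T n x) + V x * (u n x - \<psi> x))"
          by (simp add: algebra_simps)
        also have "\<dots> \<le> 2 * L2norm_sq (\<lambda>x. L x - T n x) + 2 * L2norm_sq (\<lambda>x. V x * (u n x - \<psi> x))"
          by (intro L2norm_sq_add_le L2V L2_diff L2L u)
        also have "L2norm_sq (\<lambda>x. L x - T n x) = L2norm_sq (\<lambda>x. T n x - L x)"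
          unfolding L2norm_sq_def by (simp add: power2_commute)
        also have "2 * L2norm_sq (\<lambda>x. T n x - L x) + 2 * L2norm_sq (\<lambda>x. V x * (u n x - \<psi> x)) \<le>
           2 * L2norm_sq (\<lambda>x. T n x - L x) + 2 * (B\<^sup>2 * L2norm_sq (\<lambda>x. u n x - \<psi> x))"
          by (intro add_left_mono mult_left_mono L2_mult_bounded(2)[OF V(1) B] L2_diff L2\<psi> u) auto
        finally show ?thesis .
      qed
      have "(\<lambda>n. 2 * L2norm_sq (\<lambda>x. T n x - L x) + 2 * (B\<^sup>2 * L2norm_sq (\<lambda>x. u n x - \<psi> x))) \<longlonglongrightarrow> 2 * 0 + 2 * (B\<^sup>2 * 0)"
        by (intro tendsto_intros lu lT)
      then have lim: "(\<lambda>n. 2 * L2norm_sq (\<lambda>x. T n x - L x) + 2 * (B\<^sup>2 * L2norm_sq (\<lambda>x. u n x - \<psi> x))) \<longlonglongrightarrow> 0"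
        by simp
      show "(\<lambda>n. L2norm_sq (\<lambda>x. (- T n x + V x * u n x) - (- L x + V x * \<psi> x))) \<longlonglongrightarrow> 0"
        by (rule tendsto_sandwich[OF always_eventually always_eventually tendsto_const lim])
          (intro allI L2norm_sq_nonneg le)+
    qed
    have "c * L2norm_sq \<psi> \<le> L2norm_sq (\<lambda>x. indicator S x * \<psi> x) + \<delta>\<^sup>2 * M\<^sup>2 * L2norm_sq (\<lambda>x. - L x + V x * \<psi> x)"
    proof (rule LIMSEQ_le)
      show "(\<lambda>n. c * L2norm_sq (u n)) \<longlonglongrightarrow> c * L2norm_sq \<psi>" by (intro tendsto_intros l1)
      show "(\<lambda>n. L2norm_sq (\<lambda>x. indicator S x * u n x) + \<delta>\<^sup>2 * M\<^sup>2 * L2norm_sq (\<lambda>x. - T n x + V x * u n x))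
        \<longlonglongrightarrow> L2norm_sq (\<lambda>x. indicator S x * \<psi> x) + \<delta>\<^sup>2 * M\<^sup>2 * L2norm_sq (\<lambda>x. - L x + V x * \<psi> x)"
        by (intro tendsto_intros l2 l3)
    qed (use u(5) in blast)
    then show "(\<delta> / M) powr (K1 * (1 + M powr (4/3) * Linf_norm V powr (2/3))) * L2norm_sq \<psi>
         \<le> L2norm_sq (\<lambda>x. indicator (S_set M \<delta> Z) x * \<psi> x)
           + \<delta>\<^sup>2 * M\<^sup>2 * L2norm_sq (\<lambda>x. - L x + V x * \<psi> x)"
      unfolding c_def N_def S_def .
  qed
qed

end
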